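(* Let $\Omega\subset\mathbb R^d$ be a domain satisfying condition (M). Then $$\liminf_{z\to+\infty}R_2(z)\,z^{-2-\frac d2}\ge\frac{8}{(d+2)(d+4)}(2\pi)^{-d}B_d|\Omega|.$$
   Context: Buckling eigenvalues $0<\sigma_1\le\sigma_2\le\dots$ of $\Omega$ (with multiplicity): eigenvalues of $v\in H^2_0(\Omega)\setminus\{0\}$, $\int_\Omega\Delta v\Delta\phi=\sigma\int_\Omega\nabla v\cdot\nabla\phi$ for all $\phi\in H^2_0(\Omega)$, where $H^2_0(\Omega)$ is the closure of $C_c^\infty(\Omega)$ in the norm $(\|f\|_2^2+\|\Delta f\|_2^2)^{1/2}$. $R_2(z)=\sum_j(z-\sigma_j)_+^2$, $a_+=\max\{a,0\}$. Condition (M): with $\omega_h=\{x\in\Omega:\operatorname{dist}(x,\partial\Omega)<h\}$, $|\Omega|<\infty$ and $\limsup_{h\to0^+}|\omega_h|/h^\gamma<\infty$ for some $\gamma\in(0,1]$. $B_d$ is the volume of the unit ball of $\mathbb R^d$. *)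

theory Defs
  imports "HOL-Analysis.Analysis"
begin

primrec dpart :: "'a::euclidean_space list \<Rightarrow> ('a \<Rightarrow> real) \<Rightarrow> 'a \<Rightarrow> real" where
  "dpart [] f = f"
| "dpart (b # bs) f = (\<lambda>x. frechet_derivative (dpart bs f) (at x) b)"

definition grad :: "('a::euclidean_space \<Rightarrow> real) \<Rightarrow> 'a \<Rightarrow> 'a" where
  "grad f x = (\<Sum>b\<in>Basis. dpart [b] f x *\<^sub>R b)"

definition lap :: "('a::euclidean_space \<Rightarrow> real) \<Rightarrow> 'a \<Rightarrow> real" where
  "lap f x = (\<Sum>b\<in>Basis. dpart [b, b] f x)"

definition test_fun :: "'a::euclidean_space set \<Rightarrow> ('a \<Rightarrow> real) \<Rightarrow> bool" where
  "test_fun \<Omega> f \<longleftrightarrow>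
     (\<forall>bs. set bs \<subseteq> Basis \<longrightarrow> (\<forall>x. dpart bs f differentiable (at x))) \<and>
     compact (closure {x. f x \<noteq> 0}) \<and> closure {x. f x \<noteq> 0} \<subseteq> \<Omega>"

definition l2dist :: "'a::euclidean_space set \<Rightarrow> ('a \<Rightarrow> 'b::real_normed_vector) \<Rightarrow> ('a \<Rightarrow> 'b) \<Rightarrow> ennreal" where
  "l2dist \<Omega> f g = (\<integral>\<^sup>+x\<in>\<Omega>. ennreal ((norm (f x - g x))\<^sup>2) \<partial>lebesgue)"

text \<open>v belongs to H^2_0(Omega) (closure of C_c^infinity in the norm (||f||^2+||Lap f||^2)^(1/2)),
  with gradient g and Laplacian L, these being the L2 limits of the gradients / Laplacians
  of an approximating sequence of test functions.\<close>
definition H20 :: "'a::euclidean_space set \<Rightarrow> ('a \<Rightarrow> real) \<Rightarrow> ('a \<Rightarrow> 'a) \<Rightarrow> ('a \<Rightarrow> real) \<Rightarrow> bool" where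
  "H20 \<Omega> v g L \<longleftrightarrow>
     v \<in> borel_measurable lebesgue \<and> g \<in> borel_measurable lebesgue \<and> L \<in> borel_measurable lebesgue \<and>
     (\<exists>\<phi>. (\<forall>n. test_fun \<Omega> (\<phi> n)) \<and>
        (\<lambda>n. l2dist \<Omega> (\<phi> n) v) \<longlonglongrightarrow> 0 \<and>
        (\<lambda>n. l2dist \<Omega> (grad (\<phi> n)) g) \<longlonglongrightarrow> 0 \<and>
        (\<lambda>n. l2dist \<Omega> (lap (\<phi> n)) L) \<longlonglongrightarrow> 0)"

definition buckling_eigenspace :: "'a::euclidean_space set \<Rightarrow> real \<Rightarrow> ('a \<Rightarrow> real) \<Rightarrow> bool" where
  "buckling_eigenspace \<Omega> \<sigma> v \<longleftrightarrow>
     (\<exists>g L. H20 \<Omega> v g L \<and>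
        (\<forall>\<psi> g' L'. H20 \<Omega> \<psi> g' L' \<longrightarrow>
           (LINT x:\<Omega>|lebesgue. L x * L' x) = \<sigma> * (LINT x:\<Omega>|lebesgue. g x \<bullet> g' x)))"

definition buckling_mult :: "'a::euclidean_space set \<Rightarrow> real \<Rightarrow> nat" where
  "buckling_mult \<Omega> \<sigma> = Sup {n. \<exists>vs :: nat \<Rightarrow> 'a \<Rightarrow> real.
      (\<forall>i<n. buckling_eigenspace \<Omega> \<sigma> (vs i)) \<and>
      (\<forall>c :: nat \<Rightarrow> real. (AE x in lebesgue. x \<in> \<Omega> \<longrightarrow> (\<Sum>i<n. c i * vs i x) = 0)
          \<longrightarrow> (\<forall>i<n. c i = 0))}"

definition R2 :: "'a::euclidean_space set \<Rightarrow> real \<Rightarrow> real" where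
  "R2 \<Omega> z = (\<Sum>\<sigma>\<in>{\<sigma>. 0 < buckling_mult \<Omega> \<sigma> \<and> \<sigma> < z}.
                 real (buckling_mult \<Omega> \<sigma>) * (z - \<sigma>)\<^sup>2)"

definition boundary_strip :: "'a::euclidean_space set \<Rightarrow> real \<Rightarrow> 'a set" where
  "boundary_strip \<Omega> h = {x\<in>\<Omega>. infdist x (frontier \<Omega>) < h}"

definition condition_M :: "'a::euclidean_space set \<Rightarrow> bool" where
  "condition_M \<Omega> \<longleftrightarrow> emeasure lebesgue \<Omega> < \<infinity> \<and>
     (\<exists>\<gamma>. 0 < \<gamma> \<and> \<gamma> \<le> 1 \<and>
        Limsup (at_right 0) (\<lambda>h. ereal (measure lebesgue (boundary_strip \<Omega> h) / h powr \<gamma>)) < \<infinity>)"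

end

theory Submission
  imports Defs "HOL-Library.Function_Algebras" "HOL-Library.Diagonal_Subsequence"
begin

text \<open>
  Completeness of \<open>H\<^sup>2\<^sub>0\<close> in the gradient norm is combined with averages over a grid of small cubes:
  outside finitely many linear functionals, the energy of the gradient is dominated by a small multiple
  of that of the Laplacian. Hence every maximal family of \<open>(\<integral>\<nabla>u\<bullet>\<nabla>w)\<close>-orthonormal eigenfunctions with
  \<open>\<sigma> < z\<close> is finite, and its members are found by maximising the quotient of the two forms.

  For the lower bound fix \<open>\<phi> \<in> C\<^sub>c\<^sup>\<infinity>(\<Omega>)\<close> with values in \<open>[0,1]\<close> and \<open>\<integral>\<phi>\<^sup>2\<close> close to \<open>|\<Omega>|\<close>, and let \<open>p\<close> run through
  the lattice dual to a large cube containing the support of \<open>\<phi>\<close>. The trial functions \<open>\<phi> cos (p \<bullet> x)\<close> and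
  \<open>\<phi> sin (p \<bullet> x)\<close> have a joint Rayleigh quotient \<open>|p|\<^sup>2 + O(1)\<close>. Expanding them in the eigenfunctions, weighting
  the resulting inequalities by \<open>(z - |p|\<^sup>2 - O(1))\<^sub>+\<close> and summing over \<open>p\<close>, Bessel's inequality on the cube
  bounds the total weight of each eigenfunction by its gradient energy, up to a factor close to 1. This bounds
  \<open>R\<^sub>2(z)\<close> from below by a Riemann sum for \<open>\<integral>(z - |p|\<^sup>2)\<^sub>+\<^sup>2 dp\<close>, which gives the constant. Summing over a
  lattice and using Bessel's inequality takes the place of Plancherel's theorem.
\<close>

section \<open>Pairs of positive semidefinite forms\<close>

text \<open>One obstacle sits in \<open>R2\<close> and \<open>buckling_mult\<close>: a
  \<open>sum\<close> over an infinite set is 0, and \<open>Sup\<close> of an unbounded set of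
  naturals carries no information. Even a lower bound on \<open>R2\<close> therefore needs finitely
  many eigenvalues below \<open>z\<close>, each of finite multiplicity. No completeness of the
  eigenfunctions is needed: for a B-orthonormal family e_i that cannot be enlarged, z B(w,w) -
  A(w,w) is at most the sum of (z - s_i) B(w,e_i)^2, and this with Bessel's inequality is the whole
  spectral input. Vectors are functions, not classes modulo null sets, so the forms are only
  semidefinite.

  The trial pair at p has gradient energy at least |p|^2 times the mass of the cutoff, so each
  inequality is divided by |p|^2 before summation. Small p, for which the gradient of the cutoff
  competes with |p|, are left out; this costs O(z^2), which is below the order z^(2+d/2). The mesh
  of the lattice depends on the support of the cutoff only and stays fixed as z grows: rounding to
  the lattice merely shifts z by a constant and costs a factor 1 + \<eta>, removed at the
  end.\<close>

definition psd_form :: "'v::real_vector set \<Rightarrow> ('v \<Rightarrow> 'v \<Rightarrow> real) \<Rightarrow> bool" where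
  "psd_form H F \<longleftrightarrow> subspace H \<and>
     (\<forall>u\<in>H. \<forall>w\<in>H. F u w = F w u) \<and>
     (\<forall>u\<in>H. \<forall>v\<in>H. \<forall>w\<in>H. F (u + v) w = F u w + F v w) \<and>
     (\<forall>c. \<forall>u\<in>H. \<forall>w\<in>H. F (c *\<^sub>R u) w = c * F u w) \<and>
     (\<forall>u\<in>H. 0 \<le> F u u)"

lemma psd_form_subspace: "psd_form H F \<Longrightarrow> subspace H"
  by (simp add: psd_form_def)

lemma psd_form_sym: "psd_form H F \<Longrightarrow> u \<in> H \<Longrightarrow> w \<in> H \<Longrightarrow> F u w = F w u"
  by (simp add: psd_form_def)

lemma psd_form_nonneg: "psd_form H F \<Longrightarrow> u \<in> H \<Longrightarrow> 0 \<le> F u u"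
  by (simp add: psd_form_def)

lemma psd_form_add_left:
  "psd_form H F \<Longrightarrow> u \<in> H \<Longrightarrow> v \<in> H \<Longrightarrow> w \<in> H \<Longrightarrow> F (u + v) w = F u w + F v w"
  by (simp add: psd_form_def)

lemma psd_form_scale_left:
  "psd_form H F \<Longrightarrow> u \<in> H \<Longrightarrow> w \<in> H \<Longrightarrow> F (c *\<^sub>R u) w = c * F u w"
  by (simp add: psd_form_def)

lemma psd_form_add_right:
  assumes "psd_form H F" "u \<in> H" "v \<in> H" "w \<in> H"
  shows "F w (u + v) = F w u + F w v"
  using assms psd_form_sym[OF assms(1)] psd_form_add_left[OF assms(1)]
    subspace_add[OF psd_form_subspace[OF assms(1)]] by metis

lemma psd_form_scale_right:
  assumes "psd_form H F" "u \<in> H" "w \<in> H"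
  shows "F w (c *\<^sub>R u) = c * F w u"
  using assms psd_form_sym[OF assms(1)] psd_form_scale_left[OF assms(1)]
    subspace_scale[OF psd_form_subspace[OF assms(1)]] by metis

lemma psd_form_zero_left: "psd_form H F \<Longrightarrow> w \<in> H \<Longrightarrow> F 0 w = 0"
  using psd_form_scale_left[of H F w w 0] by simp

lemma psd_form_diff_left:
  assumes "psd_form H F" "u \<in> H" "v \<in> H" "w \<in> H"
  shows "F (u - v) w = F u w - F v w"
proof -
  have S: "subspace H" by (rule psd_form_subspace[OF assms(1)])
  have "F (u + (-1) *\<^sub>R v) w = F u w + (-1) * F v w"
    using assms psd_form_add_left[OF assms(1), of u "(-1) *\<^sub>R v" w]
      psd_form_scale_left[OF assms(1), of v w "-1"] subspace_scale[OF S] by metis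
  then show ?thesis by simp
qed

lemma psd_form_diff_right:
  assumes "psd_form H F" "u \<in> H" "v \<in> H" "w \<in> H"
  shows "F w (u - v) = F w u - F w v"
  using assms psd_form_sym[OF assms(1)] psd_form_diff_left[OF assms(1)]
    subspace_diff[OF psd_form_subspace[OF assms(1)]] by metis

lemma psd_form_sum_left:
  assumes "psd_form H F" "\<And>i. i \<in> I \<Longrightarrow> u i \<in> H" "w \<in> H"
  shows "F (\<Sum>i\<in>I. c i *\<^sub>R u i) w = (\<Sum>i\<in>I. c i * F (u i) w)"
  using assms(2)
proof (induction I rule: infinite_finite_induct)
  case (insert x I)
  have S: "subspace H" by (rule psd_form_subspace[OF assms(1)])
  have "(\<Sum>i\<in>I. c i *\<^sub>R u i) \<in> H"
    using insert S by (intro subspace_sum subspace_scale) auto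
  moreover have "c x *\<^sub>R u x \<in> H" using insert S subspace_scale by blast
  ultimately have "F (c x *\<^sub>R u x + (\<Sum>i\<in>I. c i *\<^sub>R u i)) w
      = F (c x *\<^sub>R u x) w + F (\<Sum>i\<in>I. c i *\<^sub>R u i) w"
    using psd_form_add_left[OF assms(1)] assms(3) by blast
  then show ?case
    using insert psd_form_scale_left[OF assms(1), of "u x" w "c x"] assms(3) by simp
qed (use assms psd_form_zero_left in auto)

lemma psd_form_sum_right:
  assumes "psd_form H F" "\<And>i. i \<in> I \<Longrightarrow> u i \<in> H" "w \<in> H"
  shows "F w (\<Sum>i\<in>I. c i *\<^sub>R u i) = (\<Sum>i\<in>I. c i * F w (u i))"
proof -
  have S: "subspace H" by (rule psd_form_subspace[OF assms(1)])
  have "(\<Sum>i\<in>I. c i *\<^sub>R u i) \<in> H"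
    using assms S by (intro subspace_sum subspace_scale) auto
  then have "F w (\<Sum>i\<in>I. c i *\<^sub>R u i) = F (\<Sum>i\<in>I. c i *\<^sub>R u i) w"
    using psd_form_sym[OF assms(1)] assms(3) by blast
  also have "\<dots> = (\<Sum>i\<in>I. c i * F (u i) w)" by (rule psd_form_sum_left[OF assms]) auto
  also have "\<dots> = (\<Sum>i\<in>I. c i * F w (u i))"
    using psd_form_sym[OF assms(1)] assms(2,3) by (intro sum.cong) auto
  finally show ?thesis .
qed

lemma psd_form_quadratic:
  assumes "psd_form H F" "u \<in> H" "w \<in> H"
  shows "F (u + t *\<^sub>R w) (u + t *\<^sub>R w) = F u u + 2 * t * F u w + t\<^sup>2 * F w w"
proof -
  have tw: "t *\<^sub>R w \<in> H"
    using assms subspace_scale psd_form_subspace by blast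
  have utw: "u + t *\<^sub>R w \<in> H"
    using assms tw subspace_add psd_form_subspace by blast
  show ?thesis
    using assms tw utw psd_form_sym[OF assms(1), of w u]
    by (simp add: psd_form_add_left[OF assms(1)] psd_form_add_right[OF assms(1)]
        psd_form_scale_left[OF assms(1)] psd_form_scale_right[OF assms(1)]
        power2_eq_square algebra_simps)
qed

text \<open>First variation: the test value t = -a/B with B = |b| + 1 makes the polynomial at most
  -a^2/B. It is applied at a maximiser of the quotient of two forms.\<close>

lemma linear_coeff_zero_if_nonneg:
  fixes a b :: real
  assumes "\<And>t. 0 \<le> 2 * t * a + t\<^sup>2 * b"
  shows "a = 0"
proof (rule ccontr)
  assume a: "a \<noteq> 0"
  define B where "B = \<bar>b\<bar> + 1"
  have B: "B > 0" "b \<le> B" "B \<noteq> 0" unfolding B_def by auto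
  have "0 \<le> 2 * (- a / B) * a + (- a / B)\<^sup>2 * b" by (rule assms)
  also have "\<dots> \<le> 2 * (- a / B) * a + (- a / B)\<^sup>2 * B"
    using B by (intro add_left_mono mult_left_mono) auto
  also have "\<dots> = - (a\<^sup>2 / B)" using B by (simp add: field_simps power2_eq_square)
  also have "\<dots> < 0" using a B by simp
  finally show False by simp
qed

text \<open>Since \<open>F\<close> may have null vectors, the case \<open>F w w = 0\<close> is
  separate: there \<open>F u u + 2 * s * F u w\<close> is affine in \<open>s\<close> and
  nonnegative, which forces \<open>F u w = 0\<close>. Otherwise the minimising multiple of
  \<open>w\<close> is added to \<open>u\<close>.\<close>

lemma psd_form_Cauchy_Schwarz:
  assumes "psd_form H F" "u \<in> H" "w \<in> H"
  shows "(F u w)\<^sup>2 \<le> F u u * F w w"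
proof (cases "F w w = 0")
  case True
  have "F w u = 0"
  proof (rule linear_coeff_zero_if_nonneg)
    fix t :: real
    have nn: "0 \<le> F (t *\<^sub>R u + s *\<^sub>R w) (t *\<^sub>R u + s *\<^sub>R w)" for s t
      using psd_form_nonneg[OF assms(1)] assms(2,3) psd_form_subspace[OF assms(1)]
      by (simp add: subspace_add subspace_scale)
    have *: "0 \<le> F u u + 2 * s * F u w" for s
      using nn[of 1 s] psd_form_quadratic[OF assms, of s] True by simp
    have "F u w = 0"
    proof (rule ccontr)
      assume "F u w \<noteq> 0"
      then have "F u u + 2 * (- (F u u + 1) / (2 * F u w)) * F u w = - 1"
        by (simp add: field_simps)
      then show False using *[of "- (F u u + 1) / (2 * F u w)"] by simp
    qed
    then show "0 \<le> 2 * t * F w u + t\<^sup>2 * 0"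
      using psd_form_sym[OF assms] by simp
  qed
  then show ?thesis using True psd_form_sym[OF assms] by simp
next
  case False
  then have pos: "F w w > 0" using psd_form_nonneg[OF assms(1,3)] by simp
  have "0 \<le> F (u + (- F u w / F w w) *\<^sub>R w) (u + (- F u w / F w w) *\<^sub>R w)"
    using psd_form_nonneg[OF assms(1)] assms(2,3) psd_form_subspace[OF assms(1)]
    by (simp add: subspace_add subspace_scale subspace_diff)
  also have "\<dots> = F u u - (F u w)\<^sup>2 / F w w"
    using pos unfolding psd_form_quadratic[OF assms] by (simp add: field_simps power2_eq_square)
  finally show ?thesis using pos by (simp add: field_simps)
qed

text \<open>Gaussian elimination, by induction on the number of equations. Working with coefficients
  instead of subspaces suits families whose independence is itself in question.\<close>

lemma homogeneous_system_nontrivial: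
  fixes L :: "nat \<Rightarrow> 'i \<Rightarrow> real"
  assumes "finite I" "m < card I"
  shows "\<exists>c. (\<exists>i\<in>I. c i \<noteq> 0) \<and> (\<forall>k<m. (\<Sum>i\<in>I. c i * L k i) = 0)"
  using assms
proof (induction m arbitrary: I L)
  case 0
  then obtain i where "i \<in> I" by fastforce
  then show ?case by (intro exI[of _ "\<lambda>_. 1"]) auto
next
  case (Suc m)
  show ?case
  proof (cases "\<forall>i\<in>I. L m i = 0")
    case True
    obtain c where c: "\<exists>i\<in>I. c i \<noteq> 0" "\<forall>k<m. (\<Sum>i\<in>I. c i * L k i) = 0"
      using Suc.IH[OF Suc.prems(1), of L] Suc.prems(2) by auto
    have "\<forall>k<Suc m. (\<Sum>i\<in>I. c i * L k i) = 0"
      using c(2) True by (auto simp: less_Suc_eq)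
    then show ?thesis using c(1) by blast
  next
    case False
    then obtain j where j: "j \<in> I" "L m j \<noteq> 0" by blast
    \<comment> \<open>Unknown \<open>j\<close> is eliminated from the other equations with equation
      \<open>m\<close> as pivot; \<open>c'\<close> below recovers its value from equation
      \<open>m\<close>.\<close>
    define L' where "L' = (\<lambda>k i. L k i - L k j * L m i / L m j)"
    have "m < card (I - {j})" using Suc.prems j by auto
    then obtain c where c: "\<exists>i\<in>I - {j}. c i \<noteq> 0" "\<forall>k<m. (\<Sum>i\<in>I - {j}. c i * L' k i) = 0"
      using Suc.IH[of "I - {j}" L'] Suc.prems(1) by auto
    define s where "s = (\<Sum>i\<in>I - {j}. c i * L m i)"
    define c' where "c' = c(j := - s / L m j)"
    have sum': "(\<Sum>i\<in>I. c' i * L k i) = (\<Sum>i\<in>I - {j}. c i * L k i) - s / L m j * L k j" for k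
      using Suc.prems(1) j by (simp add: sum.remove c'_def)
    have "(\<Sum>i\<in>I. c' i * L k i) = 0" if "k < Suc m" for k
    proof (cases "k = m")
      case True
      then show ?thesis using sum'[of k] j(2) by (simp add: s_def)
    next
      case False
      then have "k < m" using that by simp
      then have "0 = (\<Sum>i\<in>I - {j}. c i * L' k i)" using c(2) by simp
      also have "\<dots> = (\<Sum>i\<in>I - {j}. c i * L k i) - s / L m j * L k j"
      proof -
        have *: "c i * L' k i = c i * L k i - c i * L m i * (L k j / L m j)" for i
          unfolding L'_def by (simp add: algebra_simps)
        have "s / L m j * L k j = (\<Sum>i\<in>I - {j}. c i * L m i * (L k j / L m j))"
          unfolding s_def sum_distrib_right[symmetric] by simp
        then show ?thesis by (simp only: sum_subtractf *)
      qed
      finally show ?thesis using sum' by simp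
    qed
    moreover have "\<exists>i\<in>I. c' i \<noteq> 0" using c(1) unfolding c'_def by auto
    ultimately show ?thesis by blast
  qed
qed

text \<open>\<open>finite_rank\<close> is a quantitative form of compactness of \<open>B\<close>
  relative to \<open>A\<close>: up to a small multiple of \<open>A\<close>, \<open>B\<close> is
  controlled by finitely many \<open>A\<close>-bounded functionals. \<open>H\<close> carries no
  topology, so completeness is phrased with sequences; limits are determined only up to
  \<open>A\<close>-null vectors.\<close>

locale compact_form_pair =
  fixes H :: "'v::real_vector set" and A B :: "'v \<Rightarrow> 'v \<Rightarrow> real"
  assumes psdA: "psd_form H A" and psdB: "psd_form H B"
    and finite_rank: "\<And>\<epsilon>. 0 < \<epsilon> \<Longrightarrow> \<exists>n l K.
        (\<forall>i<n. \<forall>u\<in>H. \<forall>w\<in>H. l i (u + w) = l i u + l i w) \<and>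
        (\<forall>i<n. \<forall>c. \<forall>u\<in>H. l i (c *\<^sub>R u) = c * l i u) \<and>
        (\<forall>i<n. \<forall>u\<in>H. (l i u)\<^sup>2 \<le> K * A u u) \<and>
        (\<forall>u\<in>H. B u u \<le> (\<Sum>i<(n::nat). (l i u)\<^sup>2) + \<epsilon> * A u u)"
    and A_complete: "\<And>X. (\<And>n. X n \<in> H) \<Longrightarrow>
        (\<And>e. 0 < e \<Longrightarrow> \<exists>M. \<forall>m\<ge>M. \<forall>n\<ge>M. A (X m - X n) (X m - X n) < e) \<Longrightarrow>
        \<exists>u\<in>H. (\<lambda>n. A (X n - u) (X n - u)) \<longlonglongrightarrow> 0"
begin

section \<open>Consequences of relative compactness\<close>

lemma sub: "subspace H" by (rule psd_form_subspace[OF psdA])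

lemmas subH = subspace_add[OF sub] subspace_scale[OF sub] subspace_diff[OF sub] subspace_0[OF sub]

text \<open>The finite rank bound at \<epsilon> = 1 with each functional estimated by
  \<open>A\<close>. The absolute value of \<open>K\<close> enters because its sign is not
  prescribed.\<close>

lemma B_le_A: "\<exists>K>0. \<forall>u\<in>H. B u u \<le> K * A u u"
proof -
  obtain n l K where nl: "\<forall>i<n. \<forall>u\<in>H. (l i u)\<^sup>2 \<le> K * A u u"
    "\<forall>u\<in>H. B u u \<le> (\<Sum>i<(n::nat). (l i u)\<^sup>2) + 1 * A u u"
    using finite_rank[of 1] by auto
  have "B u u \<le> (real n * \<bar>K\<bar> + 1) * A u u" if u: "u \<in> H" for u
  proof -
    have "(\<Sum>i<n. (l i u)\<^sup>2) \<le> (\<Sum>i<n. \<bar>K\<bar> * A u u)"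
    proof (rule sum_mono)
      fix i assume "i \<in> {..<n}"
      then have "(l i u)\<^sup>2 \<le> K * A u u" using nl u by auto
      also have "\<dots> \<le> \<bar>K\<bar> * A u u"
        using psd_form_nonneg[OF psdA u] by (intro mult_right_mono) auto
      finally show "(l i u)\<^sup>2 \<le> \<bar>K\<bar> * A u u" .
    qed
    then show ?thesis using nl(2) u by (force simp: algebra_simps)
  qed
  then show ?thesis
    by (intro exI[of _ "real n * \<bar>K\<bar> + 1"]) (auto intro: add_nonneg_pos)
qed

text \<open>Take the \<open>N\<close> functionals for \<epsilon> = 1/(2z). More than
  \<open>N\<close> vectors have a nontrivial combination \<open>w\<close> annihilated by all of
  them, whence A(w,w) \<le> z B(w,w) \<le> A(w,w)/2 and A(w,w) = 0. The implication on the
  coefficients replaces linear independence, which the callers verify in different ways.\<close>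

lemma finite_dimension_bound:
  assumes "0 < z"
  shows "\<exists>N. \<forall>n u. (\<forall>i<n. u i \<in> H) \<longrightarrow>
     (\<forall>c. let w = (\<Sum>i<n. c i *\<^sub>R u i) in A w w \<le> z * B w w \<and> (A w w = 0 \<longrightarrow> (\<forall>i<(n::nat). c i = 0)))
     \<longrightarrow> n \<le> N"
proof -
  obtain N l K where l_add: "\<forall>i<N. \<forall>u\<in>H. \<forall>w\<in>H. l i (u + w) = l i u + l i w"
    and l_scale: "\<forall>i<N. \<forall>c. \<forall>u\<in>H. l i (c *\<^sub>R u) = c * l i u"
    and l_app: "\<forall>u\<in>H. B u u \<le> (\<Sum>i<(N::nat). (l i u)\<^sup>2) + 1 / (2 * z) * A u u"
    using finite_rank[of "1 / (2 * z)"] assms by (auto simp del: mult_divide_mult_cancel_left_if)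
  have l_sum: "l k (\<Sum>i\<in>I. c i *\<^sub>R u i) = (\<Sum>i\<in>I. c i * l k (u i))"
    if "k < N" "finite I" "\<And>i. i \<in> I \<Longrightarrow> u i \<in> H" for k I and c :: "nat \<Rightarrow> real" and u
    using that(2,3)
  proof (induction I)
    case empty
    have "l k (0 *\<^sub>R 0) = 0 * l k 0" using l_scale that(1) subH(4) by blast
    then show ?case by simp
  next
    case (insert x I)
    have "(\<Sum>i\<in>I. c i *\<^sub>R u i) \<in> H"
      using insert sub by (intro subspace_sum subspace_scale) auto
    moreover have "c x *\<^sub>R u x \<in> H" using insert subH by blast
    ultimately show ?case
      using insert l_add l_scale that(1) by simp
  qed
  show ?thesis
  proof (intro exI[of _ N] allI impI)
    fix n :: nat and u
    assume uH: "\<forall>i<n. u i \<in> H"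
      and u: "\<forall>c. let w = (\<Sum>i<n. c i *\<^sub>R u i) in A w w \<le> z * B w w \<and> (A w w = 0 \<longrightarrow> (\<forall>i<n. c i = 0))"
    show "n \<le> N"
    proof (rule ccontr)
      assume "\<not> n \<le> N"
      then obtain c where c: "\<exists>i<n. c i \<noteq> 0" "\<forall>k<N. (\<Sum>i<n. c i * l k (u i)) = 0"
        using homogeneous_system_nontrivial[of "{..<n}" N "\<lambda>k i. l k (u i)"] by auto
      define w where "w = (\<Sum>i<n. c i *\<^sub>R u i)"
      have wH: "w \<in> H" unfolding w_def using uH sub by (intro subspace_sum subspace_scale) auto
      have "l k w = 0" if "k < N" for k
        unfolding w_def using l_sum[OF that, of "{..<n}" u c] uH c(2) that by auto
      then have "B w w \<le> 1 / (2 * z) * A w w" using l_app wH by force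
      moreover have "A w w \<le> z * B w w" using u unfolding w_def Let_def by blast
      ultimately have "A w w \<le> z * (1 / (2 * z) * A w w)"
        using assms by (meson less_eq_real_def mult_left_mono order.trans)
      then have "A w w = 0" using psd_form_nonneg[OF psdA wH] assms by simp
      then show False using u c(1) unfolding w_def Let_def by blast
    qed
  qed
qed

text \<open>The analogue of Rellich's theorem. For each accuracy 1/(k+1) the functionals are bounded
  along the sequence, and a diagonal subsequence makes all of them converge.\<close>

lemma B_Cauchy_subsequence:
  assumes XH: "\<And>n. X n \<in> H" and bd: "\<And>n. A (X n) (X n) \<le> C"
  obtains r where "strict_mono (r :: nat \<Rightarrow> nat)"
    "\<And>e. 0 < e \<Longrightarrow> \<exists>M. \<forall>m\<ge>M. \<forall>n\<ge>M. B (X (r m) - X (r n)) (X (r m) - X (r n)) < e"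
proof -
  define R where "R = (\<lambda>k n l K.
        (\<forall>i<n. \<forall>u\<in>H. \<forall>w\<in>H. l i (u + w) = l i u + l i w) \<and>
        (\<forall>i<n. \<forall>c. \<forall>u\<in>H. l i (c *\<^sub>R u) = c * l i u) \<and>
        (\<forall>i<n. \<forall>u\<in>H. (l i u)\<^sup>2 \<le> K * A u u) \<and>
        (\<forall>u\<in>H. B u u \<le> (\<Sum>i<(n::nat). (l i u)\<^sup>2) + (1 / real (Suc k)) * A u u))"
  have "\<exists>n l K. R k n l K" for k
    unfolding R_def by (intro finite_rank) simp
  then obtain N l K where R: "\<And>k. R k (N k) (l k) (K k)" by metis
  have l_add: "\<And>k i u w. i < N k \<Longrightarrow> u \<in> H \<Longrightarrow> w \<in> H \<Longrightarrow> l k i (u + w) = l k i u + l k i w"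
    and l_scale: "\<And>k i c u. i < N k \<Longrightarrow> u \<in> H \<Longrightarrow> l k i (c *\<^sub>R u) = c * l k i u"
    and l_bd: "\<And>k i u. i < N k \<Longrightarrow> u \<in> H \<Longrightarrow> (l k i u)\<^sup>2 \<le> K k * A u u"
    and l_app: "\<And>k u. u \<in> H \<Longrightarrow> B u u \<le> (\<Sum>i<(N k::nat). (l k i u)\<^sup>2) + (1 / real (Suc k)) * A u u"
    using R unfolding R_def by blast+
  \<comment> \<open>The number \<open>m\<close> encodes a pair: an accuracy level \<open>k\<close>
    and the index \<open>i\<close> of one of its functionals. Codes of nonexistent functionals hold
    vacuously.\<close>
  define P where "P = (\<lambda>m (s :: nat \<Rightarrow> nat). snd (prod_decode m) < N (fst (prod_decode m)) \<longrightarrow>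
      convergent (\<lambda>n. l (fst (prod_decode m)) (snd (prod_decode m)) (X (s n))))"
  interpret subseqs P
  proof
    fix m and s :: "nat \<Rightarrow> nat" assume s: "strict_mono s"
    define k i where "k = fst (prod_decode m)" and "i = snd (prod_decode m)"
    show "\<exists>r'. strict_mono r' \<and> P m (s \<circ> r')"
    proof (cases "i < N k")
      case True
      have "bounded (range (\<lambda>n. l k i (X (s n))))"
      proof (rule boundedI)
        fix x assume "x \<in> range (\<lambda>n. l k i (X (s n)))"
        then obtain n where x: "x = l k i (X (s n))" by auto
        have "x\<^sup>2 \<le> K k * A (X (s n)) (X (s n))" unfolding x using l_bd[OF True] XH by auto
        also have "\<dots> \<le> \<bar>K k\<bar> * A (X (s n)) (X (s n))"
          using psd_form_nonneg[OF psdA] XH by (intro mult_right_mono) auto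
        also have "\<dots> \<le> \<bar>K k\<bar> * C" using bd by (intro mult_left_mono) auto
        finally have "sqrt (x\<^sup>2) \<le> sqrt (\<bar>K k\<bar> * C)" by (rule real_sqrt_le_mono)
        then show "norm x \<le> sqrt (\<bar>K k\<bar> * C)" by simp
      qed
      then have "\<exists>L r. strict_mono r \<and> ((\<lambda>n. l k i (X (s n))) \<circ> r) \<longlonglongrightarrow> L"
        by (intro bounded_imp_convergent_subsequence) auto
      then show ?thesis unfolding P_def k_def[symmetric] i_def[symmetric] o_def convergent_def by blast
    next
      case False
      then show ?thesis unfolding P_def k_def[symmetric] i_def[symmetric]
        using strict_mono_id by auto
    qed
  qed
  have conv: "convergent (\<lambda>n. l k i (X (diagseq n)))" if "i < N k" for k i
  proof -
    define m where "m = prod_encode (k, i)"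
    have "P m (diagseq \<circ> ((+) (Suc m)))"
    proof (rule diagseq_holds)
      fix r s :: "nat \<Rightarrow> nat" and n assume "strict_mono r" "P n s"
      then show "P n (s \<circ> r)"
        unfolding P_def using convergent_subseq_convergent
        by (force simp: o_def)
    qed
    then have "convergent (\<lambda>n. l k i (X (diagseq (Suc m + n))))"
      using that unfolding P_def m_def by (simp add: o_def)
    then have "convergent (\<lambda>n. l k i (X (diagseq (n + Suc m))))" by (simp add: add.commute)
    then show ?thesis by (rule convergent_ignore_initial_segment[THEN iffD1])
  qed
  show thesis
  proof (rule that[of diagseq])
    show "strict_mono diagseq" by (rule subseq_diagseq)
    fix e :: real assume e: "0 < e"
    \<comment> \<open>The parallelogram law bounds A of a difference of two members by 4C, so this
      level leaves a remainder below e; the gap \<open>d\<close> is left for the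
      functionals.\<close>
    obtain k where k: "4 * C / e < real (Suc k)"
      using reals_Archimedean2 by (metis less_Suc_eq of_nat_less_iff order_less_trans)
    have conv': "\<exists>M. \<forall>m\<ge>M. \<forall>n\<ge>M. (\<Sum>i<N k. (l k i (X (diagseq m)) - l k i (X (diagseq n)))\<^sup>2) < d" if d: "0 < d" for d
    proof -
      have "\<exists>M. \<forall>m\<ge>M. \<forall>n\<ge>M. \<bar>l k i (X (diagseq m)) - l k i (X (diagseq n))\<bar> < sqrt (d / real (Suc (N k)))"
        if "i < N k" for i
        using conv[OF that] d unfolding Cauchy_convergent_iff[symmetric] Cauchy_def dist_real_def
        by (simp add: less_eq_real_def)
      then obtain Mf where Mf: "\<And>i m n. i < N k \<Longrightarrow> Mf i \<le> m \<Longrightarrow> Mf i \<le> n \<Longrightarrow>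
          \<bar>l k i (X (diagseq m)) - l k i (X (diagseq n))\<bar> < sqrt (d / real (Suc (N k)))" by metis
      define M where "M = Max (insert 0 (Mf ` {..<N k}))"
      have M: "Mf i \<le> M" if "i < N k" for i unfolding M_def using that by (intro Max_ge) auto
      have "(\<Sum>i<N k. (l k i (X (diagseq m)) - l k i (X (diagseq n)))\<^sup>2) < d" if "m \<ge> M" "n \<ge> M" for m n
      proof -
        have "(\<Sum>i<N k. (l k i (X (diagseq m)) - l k i (X (diagseq n)))\<^sup>2) \<le> (\<Sum>i<N k. d / real (Suc (N k)))"
        proof (rule sum_mono)
          fix i assume "i \<in> {..<N k}"
          then have "\<bar>l k i (X (diagseq m)) - l k i (X (diagseq n))\<bar> \<le> sqrt (d / real (Suc (N k)))"
            using Mf[of i m n] M[of i] that by (meson lessThan_iff less_imp_le order_trans)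
          then have "\<bar>l k i (X (diagseq m)) - l k i (X (diagseq n))\<bar>\<^sup>2 \<le> (sqrt (d / real (Suc (N k))))\<^sup>2"
            by (intro power_mono) auto
          then show "(l k i (X (diagseq m)) - l k i (X (diagseq n)))\<^sup>2 \<le> d / real (Suc (N k))"
            using d by simp
        qed
        also have "\<dots> < d" using d by (simp add: field_simps)
        finally show ?thesis .
      qed
      then show ?thesis by blast
    qed
    define d where "d = e - 4 * C / real (Suc k)"
    have d: "0 < d" unfolding d_def using k e by (simp add: field_simps)
    obtain M where M: "\<forall>m\<ge>M. \<forall>n\<ge>M. (\<Sum>i<N k. (l k i (X (diagseq m)) - l k i (X (diagseq n)))\<^sup>2) < d"
      using conv'[OF d] by blast
    have "B (X (diagseq m) - X (diagseq n)) (X (diagseq m) - X (diagseq n)) < e"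
      if "m \<ge> M" "n \<ge> M" for m n
    proof -
      let ?x = "X (diagseq m)" and ?y = "X (diagseq n)"
      have H: "?x \<in> H" "?y \<in> H" "?x - ?y \<in> H" "?x + ?y \<in> H" using XH subH by auto
      have "A (?x - ?y) (?x - ?y) + A (?x + ?y) (?x + ?y) = 2 * A ?x ?x + 2 * A ?y ?y"
        using psd_form_quadratic[OF psdA H(1,2), of "-1"] psd_form_quadratic[OF psdA H(1,2), of 1]
        by simp
      then have "A (?x - ?y) (?x - ?y) \<le> 4 * C"
        using bd[of "diagseq m"] bd[of "diagseq n"] psd_form_nonneg[OF psdA H(4)] by linarith
      then have "1 / real (Suc k) * A (?x - ?y) (?x - ?y) \<le> 1 / real (Suc k) * (4 * C)"
        by (intro mult_left_mono) auto
      moreover have "l k i (?x - ?y) = l k i ?x - l k i ?y" if "i < N k" for i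
      proof -
        have "l k i (?x + (-1) *\<^sub>R ?y) = l k i ?x + (-1) * l k i ?y"
          using l_add[OF that H(1), of "(-1) *\<^sub>R ?y"] l_scale[OF that H(2), of "-1"] H(2) subH(2) by metis
        then show ?thesis by simp
      qed
      then have "(\<Sum>i<N k. (l k i (?x - ?y))\<^sup>2) < d" using M that by simp
      ultimately show ?thesis using l_app[OF H(3), of k] unfolding d_def by simp
    qed
    then show "\<exists>M. \<forall>m\<ge>M. \<forall>n\<ge>M. B (X (diagseq m) - X (diagseq n)) (X (diagseq m) - X (diagseq n)) < e"
      by blast
  qed
qed

section \<open>Orthonormal families of eigenvectors below a threshold\<close>

definition eigen_family :: "real \<Rightarrow> nat \<Rightarrow> (nat \<Rightarrow> 'v) \<Rightarrow> (nat \<Rightarrow> real) \<Rightarrow> bool" where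
  "eigen_family z n e s \<longleftrightarrow>
     (\<forall>i<n. e i \<in> H \<and> s i < z \<and> (\<forall>w\<in>H. A (e i) w = s i * B (e i) w)) \<and>
     (\<forall>i<n. \<forall>j<n. B (e i) (e j) = (if i = j then 1 else 0))"

lemma eigen_family_forms:
  assumes "eigen_family z n e s"
  defines "w \<equiv> \<lambda>c. \<Sum>i<n. c i *\<^sub>R e i"
  shows "w c \<in> H" "B (w c) (w c) = (\<Sum>i<n. (c i)\<^sup>2)" "A (w c) (w c) = (\<Sum>i<n. s i * (c i)\<^sup>2)"
    "\<And>u. u \<in> H \<Longrightarrow> B u (w c) = (\<Sum>i<n. c i * B u (e i))"
    "\<And>u. u \<in> H \<Longrightarrow> A u (w c) = (\<Sum>i<n. c i * s i * B u (e i))"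
proof -
  have eH: "e i \<in> H" if "i < n" for i using assms that by (auto simp: eigen_family_def)
  have on: "B (e i) (e j) = (if i = j then 1 else 0)" if "i < n" "j < n" for i j
    using assms that by (auto simp: eigen_family_def)
  show wH: "w c \<in> H"
    unfolding w_def using eH sub by (intro subspace_sum subspace_scale) auto
  show B: "\<And>u. u \<in> H \<Longrightarrow> B u (w c) = (\<Sum>i<n. c i * B u (e i))"
    unfolding w_def using eH by (intro psd_form_sum_right[OF psdB]) auto
  show A: "A u (w c) = (\<Sum>i<n. c i * s i * B u (e i))" if u: "u \<in> H" for u
  proof -
    have "A u (e i) = s i * B u (e i)" if "i < n" for i
      using assms(1) that u psd_form_sym[OF psdA u eH[OF that]] psd_form_sym[OF psdB u eH[OF that]]
      by (auto simp: eigen_family_def)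
    moreover have "A u (w c) = (\<Sum>i<n. c i * A u (e i))"
      unfolding w_def using eH u by (intro psd_form_sum_right[OF psdA]) auto
    ultimately show ?thesis by (simp add: mult.assoc)
  qed
  have Bw: "B (w c) (e i) = c i" if "i < n" for i
  proof -
    have "B (w c) (e i) = (\<Sum>j<n. c j * B (e j) (e i))"
      unfolding w_def using eH that by (intro psd_form_sum_left[OF psdB]) auto
    also have "\<dots> = (\<Sum>j<n. if j = i then c j else 0)"
      using on that by (intro sum.cong) auto
    finally show ?thesis using that by simp
  qed
  show "B (w c) (w c) = (\<Sum>i<n. (c i)\<^sup>2)" using B[OF wH] Bw by (simp add: power2_eq_square)
  show "A (w c) (w c) = (\<Sum>i<n. s i * (c i)\<^sup>2)"
    using A[OF wH] Bw by (simp add: power2_eq_square mult_ac)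
qed

text \<open>On the span the forms are diagonal, so A \<le> z B there; and A(w,w) = 0 gives B(w,w) =
  0, which is the sum of the squared coefficients.\<close>

lemma eigen_family_bound:
  assumes "0 < z"
  shows "\<exists>N. \<forall>n e s. eigen_family z n e s \<longrightarrow> n \<le> N"
proof -
  obtain N where N: "\<And>n u. (\<forall>i<n. u i \<in> H) \<Longrightarrow>
     (\<forall>c :: nat \<Rightarrow> real. let w = (\<Sum>i<n. c i *\<^sub>R u i) in A w w \<le> z * B w w \<and> (A w w = 0 \<longrightarrow> (\<forall>i<n. c i = 0)))
     \<Longrightarrow> n \<le> (N::nat)"
    using finite_dimension_bound[OF assms] by blast
  obtain K where K: "\<And>u. u \<in> H \<Longrightarrow> B u u \<le> K * A u u" using B_le_A by blast
  have "n \<le> N" if ef: "eigen_family z n e s" for n e s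
  proof (rule N)
    show "\<forall>i<n. e i \<in> H" using ef by (auto simp: eigen_family_def)
    show "\<forall>c. let w = (\<Sum>i<n. c i *\<^sub>R e i) in A w w \<le> z * B w w \<and> (A w w = 0 \<longrightarrow> (\<forall>i<n. c i = 0))"
    proof (intro allI, unfold Let_def, intro conjI impI)
      fix c :: "nat \<Rightarrow> real"
      let ?w = "\<Sum>i<n. c i *\<^sub>R e i"
      note f = eigen_family_forms[OF ef, where c = c]
      have "(\<Sum>i<n. s i * (c i)\<^sup>2) \<le> (\<Sum>i<n. z * (c i)\<^sup>2)"
        using ef by (intro sum_mono mult_right_mono) (auto simp: eigen_family_def)
      then show "A ?w ?w \<le> z * B ?w ?w" unfolding f(2,3) by (simp add: sum_distrib_left)
      assume "A ?w ?w = 0"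
      then have "(\<Sum>i<n. (c i)\<^sup>2) \<le> 0" using K[OF f(1)] unfolding f(2) by simp
      then have "(\<Sum>i<n. (c i)\<^sup>2) = 0" by (simp add: sum_nonneg antisym)
      then have "\<forall>i\<in>{..<n}. (c i)\<^sup>2 = 0" by (subst (asm) sum_nonneg_eq_0_iff) auto
      then show "\<forall>i<n. c i = 0" by auto
    qed
  qed
  then show ?thesis by blast
qed

text \<open>The eigenvalue equation makes the B-orthogonal decomposition A-orthogonal as well, so
  both forms split into the part on the family and the remainder.\<close>

lemma eigen_family_project:
  assumes "eigen_family z n e s" "w \<in> H"
  defines "w' \<equiv> w - (\<Sum>i<n. B w (e i) *\<^sub>R e i)"
  shows "w' \<in> H" "\<And>j. j < n \<Longrightarrow> B w' (e j) = 0"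
    "B w' w' = B w w - (\<Sum>i<n. (B w (e i))\<^sup>2)"
    "A w' w' = A w w - (\<Sum>i<n. s i * (B w (e i))\<^sup>2)"
proof -
  let ?p = "\<Sum>i<n. B w (e i) *\<^sub>R e i"
  note f = eigen_family_forms[OF assms(1), where c = "\<lambda>i. B w (e i)"]
  show "w' \<in> H" unfolding w'_def using f(1) assms(2) subH by blast
  have eH: "e i \<in> H" if "i < n" for i using assms that by (auto simp: eigen_family_def)
  show "B w' (e j) = 0" if j: "j < n" for j
  proof -
    have "B ?p (e j) = (\<Sum>i<n. B w (e i) * B (e i) (e j))"
      using eH j by (intro psd_form_sum_left[OF psdB]) auto
    also have "\<dots> = (\<Sum>i<n. if i = j then B w (e i) else 0)"
      using assms(1) j by (intro sum.cong) (auto simp: eigen_family_def)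
    finally have "B ?p (e j) = B w (e j)" using j by simp
    then show ?thesis unfolding w'_def
      using psd_form_diff_left[OF psdB assms(2) f(1) eH[OF j]] by simp
  qed
  have "B w' w' = B w w - 2 * B w ?p + B ?p ?p"
    unfolding w'_def using psd_form_quadratic[OF psdB assms(2) f(1), of "-1"] by simp
  then show "B w' w' = B w w - (\<Sum>i<n. (B w (e i))\<^sup>2)"
    unfolding f(2) f(4)[OF assms(2)] by (simp add: power2_eq_square)
  have "A w' w' = A w w - 2 * A w ?p + A ?p ?p"
    unfolding w'_def using psd_form_quadratic[OF psdA assms(2) f(1), of "-1"] by simp
  then show "A w' w' = A w w - (\<Sum>i<n. s i * (B w (e i))\<^sup>2)"
    unfolding f(3) f(5)[OF assms(2)] by (simp add: power2_eq_square mult_ac)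
qed

text \<open>The maximum of \<open>B w w / A w w\<close> over the complement of the family is attained: a maximising
  sequence has a \<open>B\<close>-Cauchy subsequence, and the parallelogram law then makes it \<open>A\<close>-Cauchy.\<close>
lemma eigen_family_extend:
  assumes z: "0 < z" and ef: "eigen_family z n e s"
    and w0: "w0 \<in> H" "\<And>j. j < n \<Longrightarrow> B w0 (e j) = 0" "A w0 w0 < z * B w0 w0"
  shows "\<exists>u t. eigen_family z (Suc n) (e(n := u)) (s(n := t))"
proof -
  have eH: "e i \<in> H" if "i < n" for i using ef that by (auto simp: eigen_family_def)
  define H' where "H' = {w\<in>H. \<forall>j<n. B w (e j) = 0}"
  have H'H: "w \<in> H" if "w \<in> H'" for w using that by (simp add: H'_def)
  have sub': "subspace H'"
    unfolding H'_def subspace_def using subH eH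
    by (auto simp: psd_form_zero_left[OF psdB] psd_form_add_left[OF psdB] psd_form_scale_left[OF psdB])
  obtain K where K: "K > 0" "\<And>u. u \<in> H \<Longrightarrow> B u u \<le> K * A u u" using B_le_A by blast
  define S where "S = {B w w | w. w \<in> H' \<and> A w w = 1}"
  define \<mu> where "\<mu> = Sup S"
  have normalise: "B w w / A w w \<in> S" if w: "w \<in> H'" "A w w > 0" for w
  proof -
    let ?x = "(1 / sqrt (A w w)) *\<^sub>R w"
    have x: "?x \<in> H'" using w sub' subspace_scale by blast
    have "F ?x ?x = F w w / A w w" if "psd_form H F" for F
      using that w H'H[OF x] H'H[OF w(1)]
      by (simp add: psd_form_scale_left[OF that] psd_form_scale_right[OF that])
    from this[OF psdA] this[OF psdB] have "A ?x ?x = 1" "B ?x ?x = B w w / A w w" using w by auto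
    then show ?thesis unfolding S_def using x by (intro CollectI exI[of _ ?x]) simp
  qed
  have bdd: "bdd_above S" unfolding S_def bdd_above_def using K(2) H'H by fastforce
  have Aw0: "A w0 w0 > 0"
  proof (rule ccontr)
    assume "\<not> A w0 w0 > 0"
    then have "A w0 w0 = 0" using psd_form_nonneg[OF psdA w0(1)] by simp
    then show False using K(2)[OF w0(1)] w0(3) z by (simp add: zero_less_mult_iff)
  qed
  have w0H': "w0 \<in> H'" unfolding H'_def using w0 by simp
  have S_ne: "S \<noteq> {}" using normalise[OF w0H' Aw0] by auto
  \<comment> \<open>The strict inequality assumed for \<open>w0\<close> puts the supremum above 1/z;
    this is what places the new eigenvalue 1/\<mu> below z.\<close>
  have "1 / z < B w0 w0 / A w0 w0" using w0(3) Aw0 z by (simp add: field_simps)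
  also have "\<dots> \<le> \<mu>" unfolding \<mu>_def using normalise[OF w0H' Aw0] bdd by (intro cSup_upper)
  finally have \<mu>: "1 / z < \<mu>" .
  then have \<mu>0: "\<mu> > 0" using z by (meson less_trans zero_less_divide_1_iff)
  have B_le: "B w w \<le> \<mu> * A w w" if w: "w \<in> H'" for w
  proof (cases "A w w > 0")
    case True
    have "B w w / A w w \<le> \<mu>" unfolding \<mu>_def using normalise[OF w True] bdd by (intro cSup_upper)
    then show ?thesis using True by (simp add: field_simps)
  next
    case False
    then have "A w w = 0" using psd_form_nonneg[OF psdA H'H[OF w]] by simp
    then show ?thesis using K(2)[OF H'H[OF w]] by simp
  qed
  have "\<exists>w. w \<in> H' \<and> A w w = 1 \<and> \<mu> - 1 / real (Suc k) < B w w" for k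
  proof -
    have "\<mu> - 1 / real (Suc k) < Sup S" unfolding \<mu>_def by simp
    then obtain y where "y \<in> S" "\<mu> - 1 / real (Suc k) < y" using less_cSup_iff[OF S_ne bdd] by blast
    then show ?thesis unfolding S_def by auto
  qed
  then obtain V where V: "\<And>k. V k \<in> H'" "\<And>k. A (V k) (V k) = 1" "\<And>k. \<mu> - 1 / real (Suc k) < B (V k) (V k)"
    by metis
  have VH: "V k \<in> H" for k using V(1) H'H by blast
  obtain r where r: "strict_mono (r :: nat \<Rightarrow> nat)"
    "\<And>e. 0 < e \<Longrightarrow> \<exists>M. \<forall>m\<ge>M. \<forall>n\<ge>M. B (V (r m) - V (r n)) (V (r m) - V (r n)) < e"
    using B_Cauchy_subsequence[of V 1] VH V(2) by auto
  define X where "X = V \<circ> r"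
  have X: "X k \<in> H'" "X k \<in> H" "A (X k) (X k) = 1" "\<mu> - 1 / real (Suc k) < B (X k) (X k)" for k
  proof -
    show "X k \<in> H'" "X k \<in> H" "A (X k) (X k) = 1" using V VH by (auto simp: X_def)
    have "1 / real (Suc (r k)) \<le> 1 / real (Suc k)"
      using seq_suble[OF r(1), of k] by (intro divide_left_mono) auto
    then show "\<mu> - 1 / real (Suc k) < B (X k) (X k)" using V(3)[of "r k"] unfolding X_def by simp
  qed
  \<comment> \<open>B \<le> \<mu> A is applied to the sum of two members and both sides are
    rewritten by the parallelogram law; the errors 2/(m+1) and 2/(k+1) come from twice the distance
    of B(X,X) to \<mu>.\<close>
  have gap: "\<mu> * A (X m - X k) (X m - X k) \<le> B (X m - X k) (X m - X k) + 2 / real (Suc m) + 2 / real (Suc k)" for m k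
  proof -
    have sH': "X m + X k \<in> H'" using X sub' subspace_add by blast
    have par: "F (X m + X k) (X m + X k) = 2 * F (X m) (X m) + 2 * F (X k) (X k) - F (X m - X k) (X m - X k)"
      if "psd_form H F" for F
      using psd_form_quadratic[OF that X(2)[of m] X(2)[of k], of "-1"] psd_form_quadratic[OF that X(2)[of m] X(2)[of k], of 1]
      by simp
    have "2 * B (X m) (X m) + 2 * B (X k) (X k) - B (X m - X k) (X m - X k)
        \<le> \<mu> * (4 - A (X m - X k) (X m - X k))"
      using B_le[OF sH'] unfolding par[OF psdA] par[OF psdB] X(3) by simp
    then show ?thesis using X(4)[of m] X(4)[of k] by (simp add: algebra_simps)
  qed
  have "\<exists>u\<in>H. (\<lambda>k. A (X k - u) (X k - u)) \<longlonglongrightarrow> 0"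
  proof (rule A_complete)
    show "X k \<in> H" for k by (rule X)
    fix \<epsilon> :: real assume \<epsilon>: "0 < \<epsilon>"
    then have "0 < \<mu> * \<epsilon> / 2" using \<mu>0 by simp
    then obtain M where M: "\<And>m k. M \<le> m \<Longrightarrow> M \<le> k \<Longrightarrow> B (X m - X k) (X m - X k) < \<mu> * \<epsilon> / 2"
      using r(2) unfolding X_def o_def by blast
    obtain M' :: nat where M': "8 / (\<mu> * \<epsilon>) < real M'" using reals_Archimedean2 by blast
    have small: "2 / real (Suc k) < \<mu> * \<epsilon> / 4" if "k \<ge> M'" for k
    proof -
      have "8 / (\<mu> * \<epsilon>) < real (Suc k)" using M' that by simp
      then show ?thesis using \<mu>0 \<epsilon> by (simp add: field_simps)
    qed
    have "A (X m - X k) (X m - X k) < \<epsilon>" if "m \<ge> max M M'" "k \<ge> max M M'" for m k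
    proof -
      have "\<mu> * A (X m - X k) (X m - X k) < \<mu> * \<epsilon>"
        using gap[of m k] M[of m k] small[of m] small[of k] that by simp
      then show ?thesis using \<mu>0 by simp
    qed
    then show "\<exists>M. \<forall>m\<ge>M. \<forall>n\<ge>M. A (X m - X n) (X m - X n) < \<epsilon>" by blast
  qed
  then obtain u where u: "u \<in> H" "(\<lambda>k. A (X k - u) (X k - u)) \<longlonglongrightarrow> 0" by blast
  have limB: "(\<lambda>k. B (X k - u) (X k - u)) \<longlonglongrightarrow> 0"
  proof (rule tendsto_sandwich[OF _ _ tendsto_const])
    show "\<forall>\<^sub>F k in sequentially. 0 \<le> B (X k - u) (X k - u)"
      using psd_form_nonneg[OF psdB] X(2) u(1) subH by auto
    show "\<forall>\<^sub>F k in sequentially. B (X k - u) (X k - u) \<le> K * A (X k - u) (X k - u)"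
      using K(2) X(2) u(1) subH by auto
    show "(\<lambda>k. K * A (X k - u) (X k - u)) \<longlonglongrightarrow> 0" using tendsto_mult_left[OF u(2), of K] by simp
  qed
  have lim1: "(\<lambda>k. F (X k - u) w) \<longlonglongrightarrow> 0"
    if F: "psd_form H F" "(\<lambda>k. F (X k - u) (X k - u)) \<longlonglongrightarrow> 0" and w: "w \<in> H" for F w
  proof -
    have "\<bar>F (X k - u) w\<bar> \<le> sqrt (F (X k - u) (X k - u) * F w w)" for k
    proof -
      have "(F (X k - u) w)\<^sup>2 \<le> F (X k - u) (X k - u) * F w w"
        by (rule psd_form_Cauchy_Schwarz[OF F(1) subH(3)[OF X(2) u(1)] w])
      from real_sqrt_le_mono[OF this] show ?thesis by simp
    qed
    moreover have "(\<lambda>k. sqrt (F (X k - u) (X k - u) * F w w)) \<longlonglongrightarrow> sqrt (0 * F w w)"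
      by (rule tendsto_real_sqrt[OF tendsto_mult_right[OF F(2)]])
    ultimately show ?thesis
      by - (rule Lim_null_comparison[where g = "\<lambda>k. sqrt (F (X k - u) (X k - u) * F w w)"],
        simp_all add: always_eventually)
  qed
  have lim2: "(\<lambda>k. F (X k) (X k)) \<longlonglongrightarrow> F u u"
    if F: "psd_form H F" "(\<lambda>k. F (X k - u) (X k - u)) \<longlonglongrightarrow> 0" for F
  proof -
    have "F (X k) (X k) = F u u + 2 * F (X k - u) u + F (X k - u) (X k - u)" for k
    proof -
      have XuH: "X k - u \<in> H" by (rule subH(3)[OF X(2) u(1)])
      show ?thesis
      using psd_form_quadratic[OF F(1) u(1) XuH, of 1]
        psd_form_sym[OF F(1) u(1) XuH] by simp
    qed
    moreover have "(\<lambda>k. F u u + 2 * F (X k - u) u + F (X k - u) (X k - u)) \<longlonglongrightarrow> F u u + 2 * 0 + 0"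
      by (rule tendsto_add[OF tendsto_add[OF tendsto_const tendsto_mult_left[OF lim1[OF F u(1)]]] F(2)])
    ultimately show ?thesis by simp
  qed
  have Au: "A u u = 1" using lim2[OF psdA u(2)] X(3) by (simp add: LIMSEQ_const_iff)
  have uH': "u \<in> H'"
  proof -
    have "B u (e j) = 0" if j: "j < n" for j
    proof -
      have "B (X k - u) (e j) = - B u (e j)" for k
        using psd_form_diff_left[OF psdB X(2) u(1) eH[OF j], of k] X(1)[of k] j by (simp add: H'_def)
      then have "(\<lambda>k::nat. - B u (e j)) \<longlonglongrightarrow> 0" using lim1[OF psdB limB eH[OF j]] by simp
      then show ?thesis by (simp add: LIMSEQ_const_iff)
    qed
    then show ?thesis unfolding H'_def using u by simp
  qed
  have Bu: "B u u = \<mu>"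
  proof (rule antisym)
    show "B u u \<le> \<mu>" using B_le[OF uH'] Au by simp
    have "(\<lambda>k. \<mu> - 1 / real (Suc k)) \<longlonglongrightarrow> \<mu> - 0"
      using LIMSEQ_inverse_real_of_nat by (intro tendsto_intros) (simp add: inverse_eq_divide)
    then show "\<mu> \<le> B u u"
      using LIMSEQ_le[OF _ lim2[OF psdB limB]] X(4) by (fastforce intro: less_imp_le)
  qed
  \<comment> \<open>\<mu> A - B is nonnegative on \<open>H'\<close> and vanishes at
    \<open>u\<close>, so its first variation there is zero.\<close>
  have weak': "B u w = \<mu> * A u w" if w: "w \<in> H'" for w
  proof -
    have "\<mu> * A u w - B u w = 0"
    proof (rule linear_coeff_zero_if_nonneg)
      fix t :: real
      have "u + t *\<^sub>R w \<in> H'" using w uH' sub' subspace_add subspace_scale by blast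
      then have "0 \<le> \<mu> * A (u + t *\<^sub>R w) (u + t *\<^sub>R w) - B (u + t *\<^sub>R w) (u + t *\<^sub>R w)"
        using B_le by force
      also have "\<dots> = 2 * t * (\<mu> * A u w - B u w) + t\<^sup>2 * (\<mu> * A w w - B w w)"
        unfolding psd_form_quadratic[OF psdA u(1) H'H[OF w]] psd_form_quadratic[OF psdB u(1) H'H[OF w]] Au Bu
        by (simp add: algebra_simps)
      finally show "0 \<le> 2 * t * (\<mu> * A u w - B u w) + t\<^sup>2 * (\<mu> * A w w - B w w)" .
    qed
    then show ?thesis by simp
  qed
  \<comment> \<open>The equation extends from \<open>H'\<close> to \<open>H\<close> because the
    component along the family is orthogonal to \<open>u\<close> for both forms.\<close>
  have weak: "B u w = \<mu> * A u w" if w: "w \<in> H" for w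
  proof -
    let ?p = "\<Sum>i<n. B w (e i) *\<^sub>R e i"
    note pr = eigen_family_project[OF ef w]
    note f = eigen_family_forms[OF ef, where c = "\<lambda>i. B w (e i)"]
    have "w - ?p \<in> H'" unfolding H'_def using pr(1,2) by auto
    then have "B u (w - ?p) = \<mu> * A u (w - ?p)" by (rule weak')
    moreover have "B u ?p = 0" "A u ?p = 0"
      using f(4)[OF u(1)] f(5)[OF u(1)] uH' by (auto simp: H'_def)
    ultimately show ?thesis
      using psd_form_diff_right[OF psdA w f(1) u(1)] psd_form_diff_right[OF psdB w f(1) u(1)] by simp
  qed
  define x where "x = (1 / sqrt \<mu>) *\<^sub>R u"
  have xH: "x \<in> H" unfolding x_def using u subH by blast
  have "eigen_family z (Suc n) (e(n := x)) (s(n := 1 / \<mu>))"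
  proof -
    have Bx: "B x w = (1 / sqrt \<mu>) * B u w" "A x w = (1 / sqrt \<mu>) * A u w" if "w \<in> H" for w
      unfolding x_def using that u(1) psd_form_scale_left psdA psdB by blast+
    have Ax: "A x w = 1 / \<mu> * B x w" if "w \<in> H" for w
      using Bx[OF that] weak[OF that] \<mu>0 by simp
    have "B u x = (1 / sqrt \<mu>) * B u u"
      unfolding x_def using u(1) psd_form_scale_right[OF psdB u(1) u(1)] by blast
    then have xx: "B x x = 1" using Bx(1)[OF xH] Bu \<mu>0 by simp
    have xe: "B x (e j) = 0" "B (e j) x = 0" if "j < n" for j
    proof -
      show "B x (e j) = 0" using Bx(1)[OF eH[OF that]] uH' that by (simp add: H'_def)
      then show "B (e j) x = 0" using psd_form_sym[OF psdB xH eH[OF that]] by simp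
    qed
    have "1 / \<mu> < z" using \<mu> \<mu>0 z by (simp add: field_simps)
    then show ?thesis
      using ef xH Ax xx xe unfolding eigen_family_def by (auto simp: less_Suc_eq)
  qed
  then show ?thesis by blast
qed

text \<open>The bound on the length of families yields a longest one. By the extension lemma no
  vector orthogonal to it has A < z B, and adding back the diagonal part on the family gives the
  first inequality; the second is Bessel's.\<close>

theorem maximal_eigen_family:
  assumes z: "0 < z"
  obtains n e s where "eigen_family z n e s"
    "\<And>w. w \<in> H \<Longrightarrow> z * B w w - A w w \<le> (\<Sum>i<n. (z - s i) * (B w (e i))\<^sup>2)"
    "\<And>w. w \<in> H \<Longrightarrow> (\<Sum>i<n. (B w (e i))\<^sup>2) \<le> B w w"
proof -
  define Q where "Q = (\<lambda>n. \<exists>e s. eigen_family z n e s)"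
  obtain N where N: "\<And>n. Q n \<Longrightarrow> n \<le> N" using eigen_family_bound[OF z] unfolding Q_def by blast
  have "Q 0" unfolding Q_def eigen_family_def by simp
  define n where "n = Greatest Q"
  have "Q n" unfolding n_def using GreatestI_nat[of Q 0 N] \<open>Q 0\<close> N by blast
  then obtain e s where ef: "eigen_family z n e s" unfolding Q_def by blast
  have max: "\<not> Q (Suc n)" unfolding n_def using Greatest_le_nat[of Q "Suc (Greatest Q)" N] N by fastforce
  show thesis
  proof (rule that[OF ef])
    fix w assume w: "w \<in> H"
    let ?w' = "w - (\<Sum>i<n. B w (e i) *\<^sub>R e i)"
    note pr = eigen_family_project[OF ef w]
    have "z * B ?w' ?w' \<le> A ?w' ?w'"
      using eigen_family_extend[OF z ef pr(1)] pr(2) max unfolding Q_def by (meson not_le)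
    then show "z * B w w - A w w \<le> (\<Sum>i<n. (z - s i) * (B w (e i))\<^sup>2)"
      unfolding pr(3,4) by (simp add: algebra_simps sum_subtractf sum_distrib_left)
    show "(\<Sum>i<n. (B w (e i))\<^sup>2) \<le> B w w"
      using psd_form_nonneg[OF psdB pr(1)] unfolding pr(3) by simp
  qed
qed

end

section \<open>Square-integrable vector-valued functions\<close>

text \<open>With the pointwise structure functions themselves are vectors, so
  \<open>subspace\<close> and the forms above apply without quotienting by null sets.\<close>

instantiation "fun" :: (type, real_vector) real_vector
begin

definition scaleR_fun :: "real \<Rightarrow> ('a \<Rightarrow> 'b) \<Rightarrow> 'a \<Rightarrow> 'b" where
  "scaleR_fun c f = (\<lambda>x. c *\<^sub>R f x)"

instance
  by standard (auto simp: scaleR_fun_def fun_eq_iff scaleR_add_right scaleR_add_left)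

end

lemma scaleR_fun_apply [simp]: "(c *\<^sub>R f) x = c *\<^sub>R f x"
  by (simp add: scaleR_fun_def)

lemma sum_scaleR_fun_apply: "(\<Sum>i\<in>I. c i *\<^sub>R f i) x = (\<Sum>i\<in>I. c i *\<^sub>R (f i x))"
  by (induction I rule: infinite_finite_induct) auto

definition L2f :: "'b measure \<Rightarrow> ('b \<Rightarrow> 'e::euclidean_space) \<Rightarrow> bool" where
  "L2f M u \<longleftrightarrow> u \<in> borel_measurable M \<and> integrable M (\<lambda>x. (norm (u x))\<^sup>2)"

definition l2sq :: "'b measure \<Rightarrow> ('b \<Rightarrow> 'e::euclidean_space) \<Rightarrow> real" where
  "l2sq M u = (\<integral>x. (norm (u x))\<^sup>2 \<partial>M)"

lemma L2f_measurable [measurable_dest]: "L2f M u \<Longrightarrow> u \<in> borel_measurable M"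
  by (simp add: L2f_def)

lemma L2f_integrable: "L2f M u \<Longrightarrow> integrable M (\<lambda>x. (norm (u x))\<^sup>2)"
  by (simp add: L2f_def)

lemma l2sq_nonneg [simp]: "0 \<le> l2sq M u"
  unfolding l2sq_def by (intro integral_nonneg_AE) auto

lemma L2f_dominated:
  assumes "u \<in> borel_measurable M" "integrable M g" "\<And>x. x \<in> space M \<Longrightarrow> (norm (u x))\<^sup>2 \<le> g x"
  shows "L2f M u"
  unfolding L2f_def
proof (intro conjI assms(1) Bochner_Integration.integrable_bound[OF assms(2)])
  show "(\<lambda>x. (norm (u x))\<^sup>2) \<in> borel_measurable M" using assms(1) by measurable
  show "AE x in M. norm ((norm (u x))\<^sup>2) \<le> norm (g x)"
    using assms(3) by (intro AE_I2) (auto intro: order_trans[OF _ abs_ge_self])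
qed

lemma norm_add_square_le: "(norm (x + y))\<^sup>2 \<le> 2 * (norm x)\<^sup>2 + 2 * (norm (y::'e::real_normed_vector))\<^sup>2"
proof -
  have "(norm (x + y))\<^sup>2 \<le> (norm x + norm y)\<^sup>2" by (intro power_mono norm_triangle_ineq) auto
  also have "\<dots> \<le> 2 * (norm x)\<^sup>2 + 2 * (norm y)\<^sup>2"
    using sum_squares_bound[of "norm x" "norm y"] by (simp add: power2_sum)
  finally show ?thesis .
qed

lemma L2f_add: 
  assumes "L2f M u" "L2f M w" shows "L2f M (u + w)"
proof (rule L2f_dominated)
  show "u + w \<in> borel_measurable M" 
    using assms unfolding L2f_def plus_fun_def by (intro borel_measurable_add) auto
  show "integrable M (\<lambda>x. 2 * (norm (u x))\<^sup>2 + 2 * (norm (w x))\<^sup>2)"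
    using assms unfolding L2f_def by simp
qed (simp add: norm_add_square_le)

lemma L2f_scale: "L2f M u \<Longrightarrow> L2f M (c *\<^sub>R u)"
  unfolding L2f_def scaleR_fun_def by (auto simp: power_mult_distrib)

lemma L2f_zero: "L2f M 0"
  unfolding L2f_def zero_fun_def by simp

lemma subspace_L2f: "subspace {u. L2f M u}"
  unfolding subspace_def by (auto intro: L2f_add L2f_scale L2f_zero)

lemma L2f_diff: "L2f M u \<Longrightarrow> L2f M w \<Longrightarrow> L2f M (u - w)"
  using subspace_diff[OF subspace_L2f] by blast

lemma L2f_linear_image:
  assumes "bounded_linear T" "L2f M u" shows "L2f M (\<lambda>x. T (u x))"
proof -
  obtain K where K: "K > 0" "\<And>x. norm (T x) \<le> norm x * K"
    using bounded_linear.pos_bounded[OF assms(1)] by blast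
  show ?thesis
  proof (rule L2f_dominated)
    show "(\<lambda>x. T (u x)) \<in> borel_measurable M"
      using borel_measurable_continuous_on[OF linear_continuous_on[OF assms(1)] L2f_measurable[OF assms(2)]] .
    show "integrable M (\<lambda>x. K\<^sup>2 * (norm (u x))\<^sup>2)" using assms unfolding L2f_def by simp
    fix x
    have "(norm (T (u x)))\<^sup>2 \<le> (norm (u x) * K)\<^sup>2" by (intro power_mono K) auto
    then show "(norm (T (u x)))\<^sup>2 \<le> K\<^sup>2 * (norm (u x))\<^sup>2" by (simp add: power_mult_distrib mult.commute)
  qed
qed

lemma L2f_bilinear_integrable:
  assumes "bounded_bilinear \<beta>" "L2f M u" "L2f M w"
  shows "integrable M (\<lambda>x. \<beta> (u x) (w x) :: real)"
proof -
  obtain K where K: "K > 0" "\<And>a b. norm (\<beta> a b) \<le> norm a * norm b * K"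
    using bounded_bilinear.pos_bounded[OF assms(1)] by blast
  show ?thesis
  proof (rule Bochner_Integration.integrable_bound)
    show "integrable M (\<lambda>x. K * ((norm (u x))\<^sup>2 + (norm (w x))\<^sup>2))"
      using assms unfolding L2f_def by simp
    have "continuous_on UNIV (\<lambda>p. \<beta> (fst p) (snd p))"
      by (intro bounded_bilinear.continuous_on[OF assms(1)] continuous_intros)
    then show "(\<lambda>x. \<beta> (u x) (w x)) \<in> borel_measurable M"
      using borel_measurable_continuous_on[of "\<lambda>p. \<beta> (fst p) (snd p)" "\<lambda>x. (u x, w x)" M]
        borel_measurable_Pair[OF L2f_measurable[OF assms(2)] L2f_measurable[OF assms(3)]] by simp
    have "norm (\<beta> (u x) (w x)) \<le> norm (K * ((norm (u x))\<^sup>2 + (norm (w x))\<^sup>2))" for x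
    proof -
      have "norm (\<beta> (u x) (w x)) \<le> K * (norm (u x) * norm (w x))" using K(2) by (simp add: mult.commute)
      also have "\<dots> \<le> K * ((norm (u x))\<^sup>2 + (norm (w x))\<^sup>2)"
      proof (rule mult_left_mono)
        have "2 * (norm (u x) * norm (w x)) \<le> (norm (u x))\<^sup>2 + (norm (w x))\<^sup>2"
          using sum_squares_bound[of "norm (u x)" "norm (w x)"] by simp
        moreover have "0 \<le> norm (u x) * norm (w x)" by simp
        ultimately show "norm (u x) * norm (w x) \<le> (norm (u x))\<^sup>2 + (norm (w x))\<^sup>2" by linarith
      qed (use K in simp)
      finally show ?thesis using K(1) by simp
    qed
    then show "AE x in M. norm (\<beta> (u x) (w x)) \<le> norm (K * ((norm (u x))\<^sup>2 + (norm (w x))\<^sup>2))" by simp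
  qed
qed

lemma psd_form_L2:
  assumes "bounded_bilinear \<beta>" "\<And>x y. \<beta> x y = (\<beta> y x :: real)" "\<And>x. 0 \<le> \<beta> x x"
    and "subspace H" "\<And>u. u \<in> H \<Longrightarrow> L2f M u"
  shows "psd_form H (\<lambda>u w. \<integral>x. \<beta> (u x) (w x) \<partial>M)"
  unfolding psd_form_def
proof (intro conjI ballI allI)
  fix u v w assume "u \<in> H" "v \<in> H" "w \<in> H"
  then have "L2f M u" "L2f M v" "L2f M w" using assms(5) by auto
  then show "(\<integral>x. \<beta> ((u + v) x) (w x) \<partial>M) = (\<integral>x. \<beta> (u x) (w x) \<partial>M) + (\<integral>x. \<beta> (v x) (w x) \<partial>M)"
    using L2f_bilinear_integrable[OF assms(1), of M u w] L2f_bilinear_integrable[OF assms(1), of M v w]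
    by (simp add: bounded_bilinear.add_left[OF assms(1)])
next
  fix c u w assume "u \<in> H" "w \<in> H"
  show "(\<integral>x. \<beta> ((c *\<^sub>R u) x) (w x) \<partial>M) = c * (\<integral>x. \<beta> (u x) (w x) \<partial>M)"
    by (simp add: bounded_bilinear.scaleR_left[OF assms(1)])
qed (use assms(2-4) in \<open>auto intro: integral_nonneg_AE\<close>)

text \<open>Taking norms pointwise reduces to the product of two scalar functions, for which the
  semidefinite form inequality applies; \<open>K\<close> is a bound for \<beta>.\<close>

lemma L2f_Cauchy_Schwarz:
  assumes "bounded_bilinear \<beta>"
  obtains K where "0 < K" "\<And>u w. L2f M u \<Longrightarrow> L2f M w \<Longrightarrow>
    \<bar>\<integral>x. (\<beta> (u x) (w x) :: real) \<partial>M\<bar> \<le> K * sqrt (l2sq M u * l2sq M w)"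
proof -
  obtain K where K: "K > 0" "\<And>a b. norm (\<beta> a b) \<le> norm a * norm b * K"
    using bounded_bilinear.pos_bounded[OF assms(1)] by blast
  have "\<bar>\<integral>x. \<beta> (u x) (w x) \<partial>M\<bar> \<le> K * sqrt (l2sq M u * l2sq M w)"
    if u: "L2f M u" and w: "L2f M w" for u w
  proof -
    let ?u = "\<lambda>x. norm (u x)" and ?w = "\<lambda>x. norm (w x)"
    have uw: "L2f M ?u" "L2f M ?w" using u w by (auto simp: L2f_def)
    have psd: "psd_form {u. L2f M u} (\<lambda>u w. \<integral>x. u x * (w x :: real) \<partial>M)"
      by (intro psd_form_L2 bounded_bilinear_mult subspace_L2f) auto
    have "(\<integral>x. ?u x * ?w x \<partial>M)\<^sup>2 \<le> l2sq M u * l2sq M w"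
      using psd_form_Cauchy_Schwarz[OF psd, of ?u ?w] uw by (simp add: l2sq_def power2_eq_square)
    from real_sqrt_le_mono[OF this] have le: "(\<integral>x. ?u x * ?w x \<partial>M) \<le> sqrt (l2sq M u * l2sq M w)" by simp
    have int: "integrable M (\<lambda>x. ?u x * ?w x)"
      by (rule L2f_bilinear_integrable[OF bounded_bilinear_mult uw])
    have "\<bar>\<integral>x. \<beta> (u x) (w x) \<partial>M\<bar> \<le> (\<integral>x. norm (\<beta> (u x) (w x)) \<partial>M)"
      using integral_norm_bound[of M "\<lambda>x. \<beta> (u x) (w x)"] by simp
    also have "\<dots> \<le> (\<integral>x. K * (?u x * ?w x) \<partial>M)"
      using L2f_bilinear_integrable[OF assms u w] int K(2) 
      by (intro integral_mono) (auto simp: mult.commute mult.left_commute)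
    also have "\<dots> \<le> K * sqrt (l2sq M u * l2sq M w)" using le K(1) by simp
    finally show ?thesis .
  qed
  then show thesis using that K(1) by blast
qed

text \<open>Expanding around the two limits leaves three terms, each containing a factor that tends
  to 0 in L2.\<close>

lemma L2f_tendsto_bilinear:
  assumes "bounded_bilinear \<beta>"
    and "\<And>n. L2f M (U n)" "L2f M u" "(\<lambda>n. l2sq M (U n - u)) \<longlonglongrightarrow> 0"
    and "\<And>n. L2f M (W n)" "L2f M w" "(\<lambda>n. l2sq M (W n - w)) \<longlonglongrightarrow> 0"
  shows "(\<lambda>n. \<integral>x. (\<beta> (U n x) (W n x) :: real) \<partial>M) \<longlonglongrightarrow> (\<integral>x. \<beta> (u x) (w x) \<partial>M)"
proof -
  obtain K where K: "0 < K" "\<And>u w. L2f M u \<Longrightarrow> L2f M w \<Longrightarrow>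
    \<bar>\<integral>x. (\<beta> (u x) (w x) :: real) \<partial>M\<bar> \<le> K * sqrt (l2sq M u * l2sq M w)"
    using L2f_Cauchy_Schwarz[OF assms(1)] by blast
  note d = L2f_diff[OF assms(2) assms(3)] L2f_diff[OF assms(5) assms(6)]
  have eq: "(\<integral>x. \<beta> (U n x) (W n x) \<partial>M) - (\<integral>x. \<beta> (u x) (w x) \<partial>M)
    = (\<integral>x. \<beta> ((U n - u) x) ((W n - w) x) \<partial>M) + (\<integral>x. \<beta> ((U n - u) x) (w x) \<partial>M) + (\<integral>x. \<beta> (u x) ((W n - w) x) \<partial>M)" for n
    using L2f_bilinear_integrable[OF assms(1) assms(2)[of n] assms(5)[of n]]
      L2f_bilinear_integrable[OF assms(1) assms(3) assms(5)[of n]]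
      L2f_bilinear_integrable[OF assms(1) assms(2)[of n] assms(6)]
      L2f_bilinear_integrable[OF assms(1) assms(3) assms(6)]
    by (simp add: bounded_bilinear.diff_left[OF assms(1)] bounded_bilinear.diff_right[OF assms(1)])
  have z1: "(\<lambda>n. \<integral>x. \<beta> ((U n - u) x) ((W n - w) x) \<partial>M) \<longlonglongrightarrow> 0"
  proof (rule Lim_null_comparison)
    show "\<forall>\<^sub>F n in sequentially. norm (\<integral>x. \<beta> ((U n - u) x) ((W n - w) x) \<partial>M) \<le> K * sqrt (l2sq M (U n - u) * l2sq M (W n - w))"
      using K(2)[OF d] by (auto intro!: always_eventually)
    show "(\<lambda>n. K * sqrt (l2sq M (U n - u) * l2sq M (W n - w))) \<longlonglongrightarrow> 0"
      using tendsto_mult_left[OF tendsto_real_sqrt[OF tendsto_mult[OF assms(4,7)]], of K] by simp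
  qed
  have z2: "(\<lambda>n. \<integral>x. \<beta> ((U n - u) x) (w x) \<partial>M) \<longlonglongrightarrow> 0"
  proof (rule Lim_null_comparison)
    show "\<forall>\<^sub>F n in sequentially. norm (\<integral>x. \<beta> ((U n - u) x) (w x) \<partial>M) \<le> K * sqrt (l2sq M (U n - u) * l2sq M w)"
      using K(2)[OF d(1) assms(6)] by (auto intro!: always_eventually)
    show "(\<lambda>n. K * sqrt (l2sq M (U n - u) * l2sq M w)) \<longlonglongrightarrow> 0"
      using tendsto_mult_left[OF tendsto_real_sqrt[OF tendsto_mult_right[OF assms(4)]], of K "l2sq M w"] by simp
  qed
  have z3: "(\<lambda>n. \<integral>x. \<beta> (u x) ((W n - w) x) \<partial>M) \<longlonglongrightarrow> 0"
  proof (rule Lim_null_comparison)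
    show "\<forall>\<^sub>F n in sequentially. norm (\<integral>x. \<beta> (u x) ((W n - w) x) \<partial>M) \<le> K * sqrt (l2sq M u * l2sq M (W n - w))"
      using K(2)[OF assms(3) d(2)] by (auto intro!: always_eventually)
    show "(\<lambda>n. K * sqrt (l2sq M u * l2sq M (W n - w))) \<longlonglongrightarrow> 0"
      using tendsto_mult_left[OF tendsto_real_sqrt[OF tendsto_mult_left[OF assms(7)]], of K "l2sq M u"] by simp
  qed
  have "(\<lambda>n. (\<integral>x. \<beta> (U n x) (W n x) \<partial>M) - (\<integral>x. \<beta> (u x) (w x) \<partial>M)) \<longlonglongrightarrow> 0"
    unfolding eq using tendsto_add[OF tendsto_add[OF z1 z2] z3] by simp
  then show ?thesis by (rule LIM_zero_cancel)
qed

lemma l2sq_add_le: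
  assumes "L2f M u" "L2f M w"
  shows "l2sq M (u + w) \<le> 2 * l2sq M u + 2 * l2sq M w"
proof -
  have "l2sq M (u + w) \<le> (\<integral>x. 2 * (norm (u x))\<^sup>2 + 2 * (norm (w x))\<^sup>2 \<partial>M)"
    unfolding l2sq_def using L2f_integrable[OF L2f_add[OF assms]] L2f_integrable[OF assms(1)] L2f_integrable[OF assms(2)]
    by (intro integral_mono) (auto simp: norm_add_square_le)
  also have "\<dots> = 2 * l2sq M u + 2 * l2sq M w"
    unfolding l2sq_def using L2f_integrable[OF assms(1)] L2f_integrable[OF assms(2)] by simp
  finally show ?thesis .
qed

lemma nn_integral_l2sq:
  assumes "L2f M u" shows "(\<integral>\<^sup>+x. ennreal ((norm (u x))\<^sup>2) \<partial>M) = ennreal (l2sq M u)"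
  unfolding l2sq_def using L2f_integrable[OF assms] by (intro nn_integral_eq_integral) auto

text \<open>With increments g_n, the sum of 2^n g_n^2 has integral at most that of 4^(-n), hence is
  finite almost everywhere. The inequality y \<le> 1 + y^2 at y = 2^n g_n gives g_n \<le> 2^(-n) +
  2^n g_n^2, so the increments are absolutely summable. No finiteness of the measure is
  involved.\<close>

lemma L2f_rapidly_Cauchy_AE_convergent:
  assumes Y: "\<And>n. L2f M (Y n)" and le: "\<And>n. l2sq M (Y (Suc n) - Y n) \<le> (1/8) ^ n"
  shows "AE x in M. convergent (\<lambda>n. Y n x)"
proof -
  define g where "g = (\<lambda>n x. norm ((Y (Suc n) - Y n) x))"
  have Lg: "L2f M (Y (Suc n) - Y n)" for n by (intro L2f_diff Y)
  have meas: "(\<lambda>x. ennreal (2 ^ n * (g n x)\<^sup>2)) \<in> borel_measurable M" for n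
    using L2f_measurable[OF Y[of n]] L2f_measurable[OF Y[of "Suc n"]] unfolding g_def minus_apply by measurable
  have meas': "(\<lambda>x. ennreal ((g n x)\<^sup>2)) \<in> borel_measurable M" for n
    using L2f_measurable[OF Y[of n]] L2f_measurable[OF Y[of "Suc n"]] unfolding g_def minus_apply by measurable
  have "(\<integral>\<^sup>+x. ennreal (2 ^ n * (g n x)\<^sup>2) \<partial>M) \<le> ennreal ((1/4) ^ n)" for n
  proof -
    have "(\<integral>\<^sup>+x. ennreal (2 ^ n * (g n x)\<^sup>2) \<partial>M) = ennreal (2 ^ n) * (\<integral>\<^sup>+x. ennreal ((g n x)\<^sup>2) \<partial>M)"
      unfolding nn_integral_cmult[OF meas', symmetric]
      by (rule nn_integral_cong, rule ennreal_mult) auto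
    also have "\<dots> = ennreal (2 ^ n * l2sq M (Y (Suc n) - Y n))"
      using nn_integral_l2sq[OF Lg[of n]] unfolding g_def by (simp add: ennreal_mult)
    also have "\<dots> \<le> ennreal (2 ^ n * (1/8) ^ n)"
      using le by (intro ennreal_leI mult_left_mono) auto
    also have "(2::real) ^ n * (1/8) ^ n = (1/4) ^ n"
      unfolding power_mult_distrib[symmetric] by simp
    finally show ?thesis .
  qed
  then have "(\<Sum>n. \<integral>\<^sup>+x. ennreal (2 ^ n * (g n x)\<^sup>2) \<partial>M) \<le> (\<Sum>n. ennreal ((1/4) ^ n))"
    by (intro suminf_le) auto
  also have "\<dots> = ennreal (\<Sum>n. (1/4) ^ n)"
    by (intro suminf_ennreal2) (auto intro: summable_geometric)
  also have "\<dots> < \<infinity>" by simp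
  finally have "(\<integral>\<^sup>+x. (\<Sum>n. ennreal (2 ^ n * (g n x)\<^sup>2)) \<partial>M) < \<infinity>"
    using meas by (subst nn_integral_suminf) auto
  then have "AE x in M. (\<Sum>n. ennreal (2 ^ n * (g n x)\<^sup>2)) \<noteq> \<infinity>"
    using meas by (intro nn_integral_PInf_AE) auto
  then show ?thesis
  proof eventually_elim
    case (elim x)
    then have s: "summable (\<lambda>n. 2 ^ n * (g n x)\<^sup>2)" by (intro summable_suminf_not_top) auto
    have "summable (\<lambda>n. g n x)"
    proof (rule summable_comparison_test')
      show "summable (\<lambda>n. (1/2) ^ n + 2 ^ n * (g n x)\<^sup>2)"
        using s by (intro summable_add summable_geometric) auto
      fix n
      have g0: "0 \<le> g n x" unfolding g_def by simp
      have "2 * (2 ^ n * g n x) \<le> 1 + (2 ^ n * g n x)\<^sup>2"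
        using sum_squares_bound[of 1 "2 ^ n * g n x"] by simp
      moreover have "0 \<le> 2 ^ n * g n x" using g0 by simp
      ultimately have "2 ^ n * g n x \<le> 1 + (2 ^ n * g n x)\<^sup>2" by linarith
      then have "(1/2) ^ n * (2 ^ n * g n x) \<le> (1/2) ^ n * (1 + (2 ^ n * g n x)\<^sup>2)"
        by (intro mult_left_mono) auto
      then have "((1/2) ^ n * 2 ^ n) * g n x \<le> (1/2) ^ n + ((1/2) ^ n * 2 ^ n) * (2 ^ n * (g n x)\<^sup>2)"
        by (simp add: power2_eq_square algebra_simps)
      moreover have "(1/2) ^ n * 2 ^ n = (1::real)" unfolding power_mult_distrib[symmetric] by simp
      ultimately show "norm (g n x) \<le> (1/2) ^ n + 2 ^ n * (g n x)\<^sup>2" using g0 by simp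
    qed
    then have "summable (\<lambda>n. Y (Suc n) x - Y n x)"
      unfolding g_def by - (rule summable_norm_cancel, simp)
    then have "convergent (\<lambda>n. \<Sum>i<n. Y (Suc i) x - Y i x)" by (simp add: summable_iff_convergent)
    then have "convergent (\<lambda>n. Y n x - Y 0 x)" 
      using sum_lessThan_telescope[of "\<lambda>n. Y n x"] by simp
    then obtain l where "(\<lambda>n. Y n x - Y 0 x) \<longlonglongrightarrow> l" by (auto simp: convergent_def)
    from tendsto_add[OF this tendsto_const[of "Y 0 x"]]
    show "convergent (\<lambda>n. Y n x)" by (auto simp: convergent_def)
  qed
qed

text \<open>A rapidly Cauchy subsequence converges almost everywhere, and Fatou's lemma turns the
  Cauchy estimate into an estimate for the distance to the pointwise limit.\<close>

lemma L2f_complete: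
  fixes X :: "nat \<Rightarrow> 'b \<Rightarrow> 'e::euclidean_space"
  assumes X: "\<And>n. L2f M (X n)"
    and Cauchy: "\<And>e. 0 < e \<Longrightarrow> \<exists>N. \<forall>m\<ge>N. \<forall>n\<ge>N. l2sq M (X m - X n) < e"
  obtains u where "L2f M u" "(\<lambda>n. l2sq M (X n - u)) \<longlonglongrightarrow> 0"
proof -
  have "\<exists>N. \<forall>m\<ge>N. \<forall>n\<ge>N. l2sq M (X m - X n) < (1/8) ^ k" for k by (intro Cauchy) simp
  then obtain N where N: "\<And>k m n. N k \<le> m \<Longrightarrow> N k \<le> n \<Longrightarrow> l2sq M (X m - X n) < (1/8) ^ k" by metis
  \<comment> \<open>Partial sums make \<open>r\<close> nondecreasing and at least
    \<open>N k\<close>; the summand \<open>k\<close> ensures that \<open>r k\<close> passes every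
    given index.\<close>
  define r where "r = (\<lambda>k. (\<Sum>i\<le>k. N i) + k)"
  have r: "N k \<le> r k" "r k \<le> r (Suc k)" "k \<le> r k" for k
    unfolding r_def using member_le_sum[of k "{..k}" N] by auto
  define Y where "Y = (\<lambda>k. X (r k))"
  have Y: "L2f M (Y k)" for k unfolding Y_def by (rule X)
  have "l2sq M (Y (Suc k) - Y k) \<le> (1/8) ^ k" for k
    unfolding Y_def using N[of k "r (Suc k)" "r k"] r[of k] by (simp add: less_imp_le)
  then have conv: "AE x in M. convergent (\<lambda>n. Y n x)"
    by (rule L2f_rapidly_Cauchy_AE_convergent[OF Y])
  define u where "u = (\<lambda>x. lim (\<lambda>n. Y n x))"
  have um: "u \<in> borel_measurable M"
    unfolding u_def using L2f_measurable[OF Y] by (rule borel_measurable_lim_metric)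
  \<comment> \<open>Fatou along the subsequence: the distance from \<open>X n\<close> to
    \<open>u\<close> is almost everywhere the lower limit of the distances to \<open>Y k\<close>. It
    is stated with \<open>nn_integral\<close> because square integrability of the difference is only
    a consequence.\<close>
  have bound: "(\<integral>\<^sup>+x. ennreal ((norm ((X n - u) x))\<^sup>2) \<partial>M) \<le> ennreal e"
    if n: "\<And>m. m \<ge> n \<Longrightarrow> l2sq M (X n - X m) \<le> e" for n e
  proof -
    have "(\<integral>\<^sup>+x. ennreal ((norm ((X n - u) x))\<^sup>2) \<partial>M)
        = (\<integral>\<^sup>+x. liminf (\<lambda>k. ennreal ((norm ((X n - Y k) x))\<^sup>2)) \<partial>M)"
    proof (rule nn_integral_cong_AE)
      show "AE x in M. ennreal ((norm ((X n - u) x))\<^sup>2) = liminf (\<lambda>k. ennreal ((norm ((X n - Y k) x))\<^sup>2))"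
        using conv
      proof eventually_elim
        case (elim x)
        then have "(\<lambda>k. Y k x) \<longlonglongrightarrow> u x" unfolding u_def by (simp add: convergent_LIMSEQ_iff)
        then have "(\<lambda>k. ennreal ((norm ((X n - Y k) x))\<^sup>2)) \<longlonglongrightarrow> ennreal ((norm ((X n - u) x))\<^sup>2)"
          by (auto intro!: tendsto_intros tendsto_ennrealI)
        then show ?case using lim_imp_Liminf[OF trivial_limit_sequentially] by metis
      qed
    qed
    also have "\<dots> \<le> liminf (\<lambda>k. \<integral>\<^sup>+x. ennreal ((norm ((X n - Y k) x))\<^sup>2) \<partial>M)"
    proof (rule nn_integral_liminf)
      fix k
      have "(X n - Y k) \<in> borel_measurable M" by (intro L2f_measurable L2f_diff X Y)
      from measurable_compose[OF this borel_measurable_norm]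
      show "(\<lambda>x. ennreal ((norm ((X n - Y k) x))\<^sup>2)) \<in> borel_measurable M" by measurable
    qed
    also have "\<dots> = liminf (\<lambda>k. ennreal (l2sq M (X n - Y k)))"
      using nn_integral_l2sq[OF L2f_diff[OF X Y]] by simp
    also have "\<dots> \<le> liminf (\<lambda>k. ennreal e)"
    proof (rule Liminf_mono, rule eventually_sequentiallyI[of n])
      fix k assume "n \<le> k"
      then have "n \<le> r k" using r(3)[of k] by linarith
      then show "ennreal (l2sq M (X n - Y k)) \<le> ennreal e" using n unfolding Y_def by (intro ennreal_leI)
    qed
    also have "\<dots> = ennreal e" by (simp add: Liminf_const)
    finally show ?thesis .
  qed
  have XuM: "(X n - u) \<in> borel_measurable M" for n
    using borel_measurable_diff[OF L2f_measurable[OF X, of n] um] unfolding fun_diff_def .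
  have XuL: "L2f M (X n - u) \<and> l2sq M (X n - u) \<le> e"
    if n: "\<And>m. m \<ge> n \<Longrightarrow> l2sq M (X n - X m) \<le> e" and e: "0 \<le> e" for n e
  proof -
    have meas: "(\<lambda>x. (norm ((X n - u) x))\<^sup>2) \<in> borel_measurable M"
      using measurable_compose[OF XuM[of n] borel_measurable_norm] by measurable
    have "integrable M (\<lambda>x. (norm ((X n - u) x))\<^sup>2)"
      using bound[OF n] meas by (intro integrableI_bounded) (auto intro: le_less_trans)
    then have L: "L2f M (X n - u)" unfolding L2f_def using XuM by simp
    have "ennreal (l2sq M (X n - u)) \<le> ennreal e" using bound[OF n] nn_integral_l2sq[OF L] by simp
    then show ?thesis using L e by simp
  qed
  have "L2f M (X (N 0) - u)"
    using XuL[of "N 0" 1] N[of 0 "N 0"] by (auto simp: less_imp_le)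
  from L2f_diff[OF X this] have "L2f M (X (N 0) - (X (N 0) - u))" .
  moreover have "X (N 0) - (X (N 0) - u) = u" by (simp add: fun_eq_iff)
  ultimately have uL: "L2f M u" by metis
  show thesis
  proof (rule that[OF uL])
    show "(\<lambda>n. l2sq M (X n - u)) \<longlonglongrightarrow> 0"
    proof (rule LIMSEQ_I)
      fix e :: real assume e: "0 < e"
      obtain N' where N': "\<forall>m\<ge>N'. \<forall>n\<ge>N'. l2sq M (X m - X n) < e / 2" using Cauchy[of "e / 2"] e by auto
      have "norm (l2sq M (X n - u) - 0) < e" if "n \<ge> N'" for n
      proof -
        have "l2sq M (X n - u) \<le> e / 2" using XuL[of n "e / 2"] N' that e by (force simp: less_imp_le)
        then show ?thesis using e by simp
      qed
      then show "\<exists>no. \<forall>n\<ge>no. norm (l2sq M (X n - u) - 0) < e" by blast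
    qed
  qed
qed

section \<open>Test functions\<close>

text \<open>Vector values are allowed so that functions, gradients and jets share one notion.
  Smoothness is kept out: derivatives are handled through \<open>dpart\<close>, each again of this
  kind.\<close>

definition Cc :: "('a::euclidean_space \<Rightarrow> 'b::euclidean_space) \<Rightarrow> bool" where
  "Cc f \<longleftrightarrow> continuous_on UNIV f \<and> (\<exists>R. \<forall>x. R < norm x \<longrightarrow> f x = 0)"

lemma Cc_continuous: "Cc f \<Longrightarrow> continuous_on UNIV f"
  by (simp add: Cc_def)

lemma Cc_measurable: "Cc f \<Longrightarrow> f \<in> borel_measurable borel"
  using Cc_continuous borel_measurable_continuous_onI by blast

lemma Cc_integrable:
  assumes "Cc f" shows "integrable lborel f"
proof -
  obtain R where R: "\<And>x. R < norm x \<Longrightarrow> f x = 0" using assms by (auto simp: Cc_def)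
  have "integrable lborel (\<lambda>x. indicator (cball 0 R) x *\<^sub>R f x)"
    using assms by (intro borel_integrable_compact) (auto simp: Cc_def intro: continuous_on_subset)
  moreover have "(\<lambda>x. indicator (cball 0 R) x *\<^sub>R f x) = f"
    using R by (auto simp: fun_eq_iff indicator_def)
  ultimately show ?thesis by simp
qed

lemma Cc_bounded:
  assumes "Cc f" obtains S where "0 \<le> S" "\<And>x. norm (f x) \<le> S"
proof -
  obtain R where R: "\<And>x. R < norm x \<Longrightarrow> f x = 0" using assms by (auto simp: Cc_def)
  have "compact (f ` cball 0 R)"
    using assms by (intro compact_continuous_image) (auto simp: Cc_def intro: continuous_on_subset)
  then obtain S where S: "\<And>y. y \<in> f ` cball 0 R \<Longrightarrow> norm y \<le> S"
    using compact_imp_bounded bounded_iff by metis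
  have "norm (f x) \<le> max S 0" for x
    using R[of x] S[of "f x"] by (cases "R < norm x") auto
  then show thesis using that[of "max S 0"] by auto
qed

lemma Cc_support_subset:
  assumes "Cc f" "continuous_on UNIV g" "\<And>x. f x = 0 \<Longrightarrow> g x = 0" shows "Cc g"
  using assms unfolding Cc_def by metis

lemma Cc_add: "Cc f \<Longrightarrow> Cc g \<Longrightarrow> Cc (\<lambda>x. f x + g x)"
  unfolding Cc_def
proof (elim conjE exE, intro conjI)
  fix R R' assume "\<forall>x. R < norm x \<longrightarrow> f x = 0" "\<forall>x. R' < norm x \<longrightarrow> g x = 0"
  then show "\<exists>R. \<forall>x. R < norm x \<longrightarrow> f x + g x = 0" by (intro exI[of _ "max R R'"]) auto
qed (intro continuous_intros)

lemma Cc_zero: "Cc (\<lambda>x. 0)"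
  by (simp add: Cc_def)

lemma Cc_sum: "(\<And>i. i \<in> I \<Longrightarrow> Cc (f i)) \<Longrightarrow> Cc (\<lambda>x. \<Sum>i\<in>I. f i x)"
  by (induction I rule: infinite_finite_induct) (auto intro: Cc_add Cc_zero)

lemma Cc_mult_left: "Cc f \<Longrightarrow> continuous_on UNIV g \<Longrightarrow> Cc (\<lambda>x. f x * g x :: real)"
  by (rule Cc_support_subset[of f]) (auto intro!: continuous_intros simp: Cc_continuous)

lemma Cc_norm_square: "Cc f \<Longrightarrow> Cc (\<lambda>x. (norm (f x))\<^sup>2)"
  by (rule Cc_support_subset[of f]) (auto intro!: continuous_intros simp: Cc_continuous)

section \<open>Translation invariance and integration by parts\<close>

lemma lborel_integral_translation:
  fixes f :: "'a::euclidean_space \<Rightarrow> 'b::{banach, second_countable_topology}"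
  assumes "f \<in> borel_measurable borel"
  shows "(\<integral>x. f (c + x) \<partial>lborel) = (\<integral>x. f x \<partial>lborel)"
proof -
  have "(\<integral>x. f x \<partial>lborel) = (\<integral>x. f x \<partial>distr lborel borel ((+) c))" by (simp add: lborel_distr_plus)
  also have "\<dots> = (\<integral>x. f (c + x) \<partial>lborel)" using assms by (intro integral_distr) auto
  finally show ?thesis by simp
qed

lemma lborel_nn_integral_translation:
  fixes f :: "'a::euclidean_space \<Rightarrow> ennreal"
  assumes "f \<in> borel_measurable borel"
  shows "(\<integral>\<^sup>+x. f (c + x) \<partial>lborel) = (\<integral>\<^sup>+x. f x \<partial>lborel)"
proof -
  have "(\<integral>\<^sup>+x. f x \<partial>lborel) = (\<integral>\<^sup>+x. f x \<partial>distr lborel borel ((+) c))" by (simp add: lborel_distr_plus)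
  also have "\<dots> = (\<integral>\<^sup>+x. f (c + x) \<partial>lborel)" using assms by (intro nn_integral_distr) auto
  finally show ?thesis by simp
qed

lemma directional_derivative:
  fixes f :: "'a::euclidean_space \<Rightarrow> real"
  assumes "\<And>x. f differentiable (at x)"
  shows "((\<lambda>t. f (x + t *\<^sub>R b)) has_real_derivative frechet_derivative f (at (x + t *\<^sub>R b)) b) (at t)"
proof -
  let ?f' = "frechet_derivative f (at (x + t *\<^sub>R b))"
  have f': "(f has_derivative ?f') (at (x + t *\<^sub>R b))"
    using assms frechet_derivative_works by blast
  have "((\<lambda>t. x + t *\<^sub>R b) has_derivative (\<lambda>s. s *\<^sub>R b)) (at t)"
    by (auto intro!: derivative_eq_intros)
  from has_derivative_compose[OF this f'] have "((\<lambda>t. f (x + t *\<^sub>R b)) has_derivative (\<lambda>s. ?f' (s *\<^sub>R b))) (at t)" .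
  moreover have "(\<lambda>s. ?f' (s *\<^sub>R b)) = (*) (?f' b)"
    using linear_frechet_derivative[of f "at (x + t *\<^sub>R b)"] assms
    by (auto simp: fun_eq_iff linear_scale mult.commute)
  ultimately show ?thesis unfolding has_field_derivative_def by simp
qed

lemma differentiable_continuous_UNIV:
  "(\<And>x. f differentiable (at x)) \<Longrightarrow> continuous_on UNIV f"
  by (simp add: continuous_on_eq_continuous_at differentiable_imp_continuous_within)

text \<open>The difference quotients of \<open>f\<close> have vanishing integrals, by translation invariance.\<close>
lemma integral_frechet_derivative_zero:
  fixes f :: "'a::euclidean_space \<Rightarrow> real"
  assumes d: "\<And>x. f differentiable (at x)" and f: "Cc f"
    and f': "Cc (\<lambda>x. frechet_derivative f (at x) b)"
  shows "(\<integral>x. frechet_derivative f (at x) b \<partial>lborel) = 0"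
proof -
  let ?D = "\<lambda>x. frechet_derivative f (at x) b"
  obtain S where S: "0 \<le> S" "\<And>x. norm (?D x) \<le> S" using Cc_bounded[OF f'] by blast
  obtain R where R: "\<And>x. R < norm x \<Longrightarrow> f x = 0" using f by (auto simp: Cc_def)
  define h where "h = (\<lambda>n. 1 / real (Suc n))"
  have h: "0 < h n" "h n \<le> 1" for n unfolding h_def by (auto simp: field_simps)
  define s where "s = (\<lambda>n x. (f (h n *\<^sub>R b + x) - f x) / h n)"
  have fm: "f \<in> borel_measurable borel" by (rule Cc_measurable[OF f])
  have ftm: "(\<lambda>x. f (c + x)) \<in> borel_measurable borel" for c
    using measurable_compose[OF _ fm, of "\<lambda>x. c + x"] by simp
  have sm: "s n \<in> borel_measurable lborel" for n
    unfolding s_def using fm ftm by simp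
  have fti: "integrable lborel (\<lambda>x. f (c + x))" for c
    using integrable_distr[of "(+) c" lborel borel f] Cc_integrable[OF f] by (simp add: lborel_distr_plus)
  have s0: "(\<integral>x. s n x \<partial>lborel) = 0" for n
    unfolding s_def using Cc_integrable[OF f] fti lborel_integral_translation[OF fm] by simp
  have "(\<lambda>n. \<integral>x. s n x \<partial>lborel) \<longlonglongrightarrow> (\<integral>x. ?D x \<partial>lborel)"
  \<comment> \<open>Domination: the mean value theorem bounds the difference quotient by
    \<open>S\<close>, and because \<open>h n \<le> 1\<close> both evaluation points lie outside the
    support of \<open>f\<close> once |x| > |R| + |b|.\<close>
  proof (rule integral_dominated_convergence[where w = "\<lambda>x. S * indicator (cball 0 (\<bar>R\<bar> + norm b)) x"])
    show "?D \<in> borel_measurable lborel" using Cc_measurable[OF f'] by simp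
    show "s n \<in> borel_measurable lborel" for n by (rule sm)
    show "integrable lborel (\<lambda>x. S * indicator (cball 0 (\<bar>R\<bar> + norm b)) x)"
      using emeasure_lborel_cball_finite[of 0 "\<bar>R\<bar> + norm b"] by (intro integrable_mult_right) auto
    show "AE x in lborel. (\<lambda>n. s n x) \<longlonglongrightarrow> ?D x"
    proof (rule AE_I2)
      fix x
      have "((\<lambda>t. (f (x + t *\<^sub>R b) - f (x + 0 *\<^sub>R b)) / (t - 0)) \<longlongrightarrow> frechet_derivative f (at (x + 0 *\<^sub>R b)) b) (at 0)"
        using directional_derivative[OF d, of x b 0] unfolding has_field_derivative_iff .
      then have "((\<lambda>t. (f (t *\<^sub>R b + x) - f x) / t) \<longlongrightarrow> ?D x) (at 0)"
        by (simp add: add.commute)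
      moreover have "filterlim h (at 0) sequentially"
        unfolding h_def filterlim_at using LIMSEQ_inverse_real_of_nat
        by (auto simp: inverse_eq_divide)
      ultimately show "(\<lambda>n. s n x) \<longlonglongrightarrow> ?D x" unfolding s_def by (rule filterlim_compose)
    qed
    show "AE x in lborel. norm (s n x) \<le> S * indicator (cball 0 (\<bar>R\<bar> + norm b)) x" for n
    proof (rule AE_I2)
      fix x
      show "norm (s n x) \<le> S * indicator (cball 0 (\<bar>R\<bar> + norm b)) x"
      proof (cases "x \<in> cball 0 (\<bar>R\<bar> + norm b)")
        case True
        obtain z where "f (x + h n *\<^sub>R b) - f (x + 0 *\<^sub>R b) = (h n - 0) * frechet_derivative f (at (x + z *\<^sub>R b)) b"
          using MVT2[OF h(1)[of n], of "\<lambda>t. f (x + t *\<^sub>R b)" "\<lambda>t. frechet_derivative f (at (x + t *\<^sub>R b)) b"]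
            directional_derivative[OF d, of x b] by metis
        then have "s n x = frechet_derivative f (at (x + z *\<^sub>R b)) b"
          unfolding s_def using h(1)[of n] by (simp add: add.commute)
        then show ?thesis using S(2) True by simp
      next
        case False
        then have x: "\<bar>R\<bar> + norm b < norm x" by simp
        have "norm (h n *\<^sub>R b) \<le> norm b" using h[of n] by (simp add: mult_left_le_one_le)
        moreover have "norm x \<le> norm (h n *\<^sub>R b + x) + norm (h n *\<^sub>R b)"
          using norm_triangle_ineq4[of "h n *\<^sub>R b + x" "h n *\<^sub>R b"] by simp
        ultimately have "R < norm (h n *\<^sub>R b + x)" "R < norm x" using x norm_ge_zero[of b] by linarith+
        then have "f (h n *\<^sub>R b + x) = 0" "f x = 0" using R by auto
        then show ?thesis unfolding s_def using False by simp
      qed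
    qed
  qed
  then show ?thesis unfolding s0 by (simp add: LIMSEQ_const_iff)
qed

lemma frechet_derivative_mult:
  fixes f g :: "'a::euclidean_space \<Rightarrow> real"
  assumes "f differentiable (at x)" "g differentiable (at x)"
  shows "frechet_derivative (\<lambda>x. f x * g x) (at x) b
      = f x * frechet_derivative g (at x) b + frechet_derivative f (at x) b * g x"
proof -
  have "((\<lambda>x. f x * g x) has_derivative (\<lambda>h. f x * frechet_derivative g (at x) h + frechet_derivative f (at x) h * g x)) (at x)"
    using assms by (intro has_derivative_mult) (auto simp: frechet_derivative_works)
  from frechet_derivative_at[OF this] show ?thesis by metis
qed

lemma frechet_derivative_add:
  fixes f g :: "'a::euclidean_space \<Rightarrow> real"
  assumes "f differentiable (at x)" "g differentiable (at x)"
  shows "frechet_derivative (\<lambda>x. f x + g x) (at x) b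
      = frechet_derivative f (at x) b + frechet_derivative g (at x) b"
proof -
  have "((\<lambda>x. f x + g x) has_derivative (\<lambda>h. frechet_derivative f (at x) h + frechet_derivative g (at x) h)) (at x)"
    using assms by (intro has_derivative_add) (auto simp: frechet_derivative_works)
  from frechet_derivative_at[OF this] show ?thesis by metis
qed

lemma frechet_derivative_cmult:
  fixes f :: "'a::euclidean_space \<Rightarrow> real"
  assumes "f differentiable (at x)"
  shows "frechet_derivative (\<lambda>x. c * f x) (at x) b = c * frechet_derivative f (at x) b"
  using frechet_derivative_mult[of "\<lambda>_. c" x f b] assms by simp

text \<open>The product rule reduces this to the vanishing integral of a directional derivative of
  \<open>f * g\<close>; the bounded support of one factor suffices for that.\<close>

lemma integral_by_parts:
  fixes f g :: "'a::euclidean_space \<Rightarrow> real"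
  assumes df: "\<And>x. f differentiable (at x)" and dg: "\<And>x. g differentiable (at x)"
    and f: "Cc f" and f': "Cc (\<lambda>x. frechet_derivative f (at x) b)"
    and g': "continuous_on UNIV (\<lambda>x. frechet_derivative g (at x) b)"
  shows "(\<integral>x. frechet_derivative f (at x) b * g x \<partial>lborel)
       = - (\<integral>x. f x * frechet_derivative g (at x) b \<partial>lborel)"
proof -
  have g: "continuous_on UNIV g" by (rule differentiable_continuous_UNIV[OF dg])
  have eq: "frechet_derivative (\<lambda>x. f x * g x) (at x) b
      = f x * frechet_derivative g (at x) b + frechet_derivative f (at x) b * g x" for x
    by (rule frechet_derivative_mult[OF df dg])
  have c1: "Cc (\<lambda>x. f x * frechet_derivative g (at x) b)" "Cc (\<lambda>x. frechet_derivative f (at x) b * g x)"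
    by (intro Cc_mult_left f f' g g')+
  have "(\<integral>x. frechet_derivative (\<lambda>x. f x * g x) (at x) b \<partial>lborel) = 0"
  proof (rule integral_frechet_derivative_zero)
    show "(\<lambda>x. f x * g x) differentiable at x" for x using df dg by (intro differentiable_mult)
    show "Cc (\<lambda>x. f x * g x)" by (rule Cc_mult_left[OF f g])
    show "Cc (\<lambda>x. frechet_derivative (\<lambda>x. f x * g x) (at x) b)"
      unfolding eq by (intro Cc_add c1)
  qed
  then show ?thesis unfolding eq using c1[THEN Cc_integrable] by simp
qed

lemma integral_square_le_unit_interval:
  fixes k :: "real \<Rightarrow> real"
  assumes k: "continuous_on {0..1} k"
  shows "(\<integral>t. indicator {0..1} t * k t \<partial>lborel)\<^sup>2 \<le> (\<integral>t. indicator {0..1} t * (k t)\<^sup>2 \<partial>lborel)"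
proof -
  have psd: "psd_form {u. L2f lborel u} (\<lambda>u w. \<integral>x. u x * (w x :: real) \<partial>(lborel :: real measure))"
    by (intro psd_form_L2 bounded_bilinear_mult subspace_L2f) auto
  let ?I = "\<lambda>t::real. indicator {0..1} t :: real"
  have sq: "(norm (?I t))\<^sup>2 = ?I t" "(norm (?I t * k t))\<^sup>2 = ?I t * (k t)\<^sup>2" "?I t * ?I t = ?I t" for t
    by (auto simp: indicator_def)
  have int: "integrable lborel (\<lambda>t. ?I t * k t)" "integrable lborel (\<lambda>t. ?I t * (k t)\<^sup>2)"
    using borel_integrable_compact[of "{0..1}" k] borel_integrable_compact[of "{0..1}" "\<lambda>t. (k t)\<^sup>2"]
      k continuous_on_power[OF k]
    by auto
  have intI: "integrable lborel ?I" by (rule integrable_real_indicator) auto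
  have I: "L2f lborel ?I" "L2f lborel (\<lambda>t. ?I t * k t)"
    unfolding L2f_def sq using int intI borel_measurable_integrable by auto
  have eq: "?I t * (?I t * k t) = ?I t * k t" "(?I t * k t) * (?I t * k t) = ?I t * (k t)\<^sup>2" for t
    by (auto simp: indicator_def power2_eq_square)
  show ?thesis
    using psd_form_Cauchy_Schwarz[OF psd, of ?I "\<lambda>t. ?I t * k t"] I unfolding eq sq(3) by simp
qed

text \<open>The difference is the integral of the derivative along the segment from x to x + w.
  Cauchy-Schwarz on [0,1] and Tonelli reduce the claim to translates of one integrand, whose
  integrals all coincide.\<close>

lemma translation_difference_bound:
  fixes f :: "'a::euclidean_space \<Rightarrow> real"
  assumes d: "\<And>x. f differentiable (at x)" and f': "Cc (\<lambda>x. frechet_derivative f (at x) w)"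
  shows "(\<integral>\<^sup>+x. ennreal ((f (x + w) - f x)\<^sup>2) \<partial>lborel)
       \<le> ennreal (\<integral>x. (frechet_derivative f (at x) w)\<^sup>2 \<partial>lborel)"
proof -
  let ?D = "\<lambda>x. frechet_derivative f (at x) w"
  let ?I = "\<lambda>t::real. indicator {0..1} t :: real"
  have Dc: "continuous_on UNIV ?D" by (rule Cc_continuous[OF f'])
  have Dm: "?D \<in> borel_measurable borel" by (rule Cc_measurable[OF f'])
  have c: "continuous_on {0..1} (\<lambda>t. ?D (x + t *\<^sub>R w))" for x
    by (intro continuous_on_compose2[OF Dc] continuous_intros) auto
  have pt: "ennreal ((f (x + w) - f x)\<^sup>2) \<le> (\<integral>\<^sup>+t. ennreal (?I t * (?D (x + t *\<^sub>R w))\<^sup>2) \<partial>lborel)" for x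
  proof -
    have "(\<integral>t. ?I t *\<^sub>R ?D (x + t *\<^sub>R w) \<partial>lborel) = f (x + 1 *\<^sub>R w) - f (x + 0 *\<^sub>R w)"
    proof (rule integral_FTC_atLeastAtMost)
      fix t :: real
      show "((\<lambda>t. f (x + t *\<^sub>R w)) has_vector_derivative ?D (x + t *\<^sub>R w)) (at t within {0..1})"
        using directional_derivative[OF d, of x w t]
        by (simp add: has_real_derivative_iff_has_vector_derivative has_vector_derivative_at_within)
    qed (use c in auto)
    then have "(f (x + w) - f x)\<^sup>2 = (\<integral>t. ?I t * ?D (x + t *\<^sub>R w) \<partial>lborel)\<^sup>2" by simp
    also have "\<dots> \<le> (\<integral>t. ?I t * (?D (x + t *\<^sub>R w))\<^sup>2 \<partial>lborel)"
      by (rule integral_square_le_unit_interval[OF c])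
    finally have "ennreal ((f (x + w) - f x)\<^sup>2) \<le> ennreal (\<integral>t. ?I t * (?D (x + t *\<^sub>R w))\<^sup>2 \<partial>lborel)"
      by (rule ennreal_leI)
    also have "\<dots> = (\<integral>\<^sup>+t. ennreal (?I t * (?D (x + t *\<^sub>R w))\<^sup>2) \<partial>lborel)"
      using borel_integrable_compact[of "{0..1}" "\<lambda>t. (?D (x + t *\<^sub>R w))\<^sup>2"] continuous_on_power[OF c]
      by (intro nn_integral_eq_integral[symmetric]) auto
    finally show ?thesis .
  qed
  have m: "(\<lambda>(x, t). ennreal (?I t * (?D (x + t *\<^sub>R w))\<^sup>2)) \<in> borel_measurable (lborel \<Otimes>\<^sub>M lborel)"
    using Dm by measurable
  have "(\<integral>\<^sup>+x. ennreal ((f (x + w) - f x)\<^sup>2) \<partial>lborel)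
      \<le> (\<integral>\<^sup>+x. (\<integral>\<^sup>+t. ennreal (?I t * (?D (x + t *\<^sub>R w))\<^sup>2) \<partial>lborel) \<partial>lborel)"
    by (intro nn_integral_mono pt)
  also have "\<dots> = (\<integral>\<^sup>+t. (\<integral>\<^sup>+x. ennreal (?I t * (?D (x + t *\<^sub>R w))\<^sup>2) \<partial>lborel) \<partial>lborel)"
    by (rule lborel_pair.Fubini'[OF m, symmetric])
  also have "\<dots> = (\<integral>\<^sup>+t. indicator {0..1::real} t * ennreal (\<integral>x. (?D x)\<^sup>2 \<partial>lborel) \<partial>lborel)"
  proof (rule nn_integral_cong)
    fix t :: real
    have Dm': "(\<lambda>x. ennreal ((?D x)\<^sup>2)) \<in> borel_measurable borel" using Dm by measurable
    have "(\<integral>\<^sup>+x. ennreal (?I t * (?D (x + t *\<^sub>R w))\<^sup>2) \<partial>lborel)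
        = indicator {0..1} t * (\<integral>\<^sup>+x. ennreal ((?D (x + t *\<^sub>R w))\<^sup>2) \<partial>lborel)"
      by (simp add: indicator_def)
    also have "(\<integral>\<^sup>+x. ennreal ((?D (x + t *\<^sub>R w))\<^sup>2) \<partial>lborel) = (\<integral>\<^sup>+x. ennreal ((?D x)\<^sup>2) \<partial>lborel)"
      using lborel_nn_integral_translation[OF Dm', of "t *\<^sub>R w"] by (simp add: add.commute)
    also have "\<dots> = ennreal (\<integral>x. (?D x)\<^sup>2 \<partial>lborel)"
      using Cc_integrable[OF Cc_norm_square[OF f']] by (intro nn_integral_eq_integral) auto
    finally show "(\<integral>\<^sup>+x. ennreal (?I t * (?D (x + t *\<^sub>R w))\<^sup>2) \<partial>lborel)
      = indicator {0..1} t * ennreal (\<integral>x. (?D x)\<^sup>2 \<partial>lborel)" .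
  qed
  also have "\<dots> = ennreal (\<integral>x. (?D x)\<^sup>2 \<partial>lborel)"
    by (subst nn_integral_multc) auto
  finally show ?thesis .
qed

section \<open>Derivatives, jets and Green's identity for test functions\<close>

lemma test_fun_differentiable:
  "test_fun \<Omega> f \<Longrightarrow> set bs \<subseteq> Basis \<Longrightarrow> dpart bs f differentiable (at x)"
  by (simp add: test_fun_def)

lemma dpart_zero_outside_support:
  assumes "x \<notin> closure {x. f x \<noteq> 0}"
  shows "dpart bs f x = 0"
  using assms
proof (induction bs arbitrary: x)
  case Nil
  then show ?case using closure_subset[of "{x. f x \<noteq> 0}"] by auto
next
  case (Cons b bs)
  have "frechet_derivative (dpart bs f) (at x) = frechet_derivative (\<lambda>_. 0) (at x)"
  proof (rule frechet_derivative_transform_within_open[symmetric])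
    show "(\<lambda>_. 0) differentiable at x" by simp
    show "open (- closure {x. f x \<noteq> 0})" by auto
  qed (use Cons in auto)
  then show ?case by simp
qed

lemma test_fun_dpart_Cc:
  assumes "test_fun \<Omega> f" "set bs \<subseteq> Basis"
  shows "Cc (dpart bs f)"
proof -
  have c: "continuous_on UNIV (dpart bs f)"
    using test_fun_differentiable[OF assms] by (rule differentiable_continuous_UNIV)
  have "bounded (closure {x. f x \<noteq> 0})"
    using assms(1) by (intro compact_imp_bounded) (simp add: test_fun_def)
  then obtain R where R: "\<And>x. x \<in> closure {x. f x \<noteq> 0} \<Longrightarrow> norm x \<le> R"
    unfolding bounded_iff by blast
  have "dpart bs f x = 0" if "R < norm x" for x
  proof (rule dpart_zero_outside_support)
    show "x \<notin> closure {x. f x \<noteq> 0}" using R[of x] that by auto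
  qed
  with c show ?thesis unfolding Cc_def by blast
qed

lemma test_fun_Cc: "test_fun \<Omega> f \<Longrightarrow> Cc f"
  using test_fun_dpart_Cc[of \<Omega> f "[]"] by simp

lemma test_fun_dpart_outside:
  "test_fun \<Omega> f \<Longrightarrow> x \<notin> \<Omega> \<Longrightarrow> dpart bs f x = 0"
  using dpart_zero_outside_support unfolding test_fun_def by blast

lemma dpart_add:
  assumes "\<And>bs x. set bs \<subseteq> Basis \<Longrightarrow> dpart bs f differentiable (at x)"
    "\<And>bs x. set bs \<subseteq> Basis \<Longrightarrow> dpart bs g differentiable (at x)" "set bs \<subseteq> Basis"
  shows "dpart bs (\<lambda>x. f x + g x) = (\<lambda>x. dpart bs f x + dpart bs g x)"
  using assms(3)
proof (induction bs)
  case (Cons b bs)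
  then show ?case using assms(1,2) by (simp add: frechet_derivative_add)
qed simp

lemma dpart_cmult:
  assumes "\<And>bs x. set bs \<subseteq> Basis \<Longrightarrow> dpart bs f differentiable (at x)" "set bs \<subseteq> Basis"
  shows "dpart bs (\<lambda>x. c * f x) = (\<lambda>x. c * dpart bs f x)"
  using assms(2)
proof (induction bs)
  case (Cons b bs)
  then show ?case using assms(1) by (simp add: frechet_derivative_cmult)
qed simp

lemma test_fun_add:
  assumes "test_fun \<Omega> f" "test_fun \<Omega> g" shows "test_fun \<Omega> (\<lambda>x. f x + g x)"
proof -
  have sub: "closure {x. f x + g x \<noteq> 0} \<subseteq> closure {x. f x \<noteq> 0} \<union> closure {x. g x \<noteq> 0}"
    unfolding closure_Un[symmetric] by (intro closure_mono) auto
  have "dpart bs (\<lambda>x. f x + g x) differentiable (at x)" if "set bs \<subseteq> Basis" for bs x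
    using dpart_add[of f g bs] that assms by (simp add: test_fun_def)
  moreover have "bounded ({x. f x \<noteq> 0} \<union> {x. g x \<noteq> 0})"
    using assms unfolding test_fun_def compact_closure by simp
  then have "bounded {x. f x + g x \<noteq> 0}" by (rule bounded_subset) auto
  then have "compact (closure {x. f x + g x \<noteq> 0})" by simp
  ultimately show ?thesis using sub assms unfolding test_fun_def by blast
qed

lemma test_fun_cmult:
  assumes "test_fun \<Omega> f" shows "test_fun \<Omega> (\<lambda>x. c * f x)"
proof -
  have sub: "closure {x. c * f x \<noteq> 0} \<subseteq> closure {x. f x \<noteq> 0}" by (intro closure_mono) auto
  have "dpart bs (\<lambda>x. c * f x) differentiable (at x)" if "set bs \<subseteq> Basis" for bs x
    using dpart_cmult[of f bs c] that assms by (simp add: test_fun_def)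
  moreover have "bounded {x. f x \<noteq> 0}"
    using assms unfolding test_fun_def compact_closure by simp
  then have "bounded {x. c * f x \<noteq> 0}" by (rule bounded_subset) auto
  then have "compact (closure {x. c * f x \<noteq> 0})" by simp
  ultimately show ?thesis using sub assms unfolding test_fun_def by blast
qed

text \<open>Bundling turns the three L2 convergences in \<open>H20\<close> into a single one, and
  the L2 norm of the jet is the full norm of the space.\<close>

definition jet :: "('a::euclidean_space \<Rightarrow> real) \<Rightarrow> 'a \<Rightarrow> real \<times> 'a \<times> real" where
  "jet f x = (f x, grad f x, lap f x)"

lemma grad_inner_Basis: "b \<in> Basis \<Longrightarrow> grad f x \<bullet> b = frechet_derivative f (at x) b"
  unfolding grad_def by (simp add: inner_sum_left inner_Basis if_distrib sum.delta cong: if_cong)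

lemma grad_inner: "f differentiable (at x) \<Longrightarrow> grad f x \<bullet> w = frechet_derivative f (at x) w"
proof -
  assume d: "f differentiable (at x)"
  note lin = linear_frechet_derivative[OF d]
  have "frechet_derivative f (at x) w = frechet_derivative f (at x) (\<Sum>b\<in>Basis. (w \<bullet> b) *\<^sub>R b)"
    by (simp add: euclidean_representation)
  also have "\<dots> = (\<Sum>b\<in>Basis. (w \<bullet> b) * frechet_derivative f (at x) b)"
    by (simp add: linear_sum[OF lin] linear_scale[OF lin])
  also have "\<dots> = grad f x \<bullet> w"
    unfolding grad_def by (simp add: inner_sum_left inner_commute[of w] mult.commute)
  finally show ?thesis by simp
qed

lemma test_fun_grad_Cc: "test_fun \<Omega> f \<Longrightarrow> Cc (grad f)"
  unfolding grad_def[abs_def]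
proof (rule Cc_sum)
  fix b :: 'a assume "test_fun \<Omega> f" "b \<in> Basis"
  then have "Cc (dpart [b] f)" by (intro test_fun_dpart_Cc) auto
  then show "Cc (\<lambda>x. dpart [b] f x *\<^sub>R b)"
    by (rule Cc_support_subset[of "dpart [b] f"])
      (use Cc_continuous[OF \<open>Cc (dpart [b] f)\<close>] in \<open>auto intro!: continuous_intros simp del: dpart.simps\<close>)
qed

lemma test_fun_lap_Cc: "test_fun \<Omega> f \<Longrightarrow> Cc (lap f)"
  unfolding lap_def[abs_def] by (intro Cc_sum test_fun_dpart_Cc) auto

lemma test_fun_jet_Cc: "test_fun \<Omega> f \<Longrightarrow> Cc (jet f)"
proof -
  assume t: "test_fun \<Omega> f"
  note cs = test_fun_Cc[OF t] test_fun_grad_Cc[OF t] test_fun_lap_Cc[OF t]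
  obtain R1 R2 R3 where "\<And>x. R1 < norm x \<Longrightarrow> f x = 0" "\<And>x. R2 < norm x \<Longrightarrow> grad f x = 0"
    "\<And>x. R3 < norm x \<Longrightarrow> lap f x = 0" using cs unfolding Cc_def by metis
  then have "\<forall>x. max R1 (max R2 R3) < norm x \<longrightarrow> jet f x = 0" by (auto simp: jet_def zero_prod_def)
  moreover have "continuous_on UNIV (jet f)"
    unfolding jet_def[abs_def] using cs[THEN Cc_continuous] by (intro continuous_intros)
  ultimately show ?thesis unfolding Cc_def by blast
qed

lemma jet_outside: "test_fun \<Omega> f \<Longrightarrow> x \<notin> \<Omega> \<Longrightarrow> jet f x = 0"
proof -
  assume "test_fun \<Omega> f" "x \<notin> \<Omega>"
  then have z: "dpart bs f x = 0" for bs by (rule test_fun_dpart_outside)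
  show ?thesis
    using z[of "[]"] by (simp add: jet_def grad_def lap_def zero_prod_def z del: dpart.simps(2))
qed

lemma jet_add: "test_fun \<Omega> f \<Longrightarrow> test_fun \<Omega> g \<Longrightarrow> jet (\<lambda>x. f x + g x) = jet f + jet g"
proof -
  assume a: "test_fun \<Omega> f" "test_fun \<Omega> g"
  have "dpart bs (\<lambda>x. f x + g x) = (\<lambda>x. dpart bs f x + dpart bs g x)" if "set bs \<subseteq> Basis" for bs
    using a that by (intro dpart_add) (auto simp: test_fun_def)
  then have "b \<in> Basis \<Longrightarrow> dpart [b] (\<lambda>x. f x + g x) = (\<lambda>x. dpart [b] f x + dpart [b] g x)"
    "b \<in> Basis \<Longrightarrow> dpart [b, b] (\<lambda>x. f x + g x) = (\<lambda>x. dpart [b, b] f x + dpart [b, b] g x)" for b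
    by (auto simp del: dpart.simps)
  then show ?thesis
    by (auto simp: fun_eq_iff jet_def grad_def lap_def sum.distrib scaleR_add_left simp del: dpart.simps)
qed

lemma jet_cmult: "test_fun \<Omega> f \<Longrightarrow> jet (\<lambda>x. c * f x) = c *\<^sub>R jet f"
proof -
  assume a: "test_fun \<Omega> f"
  have "dpart bs (\<lambda>x. c * f x) = (\<lambda>x. c * dpart bs f x)" if "set bs \<subseteq> Basis" for bs
    using a that by (intro dpart_cmult) (auto simp: test_fun_def)
  then have "b \<in> Basis \<Longrightarrow> dpart [b] (\<lambda>x. c * f x) = (\<lambda>x. c * dpart [b] f x)"
    "b \<in> Basis \<Longrightarrow> dpart [b, b] (\<lambda>x. c * f x) = (\<lambda>x. c * dpart [b, b] f x)" for b
    by (auto simp del: dpart.simps)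
  then show ?thesis
    by (auto simp: fun_eq_iff jet_def grad_def lap_def sum_distrib_left scaleR_sum_right simp del: dpart.simps)
qed

text \<open>One integration by parts in each coordinate, moving the derivative from \<open>f\<close>
  to \<open>g\<close>.\<close>

lemma Green_identity:
  assumes "test_fun \<Omega> f" "test_fun \<Omega> g"
  shows "(\<integral>x. grad f x \<bullet> grad g x \<partial>lborel) = - (\<integral>x. f x * lap g x \<partial>lborel)"
proof -
  have int: "integrable lborel (\<lambda>x. dpart [b] f x * dpart [b] g x)" "integrable lborel (\<lambda>x. f x * dpart [b, b] g x)"
    if b: "b \<in> Basis" for b
  proof -
    have "Cc (dpart [b] f)" "Cc (dpart [b] g)" "Cc (dpart [b, b] g)"
      using b assms by (intro test_fun_dpart_Cc; auto)+
    then show "integrable lborel (\<lambda>x. dpart [b] f x * dpart [b] g x)" "integrable lborel (\<lambda>x. f x * dpart [b, b] g x)"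
      using test_fun_Cc[OF assms(1)] by (auto intro!: Cc_integrable Cc_mult_left Cc_continuous simp del: dpart.simps)
  qed
  have "(\<integral>x. grad f x \<bullet> grad g x \<partial>lborel) = (\<integral>x. (\<Sum>b\<in>Basis. dpart [b] f x * dpart [b] g x) \<partial>lborel)"
    by (subst euclidean_inner) (simp add: grad_inner_Basis cong: sum.cong)
  also have "\<dots> = (\<Sum>b\<in>Basis. \<integral>x. dpart [b] f x * dpart [b] g x \<partial>lborel)"
    using int by (intro Bochner_Integration.integral_sum) auto
  also have "\<dots> = (\<Sum>b\<in>Basis. - (\<integral>x. f x * dpart [b, b] g x \<partial>lborel))"
  proof (rule sum.cong[OF refl])
    fix b :: 'a assume b: "b \<in> Basis"
    have "(\<integral>x. frechet_derivative f (at x) b * dpart [b] g x \<partial>lborel)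
       = - (\<integral>x. f x * frechet_derivative (dpart [b] g) (at x) b \<partial>lborel)"
    proof (rule integral_by_parts)
      show "f differentiable at x" for x using test_fun_differentiable[OF assms(1), of "[]"] by simp
      show "dpart [b] g differentiable at x" for x using test_fun_differentiable[OF assms(2), of "[b]"] b by simp
      show "Cc f" by (rule test_fun_Cc[OF assms(1)])
      show "Cc (\<lambda>x. frechet_derivative f (at x) b)" using test_fun_dpart_Cc[OF assms(1), of "[b]"] b by simp
      show "continuous_on UNIV (\<lambda>x. frechet_derivative (dpart [b] g) (at x) b)"
        using test_fun_dpart_Cc[OF assms(2), of "[b, b]", THEN Cc_continuous] b by simp
    qed
    then show "(\<integral>x. dpart [b] f x * dpart [b] g x \<partial>lborel) = - (\<integral>x. f x * dpart [b, b] g x \<partial>lborel)" by simp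
  qed
  also have "\<dots> = - (\<integral>x. (\<Sum>b\<in>Basis. f x * dpart [b, b] g x) \<partial>lborel)"
    using int by (subst Bochner_Integration.integral_sum) (auto simp: sum_negf)
  also have "\<dots> = - (\<integral>x. f x * lap g x \<partial>lborel)" by (simp add: lap_def sum_distrib_left)
  finally show ?thesis .
qed

lemma grad_translation_bound:
  assumes "test_fun \<Omega> f"
  shows "(\<integral>\<^sup>+x. ennreal ((f (x + w) - f x)\<^sup>2) \<partial>lborel) \<le> ennreal ((norm w)\<^sup>2 * l2sq lborel (grad f))"
proof -
  have d: "f differentiable at x" for x using test_fun_differentiable[OF assms, of "[]"] by simp
  have eq: "frechet_derivative f (at x) w = grad f x \<bullet> w" for x using grad_inner[OF d] by simp
  have g: "Cc (grad f)" by (rule test_fun_grad_Cc[OF assms])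
  have f': "Cc (\<lambda>x. frechet_derivative f (at x) w)"
    unfolding eq by (rule Cc_support_subset[OF g]) (auto intro!: continuous_intros Cc_continuous[OF g])
  have "(\<integral>x. (frechet_derivative f (at x) w)\<^sup>2 \<partial>lborel) \<le> (\<integral>x. (norm w)\<^sup>2 * (norm (grad f x))\<^sup>2 \<partial>lborel)"
  proof (rule integral_mono)
    show "integrable lborel (\<lambda>x. (frechet_derivative f (at x) w)\<^sup>2)"
      using Cc_integrable[OF Cc_norm_square[OF f']] by simp
    show "integrable lborel (\<lambda>x. (norm w)\<^sup>2 * (norm (grad f x))\<^sup>2)"
      using Cc_integrable[OF Cc_norm_square[OF g]] by simp
    show "(frechet_derivative f (at x) w)\<^sup>2 \<le> (norm w)\<^sup>2 * (norm (grad f x))\<^sup>2" for x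
      unfolding eq using Cauchy_Schwarz_ineq[of "grad f x" w] by (simp add: power2_norm_eq_inner mult.commute)
  qed
  also have "\<dots> = (norm w)\<^sup>2 * l2sq lborel (grad f)" unfolding l2sq_def by simp
  finally show ?thesis using translation_difference_bound[OF d f'] order_trans ennreal_leI by blast
qed

section \<open>Averages over the cells of a grid\<close>

text \<open>Rounding down to the lattice of mesh h. Its fibres are half-open cubes that partition
  the space, and \<open>range (rnd h)\<close> also serves later as the lattice of
  frequencies.\<close>

definition rnd :: "real \<Rightarrow> 'a::euclidean_space \<Rightarrow> 'a" where
  "rnd h x = (\<Sum>b\<in>Basis. (h * of_int \<lfloor>x \<bullet> b / h\<rfloor>) *\<^sub>R b)"

definition cell :: "real \<Rightarrow> 'a::euclidean_space \<Rightarrow> 'a set" where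
  "cell h q = {x. rnd h x = q}"

lemma rnd_inner: "b \<in> Basis \<Longrightarrow> rnd h x \<bullet> b = h * of_int \<lfloor>x \<bullet> b / h\<rfloor>"
  unfolding rnd_def by simp

lemma rnd_bounds:
  assumes "0 < h" "b \<in> Basis"
  shows "rnd h x \<bullet> b \<le> x \<bullet> b" "x \<bullet> b < rnd h x \<bullet> b + h"
proof -
  have "of_int \<lfloor>x \<bullet> b / h\<rfloor> \<le> x \<bullet> b / h" "x \<bullet> b / h < of_int \<lfloor>x \<bullet> b / h\<rfloor> + 1" by linarith+
  then show "rnd h x \<bullet> b \<le> x \<bullet> b" "x \<bullet> b < rnd h x \<bullet> b + h"
    unfolding pos_le_divide_eq[OF assms(1)] pos_divide_less_eq[OF assms(1)] rnd_inner[OF assms(2)]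
    by (simp_all add: algebra_simps)
qed

lemma cell_rnd:
  assumes "0 < h"
  shows "cell h (rnd h y) = {x. \<forall>b\<in>Basis. rnd h y \<bullet> b \<le> x \<bullet> b \<and> x \<bullet> b < rnd h y \<bullet> b + h}"
proof (intro set_eqI iffI)
  fix x :: 'a
  assume "x \<in> cell h (rnd h y)"
  then have "rnd h x = rnd h y" by (simp add: cell_def)
  then show "x \<in> {x. \<forall>b\<in>Basis. rnd h y \<bullet> b \<le> x \<bullet> b \<and> x \<bullet> b < rnd h y \<bullet> b + h}"
    using rnd_bounds[OF assms, of _ x] by auto
next
  fix x :: 'a
  assume x: "x \<in> {x. \<forall>b\<in>Basis. rnd h y \<bullet> b \<le> x \<bullet> b \<and> x \<bullet> b < rnd h y \<bullet> b + h}"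
  have "rnd h x = rnd h y"
  proof (rule euclidean_eqI)
    fix b :: 'a assume b: "b \<in> Basis"
    have "h * of_int \<lfloor>y \<bullet> b / h\<rfloor> \<le> x \<bullet> b" "x \<bullet> b < h * of_int \<lfloor>y \<bullet> b / h\<rfloor> + h"
      using x b by (auto simp: rnd_inner)
    then have "\<lfloor>x \<bullet> b / h\<rfloor> = \<lfloor>y \<bullet> b / h\<rfloor>"
      using assms by (intro floor_unique) (auto simp: field_simps)
    then show "rnd h x \<bullet> b = rnd h y \<bullet> b" using b by (simp add: rnd_inner)
  qed
  then show "x \<in> cell h (rnd h y)" by (simp add: cell_def)
qed

lemma rnd_measurable [measurable]: "rnd h \<in> borel_measurable borel"
  unfolding rnd_def[abs_def] by measurable

lemma cell_borel [measurable]: "cell h q \<in> sets borel"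
proof -
  have "rnd h -` {q} \<inter> space borel \<in> sets borel" by (rule measurable_sets[OF rnd_measurable]) simp
  then show ?thesis by (simp add: cell_def vimage_def)
qed

lemma emeasure_cell:
  assumes h: "0 < h"
  shows "emeasure lborel (cell h (rnd h y) :: 'a::euclidean_space set) = ennreal (h ^ DIM('a))"
proof -
  let ?q = "rnd h y" and ?r = "rnd h y + h *\<^sub>R One"
  have r: "?r \<bullet> b = ?q \<bullet> b + h" if "b \<in> Basis" for b using that by (simp add: inner_add_left)
  have "(\<Prod>b\<in>Basis. (?r - ?q) \<bullet> b) = (\<Prod>b\<in>(Basis::'a set). h)"
    by (rule prod.cong) (auto simp: r inner_diff_left inner_add_left)
  then have v: "(\<Prod>b\<in>Basis. (?r - ?q) \<bullet> b) = h ^ DIM('a)" by simp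
  show ?thesis
  proof (rule antisym)
    have "cell h ?q \<subseteq> cbox ?q ?r"
      unfolding cell_rnd[OF h] using r by (auto simp: mem_box less_imp_le)
    then have "emeasure lborel (cell h ?q) \<le> emeasure lborel (cbox ?q ?r)" by (intro emeasure_mono) auto
    also have "\<dots> = ennreal (h ^ DIM('a))"
      using r h v by (subst emeasure_lborel_cbox) (auto simp: less_imp_le)
    finally show "emeasure lborel (cell h ?q) \<le> ennreal (h ^ DIM('a))" .
    have "box ?q ?r \<subseteq> cell h ?q"
      unfolding cell_rnd[OF h] using r by (auto simp: mem_box less_imp_le)
    then have "emeasure lborel (box ?q ?r) \<le> emeasure lborel (cell h ?q)" by (intro emeasure_mono) auto
    moreover have "emeasure lborel (box ?q ?r) = ennreal (h ^ DIM('a))"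
      using r h v by (subst emeasure_lborel_box) (auto simp: less_imp_le)
    ultimately show "ennreal (h ^ DIM('a)) \<le> emeasure lborel (cell h ?q)" by simp
  qed
qed

lemma measure_cell:
  "0 < h \<Longrightarrow> measure lborel (cell h (rnd h y) :: 'a::euclidean_space set) = h ^ DIM('a)"
  using emeasure_cell[of h y] by (intro measure_eq_emeasure_eq_ennreal) auto

lemma norm_le_coordinates:
  assumes "\<And>b. b \<in> Basis \<Longrightarrow> \<bar>x \<bullet> b\<bar> \<le> h"
  shows "norm (x::'a::euclidean_space) \<le> real DIM('a) * h"
proof -
  have "norm x \<le> (\<Sum>b\<in>Basis. \<bar>x \<bullet> b\<bar>)" by (rule norm_le_l1)
  also have "\<dots> \<le> (\<Sum>b\<in>(Basis::'a set). h)" by (intro sum_mono assms)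
  finally show ?thesis by simp
qed

lemma norm_diff_rnd:
  assumes "0 < h" shows "norm (x - rnd h x :: 'a::euclidean_space) \<le> real DIM('a) * h"
  using rnd_bounds[OF assms, of _ x] by (intro norm_le_coordinates) (force simp: inner_diff_left)

text \<open>The cells are disjoint, so at most |S|/c of them can carry volume \<open>c\<close> of
  \<open>S\<close>.\<close>

lemma finite_heavy_cells:
  fixes S :: "'a::euclidean_space set"
  assumes S: "S \<in> sets borel" "emeasure lborel S < \<infinity>" and c: "0 < c"
  shows "finite {q \<in> range (rnd h). c \<le> measure lborel (S \<inter> cell h q)}" (is "finite ?F")
proof -
  have "card G \<le> nat \<lfloor>measure lborel S / c\<rfloor>" if G: "G \<subseteq> ?F" "finite G" for G
  proof -
    have Sm: "S \<in> sets lborel" using S by simp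
    have fin: "emeasure lborel (S \<inter> cell h q) < \<infinity>" for q
      using emeasure_mono[OF _ Sm, of "S \<inter> cell h q"] S(2) by (meson Int_lower1 le_less_trans)
    have "real (card G) * c = (\<Sum>q\<in>G. c)" by simp
    also have "\<dots> \<le> (\<Sum>q\<in>G. measure lborel (S \<inter> cell h q))" using G by (intro sum_mono) auto
    also have "\<dots> = measure lborel (\<Union>q\<in>G. S \<inter> cell h q)"
    proof (rule measure_finite_Union[symmetric])
      show "disjoint_family_on (\<lambda>q. S \<inter> cell h q) G" by (auto simp: disjoint_family_on_def cell_def)
      show "(\<lambda>q. S \<inter> cell h q) ` G \<subseteq> sets lborel" using S by auto
    qed (use G fin in \<open>auto simp: less_top[symmetric]\<close>)
    also have "\<dots> \<le> measure lborel S"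
      using S Sm G by (intro measure_mono_fmeasurable) (auto simp: fmeasurable_def)
    finally have "real (card G) \<le> measure lborel S / c" using c by (simp add: field_simps)
    then show ?thesis by (simp add: le_nat_floor)
  qed
  then show ?thesis using finite_if_finite_subsets_card_bdd by blast
qed

lemma square_integral_le_measure:
  fixes g :: "'b \<Rightarrow> real"
  assumes Q: "Q \<in> sets M" "emeasure M Q < \<infinity>" and g: "g \<in> borel_measurable M" "\<And>x. \<bar>g x\<bar> \<le> S"
  shows "integrable M (\<lambda>x. indicator Q x * g x)" "integrable M (\<lambda>x. indicator Q x * (g x)\<^sup>2)"
    "(\<integral>x. indicator Q x * g x \<partial>M)\<^sup>2 \<le> measure M Q * (\<integral>x. indicator Q x * (g x)\<^sup>2 \<partial>M)"
proof -
  let ?I = "\<lambda>x. indicator Q x :: real"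
  have intI: "integrable M ?I" using Q by simp
  have S: "0 \<le> S" using g(2)[of undefined] by linarith
  show int1: "integrable M (\<lambda>x. ?I x * g x)"
    using intI g Q S by (intro Bochner_Integration.integrable_bound[OF integrable_mult_right[OF intI, of S]])
      (auto simp: abs_mult indicator_def)
  have "(g x)\<^sup>2 \<le> S\<^sup>2" for x using g(2)[of x] S by (intro abs_le_square_iff[THEN iffD1]) auto
  then show int2: "integrable M (\<lambda>x. ?I x * (g x)\<^sup>2)"
    using intI g Q by (intro Bochner_Integration.integrable_bound[OF integrable_mult_right[OF intI, of "S\<^sup>2"]])
      (auto simp: abs_mult indicator_def)
  have sq: "(norm (?I t))\<^sup>2 = ?I t" "(norm (?I t * g t))\<^sup>2 = ?I t * (g t)\<^sup>2" "?I t * ?I t = ?I t"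
    "?I t * (?I t * g t) = ?I t * g t" "(?I t * g t) * (?I t * g t) = ?I t * (g t)\<^sup>2" for t
    by (auto simp: indicator_def power2_eq_square)
  have psd: "psd_form {u. L2f M u} (\<lambda>u w. \<integral>x. u x * (w x :: real) \<partial>M)"
    by (intro psd_form_L2 bounded_bilinear_mult subspace_L2f) auto
  have "L2f M ?I" "L2f M (\<lambda>t. ?I t * g t)"
    unfolding L2f_def sq using intI int1 int2 borel_measurable_integrable by auto
  then show "(\<integral>x. ?I x * g x \<partial>M)\<^sup>2 \<le> measure M Q * (\<integral>x. ?I x * (g x)\<^sup>2 \<partial>M)"
    using psd_form_Cauchy_Schwarz[OF psd, of ?I "\<lambda>t. ?I t * g t"] Q
    unfolding mem_Collect_eq sq by simp
qed

definition heavy_cells :: "real \<Rightarrow> 'a::euclidean_space set \<Rightarrow> 'a set" where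
  "heavy_cells h \<Omega> = {q \<in> range (rnd h). h ^ DIM('a) / 2 \<le> measure lborel (\<Omega> \<inter> cell h q)}"

text \<open>On a cell meeting \<open>\<Omega>\<close> in less than half of its volume the function vanishes on a large set,
  so no mean value is needed; only the finitely many heavy cells contribute functionals.\<close>
lemma cell_pointwise_bound:
  fixes f :: "'a::euclidean_space \<Rightarrow> real"
  assumes h: "0 < h" and f: "Cc f" "\<And>x. x \<notin> \<Omega> \<Longrightarrow> f x = 0"
    and \<Omega>: "\<Omega> \<in> sets borel" "emeasure lborel \<Omega> < \<infinity>"
  shows "(f x)\<^sup>2 \<le> (\<Sum>q\<in>heavy_cells h \<Omega>. indicator (cell h q) x * (2 / (h ^ DIM('a))\<^sup>2 * (\<integral>y. indicator (cell h q) y * f y \<partial>lborel)\<^sup>2))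
     + 2 / h ^ DIM('a) * (\<integral>y. indicator (cell h (rnd h x)) y * (f x - f y)\<^sup>2 \<partial>lborel)"
proof -
  let ?q = "rnd h x" and ?v = "h ^ DIM('a)"
  let ?Q = "cell h ?q"
  let ?D = "\<integral>y. indicator ?Q y * (f x - f y)\<^sup>2 \<partial>lborel"
  obtain S where S: "0 \<le> S" "\<And>x. norm (f x) \<le> S" using Cc_bounded[OF f(1)] by blast
  have v: "0 < ?v" using h by simp
  have fm: "f \<in> borel_measurable borel" by (rule Cc_measurable[OF f(1)])
  have Q: "?Q \<in> sets lborel" "emeasure lborel ?Q < \<infinity>" "measure lborel ?Q = ?v"
    using emeasure_cell[OF h, of x] measure_cell[OF h, of x] by auto
  have bd: "\<bar>f x - f y\<bar> \<le> 2 * S" for y using S(2)[of x] S(2)[of y] by auto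
  note cs = square_integral_le_measure[OF Q(1,2), of "\<lambda>y. f x - f y" "2 * S"]
  have gm: "(\<lambda>y. f x - f y) \<in> borel_measurable lborel" using fm by simp
  note cs = cs[OF gm bd]
  note fi = square_integral_le_measure(1)[OF Q(1,2), of f S]
  have fi: "integrable lborel (\<lambda>y. indicator ?Q y * f y)" using fi fm S by simp
  have fin: "finite (heavy_cells h \<Omega>)"
    unfolding heavy_cells_def using v by (intro finite_heavy_cells \<Omega>) simp
  have sum_nn: "0 \<le> (\<Sum>q\<in>heavy_cells h \<Omega>. indicator (cell h q) x * (2 / ?v\<^sup>2 * (\<integral>y. indicator (cell h q) y * f y \<partial>lborel)\<^sup>2))"
    by (intro sum_nonneg mult_nonneg_nonneg) auto
  show ?thesis
  proof (cases "?q \<in> heavy_cells h \<Omega>")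
    case True
    let ?m = "\<integral>y. indicator ?Q y * f y \<partial>lborel"
    have xQ: "x \<in> ?Q" by (simp add: cell_def)
    have "(\<integral>y. indicator ?Q y * (f x - f y) \<partial>lborel) = (\<integral>y. indicator ?Q y * f x - indicator ?Q y * f y \<partial>lborel)"
      by (simp add: right_diff_distrib)
    also have "\<dots> = ?v * f x - ?m" using fi Q by (subst Bochner_Integration.integral_diff) auto
    finally have "(?v * f x - ?m)\<^sup>2 \<le> ?v * ?D" using cs(3) Q(3) by simp
    \<comment> \<open>v f(x) is split into the cell integral and v times the deviation from the
      mean; Cauchy-Schwarz just above bounds the deviation by the oscillation
      \<open>?D\<close>.\<close>
    moreover have "(?v * f x)\<^sup>2 \<le> 2 * ?m\<^sup>2 + 2 * (?v * f x - ?m)\<^sup>2"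
      using norm_add_square_le[of ?m "?v * f x - ?m"] by simp
    ultimately have "?v\<^sup>2 * (f x)\<^sup>2 \<le> 2 * ?m\<^sup>2 + 2 * (?v * ?D)" by (simp add: power_mult_distrib)
    then have "(f x)\<^sup>2 \<le> (2 * ?m\<^sup>2 + 2 * (?v * ?D)) / ?v\<^sup>2"
      using zero_less_power[OF v, of 2] by (simp only: pos_le_divide_eq mult.commute)
    also have "\<dots> = 2 / ?v\<^sup>2 * ?m\<^sup>2 + 2 / ?v * ?D"
    proof -
      have "(2 * m\<^sup>2 + 2 * (v * D)) / v\<^sup>2 = 2 / v\<^sup>2 * m\<^sup>2 + 2 / v * D" if "0 < v" for v m D :: real
        using that by (simp add: field_simps power2_eq_square)
      from this[OF v] show ?thesis .
    qed
    also have "2 / ?v\<^sup>2 * ?m\<^sup>2 = indicator ?Q x * (2 / ?v\<^sup>2 * ?m\<^sup>2)" using xQ by simp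
    also have "\<dots> \<le> (\<Sum>q\<in>heavy_cells h \<Omega>. indicator (cell h q) x * (2 / ?v\<^sup>2 * (\<integral>y. indicator (cell h q) y * f y \<partial>lborel)\<^sup>2))"
      using fin True by (intro member_le_sum mult_nonneg_nonneg) auto
    finally show ?thesis by simp
  next
    case False
    then have small: "measure lborel (\<Omega> \<inter> ?Q) \<le> ?v / 2" by (auto simp: heavy_cells_def)
    have fin': "emeasure lborel (\<Omega> \<inter> ?Q) < \<infinity>"
      using emeasure_mono[of "\<Omega> \<inter> ?Q" ?Q lborel] Q(1,2) by (meson Int_lower2 le_less_trans)
    have "integrable lborel (\<lambda>y. indicator (\<Omega> \<inter> ?Q) y * (f x)\<^sup>2)" "integrable lborel (\<lambda>y. indicator ?Q y * (f x)\<^sup>2)"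
      using fin' Q \<Omega> by auto
    note int = this
    \<comment> \<open>At least half of a light cell lies outside \<Omega>, where f(y) = 0 and (f x -
      f y)^2 = (f x)^2, so the oscillation alone controls the value.\<close>
    have "?v / 2 * (f x)\<^sup>2 \<le> (?v - measure lborel (\<Omega> \<inter> ?Q)) * (f x)\<^sup>2"
      using small by (intro mult_right_mono) auto
    also have "\<dots> = (\<integral>y. indicator ?Q y * (f x)\<^sup>2 - indicator (\<Omega> \<inter> ?Q) y * (f x)\<^sup>2 \<partial>lborel)"
      using int Q \<Omega> fin' by (subst Bochner_Integration.integral_diff) (auto simp: left_diff_distrib)
    also have "\<dots> \<le> ?D"
    proof (rule integral_mono)
      show "integrable lborel (\<lambda>y. indicator ?Q y * (f x)\<^sup>2 - indicator (\<Omega> \<inter> ?Q) y * (f x)\<^sup>2)"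
        using int by (rule Bochner_Integration.integrable_diff[rotated])
      show "integrable lborel (\<lambda>y. indicator ?Q y * (f x - f y)\<^sup>2)" by (rule cs(2))
      show "indicator ?Q y * (f x)\<^sup>2 - indicator (\<Omega> \<inter> ?Q) y * (f x)\<^sup>2 \<le> indicator ?Q y * (f x - f y)\<^sup>2" for y
        using f(2)[of y] by (auto simp: indicator_def)
    qed
    finally have "(f x)\<^sup>2 \<le> 2 / ?v * ?D" using v by (simp add: field_simps)
    then show ?thesis using sum_nn by linarith
  qed
qed

text \<open>Two points of one cell differ by a vector of the cube [-h,h]^d. Integrating over all
  such translations only increases the integral; after Tonelli each translation costs at most (d
  h)^2 times the gradient energy, and the cube has volume (2h)^d.\<close>

lemma cell_oscillation_bound:
  fixes f :: "'a::euclidean_space \<Rightarrow> real"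
  assumes h: "0 < h" and f: "test_fun \<Omega> f"
  shows "(\<integral>\<^sup>+x. (\<integral>\<^sup>+y. indicator (cell h (rnd h x)) y * ennreal ((f x - f y)\<^sup>2) \<partial>lborel) \<partial>lborel)
     \<le> ennreal ((2 * h) ^ DIM('a) * ((real DIM('a) * h)\<^sup>2 * l2sq lborel (grad f)))"
proof -
  have fm[measurable]: "f \<in> borel_measurable borel" by (rule Cc_measurable[OF test_fun_Cc[OF f]])
  let ?B = "cbox (- h *\<^sub>R One) (h *\<^sub>R One) :: 'a set"
  have in_B: "w \<in> ?B" if "rnd h (x + w) = rnd h x" for x w :: 'a
  proof -
    have "\<bar>w \<bullet> b\<bar> \<le> h" if b: "b \<in> Basis" for b
      using rnd_bounds[OF h b, of x] rnd_bounds[OF h b, of "x + w"] \<open>rnd h (x + w) = rnd h x\<close>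
      by (simp add: inner_add_left abs_le_iff)
    then show ?thesis by (auto simp: mem_box abs_le_iff minus_le_iff)
  qed
  have "(\<integral>\<^sup>+x. (\<integral>\<^sup>+y. indicator (cell h (rnd h x)) y * ennreal ((f x - f y)\<^sup>2) \<partial>lborel) \<partial>lborel)
     \<le> (\<integral>\<^sup>+x. (\<integral>\<^sup>+w. indicator ?B w * ennreal ((f (x + w) - f x)\<^sup>2) \<partial>lborel) \<partial>lborel)"
  proof (rule nn_integral_mono)
    fix x :: 'a
    have m: "(\<lambda>y. indicator (cell h (rnd h x)) y * ennreal ((f x - f y)\<^sup>2)) \<in> borel_measurable borel"
      by measurable
    have "(\<integral>\<^sup>+y. indicator (cell h (rnd h x)) y * ennreal ((f x - f y)\<^sup>2) \<partial>lborel)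
        = (\<integral>\<^sup>+w. indicator (cell h (rnd h x)) (x + w) * ennreal ((f x - f (x + w))\<^sup>2) \<partial>lborel)"
      by (rule lborel_nn_integral_translation[OF m, symmetric])
    also have "\<dots> \<le> (\<integral>\<^sup>+w. indicator ?B w * ennreal ((f (x + w) - f x)\<^sup>2) \<partial>lborel)"
      using in_B[of x] by (intro nn_integral_mono) (auto simp: indicator_def cell_def power2_commute)
    finally show "(\<integral>\<^sup>+y. indicator (cell h (rnd h x)) y * ennreal ((f x - f y)\<^sup>2) \<partial>lborel)
      \<le> (\<integral>\<^sup>+w. indicator ?B w * ennreal ((f (x + w) - f x)\<^sup>2) \<partial>lborel)" .
  qed
  also have "\<dots> = (\<integral>\<^sup>+w. (\<integral>\<^sup>+x. indicator ?B w * ennreal ((f (x + w) - f x)\<^sup>2) \<partial>lborel) \<partial>lborel)"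
    by (rule lborel_pair.Fubini'[symmetric]) measurable
  also have "\<dots> \<le> (\<integral>\<^sup>+w. indicator ?B w * ennreal ((real DIM('a) * h)\<^sup>2 * l2sq lborel (grad f)) \<partial>lborel)"
  proof (rule nn_integral_mono)
    fix w :: 'a
    show "(\<integral>\<^sup>+x. indicator ?B w * ennreal ((f (x + w) - f x)\<^sup>2) \<partial>lborel)
      \<le> indicator ?B w * ennreal ((real DIM('a) * h)\<^sup>2 * l2sq lborel (grad f))"
    proof (cases "w \<in> ?B")
      case True
      then have "norm w \<le> real DIM('a) * h"
        by (intro norm_le_coordinates) (auto simp: mem_box abs_le_iff minus_le_iff)
      then have "ennreal ((norm w)\<^sup>2 * l2sq lborel (grad f)) \<le> ennreal ((real DIM('a) * h)\<^sup>2 * l2sq lborel (grad f))"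
        by (intro ennreal_leI mult_right_mono power_mono) auto
      from order_trans[OF grad_translation_bound[OF f, of w] this] show ?thesis using True by simp
    qed simp
  qed
  also have "\<dots> = ennreal ((real DIM('a) * h)\<^sup>2 * l2sq lborel (grad f)) * emeasure lborel ?B"
    by (subst nn_integral_multc) (auto simp: mult.commute)
  also have "emeasure lborel ?B = ennreal (\<Prod>b\<in>(Basis::'a set). (h *\<^sub>R One - - h *\<^sub>R One) \<bullet> b)"
    using h by (subst emeasure_lborel_cbox) auto
  also have "(\<Prod>b\<in>(Basis::'a set). (h *\<^sub>R One - - h *\<^sub>R One) \<bullet> b) = (\<Prod>b\<in>(Basis::'a set). 2 * h)"
    by (rule prod.cong) (auto simp: inner_add_left)
  also have "\<dots> = (2 * h) ^ DIM('a)" by simp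
  finally show ?thesis using h by (simp add: ennreal_mult[symmetric] mult.commute)
qed

text \<open>The pointwise estimate is integrated. A cell volume cancels one power of h^d in front of
  the functionals, and (2/h^d) (2h)^d (d h)^2 gives the coefficient of the gradient term, which is
  small for small h.\<close>

lemma test_fun_finite_rank_bound:
  fixes f :: "'a::euclidean_space \<Rightarrow> real"
  assumes h: "0 < h" and f: "test_fun \<Omega> f"
    and \<Omega>: "\<Omega> \<in> sets borel" "emeasure lborel \<Omega> < \<infinity>"
  shows "l2sq lborel f \<le> (\<Sum>q\<in>heavy_cells h \<Omega>. 2 / h ^ DIM('a) * (\<integral>y. indicator (cell h q) y * f y \<partial>lborel)\<^sup>2)
     + 2 * 2 ^ DIM('a) * (real DIM('a))\<^sup>2 * h\<^sup>2 * l2sq lborel (grad f)"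
proof -
  let ?v = "h ^ DIM('a)" and ?H = "heavy_cells h \<Omega>"
  define a where "a = (\<lambda>q. (\<integral>y. indicator (cell h q) y * f y \<partial>lborel)\<^sup>2)"
  have v: "0 < ?v" using h by simp
  have f0: "f x = 0" if "x \<notin> \<Omega>" for x using test_fun_dpart_outside[OF f that, of "[]"] by simp
  note Cf = test_fun_Cc[OF f]
  have fm[measurable]: "f \<in> borel_measurable borel" by (rule Cc_measurable[OF Cf])
  obtain S where S: "0 \<le> S" "\<And>x. norm (f x) \<le> S" using Cc_bounded[OF Cf] by blast
  have a0: "0 \<le> a q" for q unfolding a_def by simp
  have D: "ennreal (\<integral>y. indicator (cell h (rnd h x)) y * (f x - f y)\<^sup>2 \<partial>lborel)
      = (\<integral>\<^sup>+y. indicator (cell h (rnd h x)) y * ennreal ((f x - f y)\<^sup>2) \<partial>lborel)" for x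
  proof -
    have Q: "cell h (rnd h x) \<in> sets lborel" "emeasure lborel (cell h (rnd h x)) < \<infinity>"
      using emeasure_cell[OF h, of x] by auto
    have bd: "\<bar>f x - f y\<bar> \<le> 2 * S" for y using S(2)[of x] S(2)[of y] by auto
    have "integrable lborel (\<lambda>y. indicator (cell h (rnd h x)) y * (f x - f y)\<^sup>2)"
      by (rule square_integral_le_measure(2)[OF Q _ bd]) measurable
    then have "ennreal (\<integral>y. indicator (cell h (rnd h x)) y * (f x - f y)\<^sup>2 \<partial>lborel)
       = (\<integral>\<^sup>+y. ennreal (indicator (cell h (rnd h x)) y * (f x - f y)\<^sup>2) \<partial>lborel)"
      by (intro nn_integral_eq_integral[symmetric]) auto
    also have "\<dots> = (\<integral>\<^sup>+y. indicator (cell h (rnd h x)) y * ennreal ((f x - f y)\<^sup>2) \<partial>lborel)"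
      by (intro nn_integral_cong) (auto simp: indicator_def)
    finally show ?thesis .
  qed
  have Dm: "(\<lambda>x. \<integral>\<^sup>+y. indicator (cell h (rnd h x)) y * ennreal ((f x - f y)\<^sup>2) \<partial>lborel) \<in> borel_measurable lborel"
  proof -
    have "(\<lambda>(x, y). indicator {p. rnd h (snd p) = rnd h (fst p)} (x, y) * ennreal ((f x - f y)\<^sup>2))
        \<in> borel_measurable (lborel \<Otimes>\<^sub>M lborel :: ('a \<times> 'a) measure)"
      by measurable
    from lborel.borel_measurable_nn_integral[OF this] show ?thesis
      by (simp add: cell_def indicator_def)
  qed
  have pt: "ennreal ((f x)\<^sup>2) \<le> (\<Sum>q\<in>?H. ennreal (2 / ?v\<^sup>2 * a q) * indicator (cell h q) x)
      + ennreal (2 / ?v) * (\<integral>\<^sup>+y. indicator (cell h (rnd h x)) y * ennreal ((f x - f y)\<^sup>2) \<partial>lborel)" for x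
  proof -
    have "ennreal ((f x)\<^sup>2) \<le> ennreal ((\<Sum>q\<in>?H. indicator (cell h q) x * (2 / ?v\<^sup>2 * a q))
      + 2 / ?v * (\<integral>y. indicator (cell h (rnd h x)) y * (f x - f y)\<^sup>2 \<partial>lborel))"
      unfolding a_def by (intro ennreal_leI cell_pointwise_bound h Cf f0 \<Omega>)
    also have "\<dots> = ennreal (\<Sum>q\<in>?H. indicator (cell h q) x * (2 / ?v\<^sup>2 * a q))
      + ennreal (2 / ?v * (\<integral>y. indicator (cell h (rnd h x)) y * (f x - f y)\<^sup>2 \<partial>lborel))"
      using v a0 by (intro ennreal_plus sum_nonneg mult_nonneg_nonneg integral_nonneg_AE) auto
    also have "ennreal (\<Sum>q\<in>?H. indicator (cell h q) x * (2 / ?v\<^sup>2 * a q))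
      = (\<Sum>q\<in>?H. ennreal (2 / ?v\<^sup>2 * a q) * indicator (cell h q) x)"
    proof -
      have "(\<Sum>q\<in>?H. ennreal (2 / ?v\<^sup>2 * a q) * indicator (cell h q) x)
          = (\<Sum>q\<in>?H. ennreal (indicator (cell h q) x * (2 / ?v\<^sup>2 * a q)))"
        by (intro sum.cong) (auto simp: indicator_def)
      also have "\<dots> = ennreal (\<Sum>q\<in>?H. indicator (cell h q) x * (2 / ?v\<^sup>2 * a q))"
        using a0 by (intro sum_ennreal mult_nonneg_nonneg) auto
      finally show ?thesis by simp
    qed
    also have "ennreal (2 / ?v * (\<integral>y. indicator (cell h (rnd h x)) y * (f x - f y)\<^sup>2 \<partial>lborel))
      = ennreal (2 / ?v) * (\<integral>\<^sup>+y. indicator (cell h (rnd h x)) y * ennreal ((f x - f y)\<^sup>2) \<partial>lborel)"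
      unfolding D[symmetric] using v by (intro ennreal_mult integral_nonneg_AE) auto
    finally show ?thesis .
  qed
  have osc: "ennreal (2 / ?v) * (\<integral>\<^sup>+x. (\<integral>\<^sup>+y. indicator (cell h (rnd h x)) y * ennreal ((f x - f y)\<^sup>2) \<partial>lborel) \<partial>lborel)
     \<le> ennreal (2 * 2 ^ DIM('a) * (real DIM('a))\<^sup>2 * h\<^sup>2 * l2sq lborel (grad f))"
  proof -
    have "ennreal (2 / ?v) * (\<integral>\<^sup>+x. (\<integral>\<^sup>+y. indicator (cell h (rnd h x)) y * ennreal ((f x - f y)\<^sup>2) \<partial>lborel) \<partial>lborel)
     \<le> ennreal (2 / ?v) * ennreal ((2 * h) ^ DIM('a) * ((real DIM('a) * h)\<^sup>2 * l2sq lborel (grad f)))"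
    by (intro mult_left_mono cell_oscillation_bound[OF h f]) auto
  also have "\<dots> = ennreal (2 / ?v * ((2 * h) ^ DIM('a) * ((real DIM('a) * h)\<^sup>2 * l2sq lborel (grad f))))"
    using v h by (intro ennreal_mult[symmetric]) auto
  also have "2 / ?v * ((2 * h) ^ DIM('a) * ((real DIM('a) * h)\<^sup>2 * l2sq lborel (grad f)))
     = 2 * 2 ^ DIM('a) * (real DIM('a))\<^sup>2 * h\<^sup>2 * l2sq lborel (grad f)"
    using v by (simp add: power_mult_distrib)
    finally show ?thesis .
  qed
  have Lf: "L2f lborel f"
    using Cc_integrable[OF Cc_norm_square[OF Cf]] fm by (auto simp: L2f_def)
  have "ennreal (l2sq lborel f) = (\<integral>\<^sup>+x. ennreal ((f x)\<^sup>2) \<partial>lborel)"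
    using nn_integral_l2sq[OF Lf] by simp
  also have "\<dots> \<le> (\<integral>\<^sup>+x. (\<Sum>q\<in>?H. ennreal (2 / ?v\<^sup>2 * a q) * indicator (cell h q) x)
      + ennreal (2 / ?v) * (\<integral>\<^sup>+y. indicator (cell h (rnd h x)) y * ennreal ((f x - f y)\<^sup>2) \<partial>lborel) \<partial>lborel)"
    by (intro nn_integral_mono pt)
  also have "\<dots> = (\<Sum>q\<in>?H. ennreal (2 / ?v\<^sup>2 * a q) * emeasure lborel (cell h q))
      + ennreal (2 / ?v) * (\<integral>\<^sup>+x. (\<integral>\<^sup>+y. indicator (cell h (rnd h x)) y * ennreal ((f x - f y)\<^sup>2) \<partial>lborel) \<partial>lborel)"
    using Dm by (subst nn_integral_add) (auto simp: nn_integral_cmult nn_integral_sum nn_integral_cmult_indicator)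
  also have "(\<Sum>q\<in>?H. ennreal (2 / ?v\<^sup>2 * a q) * emeasure lborel (cell h q)) = (\<Sum>q\<in>?H. ennreal (2 / ?v * a q))"
  proof (rule sum.cong[OF refl])
    fix q assume "q \<in> ?H"
    then have "emeasure lborel (cell h q) = ennreal ?v"
      using emeasure_cell[OF h] by (auto simp: heavy_cells_def)
    then show "ennreal (2 / ?v\<^sup>2 * a q) * emeasure lborel (cell h q) = ennreal (2 / ?v * a q)"
      using v a0[of q] by (simp add: ennreal_mult[symmetric] power2_eq_square)
  qed
  also have "\<dots> = ennreal (\<Sum>q\<in>?H. 2 / ?v * a q)"
    using v a0 by (intro sum_ennreal) auto
  also have "ennreal (\<Sum>q\<in>?H. 2 / ?v * a q)
      + ennreal (2 / ?v) * (\<integral>\<^sup>+x. (\<integral>\<^sup>+y. indicator (cell h (rnd h x)) y * ennreal ((f x - f y)\<^sup>2) \<partial>lborel) \<partial>lborel)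
      \<le> ennreal (\<Sum>q\<in>?H. 2 / ?v * a q) + ennreal (2 * 2 ^ DIM('a) * (real DIM('a))\<^sup>2 * h\<^sup>2 * l2sq lborel (grad f))"
    by (intro add_left_mono osc)
  also have "ennreal (\<Sum>q\<in>?H. 2 / ?v * a q) + ennreal (2 * 2 ^ DIM('a) * (real DIM('a))\<^sup>2 * h\<^sup>2 * l2sq lborel (grad f))
     = ennreal ((\<Sum>q\<in>?H. 2 / ?v * a q) + 2 * 2 ^ DIM('a) * (real DIM('a))\<^sup>2 * h\<^sup>2 * l2sq lborel (grad f))"
    using v a0 by (intro ennreal_plus[symmetric] sum_nonneg) auto
  finally show ?thesis
    unfolding a_def using v by (subst (asm) ennreal_le_iff) (auto intro!: add_nonneg_nonneg sum_nonneg)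
qed

section \<open>The space \<open>H\<^sup>2\<^sub>0\<close> and its energy forms\<close>

lemma tendsto_zero_dominated:
  fixes f g :: "nat \<Rightarrow> real"
  assumes "\<And>n. 0 \<le> f n" "\<And>n. f n \<le> g n" "g \<longlonglongrightarrow> 0" shows "f \<longlonglongrightarrow> 0"
  by (rule tendsto_sandwich[OF _ _ tendsto_const assms(3)]) (simp_all add: assms)

locale finite_volume_domain =
  fixes \<Omega> :: "'a::euclidean_space set"
  assumes open_\<Omega>: "open \<Omega>" and finite_volume: "emeasure lebesgue \<Omega> < \<infinity>"
begin

abbreviation M :: "'a measure" where "M \<equiv> lebesgue_on \<Omega>"

lemma \<Omega>_borel: "\<Omega> \<in> sets borel"
  using open_\<Omega> by simp

lemma \<Omega>_lebesgue: "\<Omega> \<in> sets lebesgue" "\<Omega> \<inter> space lebesgue \<in> sets lebesgue"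
  using \<Omega>_borel by simp_all

lemma emeasure_lborel_\<Omega>: "emeasure lborel \<Omega> < \<infinity>"
  using finite_volume emeasure_completion[of \<Omega> lborel] \<Omega>_borel by simp

lemma borel_measurable_M: "f \<in> borel_measurable borel \<Longrightarrow> f \<in> borel_measurable M"
  by (rule measurable_restrict_space1, rule measurable_completion) simp

lemma integrable_M:
  fixes f :: "'a \<Rightarrow> 'b::euclidean_space"
  assumes "integrable lborel f" shows "integrable M f"
proof -
  have "integrable lebesgue f"
    using assms integrable_completion[of f lborel] borel_measurable_integrable[OF assms] by simp
  then have "integrable lebesgue (\<lambda>x. indicator \<Omega> x *\<^sub>R f x)"
    using \<Omega>_lebesgue by (intro integrable_mult_indicator) auto
  then show ?thesis using integrable_restrict_space[OF \<Omega>_lebesgue(2)] by blast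
qed

lemma integral_M:
  fixes f :: "'a \<Rightarrow> 'b::euclidean_space"
  assumes "f \<in> borel_measurable borel" "\<And>x. x \<notin> \<Omega> \<Longrightarrow> f x = 0"
  shows "integral\<^sup>L M f = integral\<^sup>L lborel f"
proof -
  have "integral\<^sup>L M f = integral\<^sup>L lebesgue (\<lambda>x. indicator \<Omega> x *\<^sub>R f x)"
    by (rule integral_restrict_space[OF \<Omega>_lebesgue(2)])
  also have "(\<lambda>x. indicator \<Omega> x *\<^sub>R f x) = f" using assms(2) by (auto simp: fun_eq_iff indicator_def)
  also have "integral\<^sup>L lebesgue f = integral\<^sup>L lborel f"
    using assms(1) by (intro integral_completion) simp
  finally show ?thesis .
qed

lemma L2f_Cc: "Cc f \<Longrightarrow> L2f M f"
  unfolding L2f_def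
  by (intro conjI borel_measurable_M integrable_M Cc_measurable Cc_integrable Cc_norm_square)

lemma L2f_jet: "test_fun \<Omega> f \<Longrightarrow> L2f M (jet f)"
  by (rule L2f_Cc[OF test_fun_jet_Cc])

text \<open>An element of \<open>H\<^sup>2\<^sub>0\<close> is represented by the triple of the function, its weak gradient and its weak Laplacian.\<close>
definition W20 :: "('a \<Rightarrow> real \<times> 'a \<times> real) set" where
  "W20 = {u. u \<in> borel_measurable lebesgue \<and> L2f M u \<and>
      (\<exists>\<phi>. (\<forall>n. test_fun \<Omega> (\<phi> n)) \<and> (\<lambda>n. l2sq M (jet (\<phi> n) - u)) \<longlonglongrightarrow> 0)}"

definition formA :: "('a \<Rightarrow> real \<times> 'a \<times> real) \<Rightarrow> ('a \<Rightarrow> real \<times> 'a \<times> real) \<Rightarrow> real" where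
  "formA u w = (\<integral>x. snd (snd (u x)) * snd (snd (w x)) \<partial>M)"

definition formB :: "('a \<Rightarrow> real \<times> 'a \<times> real) \<Rightarrow> ('a \<Rightarrow> real \<times> 'a \<times> real) \<Rightarrow> real" where
  "formB u w = (\<integral>x. fst (snd (u x)) \<bullet> fst (snd (w x)) \<partial>M)"

definition formC :: "('a \<Rightarrow> real \<times> 'a \<times> real) \<Rightarrow> ('a \<Rightarrow> real \<times> 'a \<times> real) \<Rightarrow> real" where
  "formC u w = (\<integral>x. fst (u x) * fst (w x) \<partial>M)"

text \<open>The mixed pairing of a function with a Laplacian. It is not assumed symmetric; it serves
  to express Green's identity on the closure.\<close>

definition formE :: "('a \<Rightarrow> real \<times> 'a \<times> real) \<Rightarrow> ('a \<Rightarrow> real \<times> 'a \<times> real) \<Rightarrow> real" where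
  "formE u w = (\<integral>x. fst (u x) * snd (snd (w x)) \<partial>M)"

lemmas form_defs = formA_def formB_def formC_def formE_def

lemma bounded_bilinear_forms:
  "bounded_bilinear (\<lambda>(x :: real \<times> 'a \<times> real) (y :: real \<times> 'a \<times> real). snd (snd x) * snd (snd y))"
  "bounded_bilinear (\<lambda>(x :: real \<times> 'a \<times> real) (y :: real \<times> 'a \<times> real). fst (snd x) \<bullet> fst (snd y))"
  "bounded_bilinear (\<lambda>(x :: real \<times> 'a \<times> real) (y :: real \<times> 'a \<times> real). fst x * fst y)"
  "bounded_bilinear (\<lambda>(x :: real \<times> 'a \<times> real) (y :: real \<times> 'a \<times> real). fst x * snd (snd y))"
proof -
  have T: "bounded_linear (\<lambda>x :: real \<times> 'a \<times> real. fst (snd x))" "bounded_linear (\<lambda>x :: real \<times> 'a \<times> real. snd (snd x))"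
    using bounded_linear_compose[OF bounded_linear_fst bounded_linear_snd]
      bounded_linear_compose[OF bounded_linear_snd bounded_linear_snd] .
  show "bounded_bilinear (\<lambda>(x :: real \<times> 'a \<times> real) (y :: real \<times> 'a \<times> real). snd (snd x) * snd (snd y))"
    by (rule bounded_bilinear.comp[OF bounded_bilinear_mult T(2) T(2)])
  show "bounded_bilinear (\<lambda>(x :: real \<times> 'a \<times> real) (y :: real \<times> 'a \<times> real). fst (snd x) \<bullet> fst (snd y))"
    by (rule bounded_bilinear.comp[OF bounded_bilinear_inner T(1) T(1)])
  show "bounded_bilinear (\<lambda>(x :: real \<times> 'a \<times> real) (y :: real \<times> 'a \<times> real). fst x * fst y)"
    by (rule bounded_bilinear.comp[OF bounded_bilinear_mult bounded_linear_fst bounded_linear_fst])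
  show "bounded_bilinear (\<lambda>(x :: real \<times> 'a \<times> real) (y :: real \<times> 'a \<times> real). fst x * snd (snd y))"
    by (rule bounded_bilinear.comp[OF bounded_bilinear_mult bounded_linear_fst T(2)])
qed

lemma W20_L2f: "u \<in> W20 \<Longrightarrow> L2f M u"
  by (simp add: W20_def)

lemma jet_in_W20:
  assumes "test_fun \<Omega> f" shows "jet f \<in> W20"
proof -
  have "jet f \<in> borel_measurable borel" by (rule Cc_measurable[OF test_fun_jet_Cc[OF assms]])
  then have "jet f \<in> borel_measurable lebesgue" by (intro measurable_completion) simp
  moreover have "(\<lambda>n. l2sq M (jet f - jet f)) \<longlonglongrightarrow> 0" by (simp add: l2sq_def)
  ultimately show ?thesis
    unfolding W20_def using L2f_jet[OF assms] assms by (auto intro!: exI[of _ "\<lambda>_. f"])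
qed

lemma test_fun_zero: "test_fun \<Omega> (\<lambda>x. 0)"
proof -
  have "dpart bs (\<lambda>x::'a. 0) = (\<lambda>x. 0)" for bs by (induction bs) auto
  then show ?thesis unfolding test_fun_def by simp
qed

lemma l2sq_scale: "l2sq M (c *\<^sub>R u) = c\<^sup>2 * l2sq M u"
  unfolding l2sq_def by (simp add: power_mult_distrib)

lemma subspace_W20: "subspace W20"
  unfolding subspace_def
proof (intro conjI ballI allI)
  have "jet (\<lambda>x::'a. 0) = 0" using jet_cmult[OF test_fun_zero, of 0] by simp
  then show "0 \<in> W20" using jet_in_W20[OF test_fun_zero] by simp
next
  fix u w assume "u \<in> W20" "w \<in> W20"
  then obtain \<phi> \<psi> where *: "u \<in> borel_measurable lebesgue" "w \<in> borel_measurable lebesgue" "L2f M u" "L2f M w"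
    "\<And>n. test_fun \<Omega> (\<phi> n)" "(\<lambda>n. l2sq M (jet (\<phi> n) - u)) \<longlonglongrightarrow> 0"
    "\<And>n. test_fun \<Omega> (\<psi> n)" "(\<lambda>n. l2sq M (jet (\<psi> n) - w)) \<longlonglongrightarrow> 0"
    unfolding W20_def by blast
  have bound: "l2sq M (jet (\<lambda>x. \<phi> n x + \<psi> n x) - (u + w)) \<le> 2 * l2sq M (jet (\<phi> n) - u) + 2 * l2sq M (jet (\<psi> n) - w)" for n
  proof -
    have eq: "jet (\<lambda>x. \<phi> n x + \<psi> n x) - (u + w) = (jet (\<phi> n) - u) + (jet (\<psi> n) - w)"
      by (simp add: jet_add[OF *(5,7)] algebra_simps)
    show ?thesis unfolding eq
      by (rule l2sq_add_le[OF L2f_diff[OF L2f_jet[OF *(5)[of n]] *(3)] L2f_diff[OF L2f_jet[OF *(7)[of n]] *(4)]])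
  qed
  have lim: "(\<lambda>n. 2 * l2sq M (jet (\<phi> n) - u) + 2 * l2sq M (jet (\<psi> n) - w)) \<longlonglongrightarrow> 0"
    using tendsto_add[OF tendsto_mult_left[OF *(6), of 2] tendsto_mult_left[OF *(8), of 2]] by simp
  have "(\<lambda>n. l2sq M (jet (\<lambda>x. \<phi> n x + \<psi> n x) - (u + w))) \<longlonglongrightarrow> 0"
    by (rule tendsto_zero_dominated[OF l2sq_nonneg bound lim])
  moreover have "u + w \<in> borel_measurable lebesgue"
    unfolding plus_fun_def by (intro borel_measurable_add *)
  moreover have "\<forall>n. test_fun \<Omega> (\<lambda>x. \<phi> n x + \<psi> n x)" using * by (auto intro: test_fun_add)
  ultimately show "u + w \<in> W20" unfolding W20_def using L2f_add[OF *(3,4)]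
    by (auto intro!: exI[of _ "\<lambda>n x. \<phi> n x + \<psi> n x"])
next
  fix c u assume "u \<in> W20"
  then obtain \<phi> where *: "u \<in> borel_measurable lebesgue" "L2f M u"
    "\<And>n. test_fun \<Omega> (\<phi> n)" "(\<lambda>n. l2sq M (jet (\<phi> n) - u)) \<longlonglongrightarrow> 0"
    unfolding W20_def by blast
  have "jet (\<lambda>x. c * \<phi> n x) - c *\<^sub>R u = c *\<^sub>R (jet (\<phi> n) - u)" for n
    by (simp add: jet_cmult[OF *(3)] scaleR_diff_right)
  then have "(\<lambda>n. l2sq M (jet (\<lambda>x. c * \<phi> n x) - c *\<^sub>R u)) \<longlonglongrightarrow> 0"
    using tendsto_mult_left[OF *(4), of "c\<^sup>2"] by (simp add: l2sq_scale)
  moreover have "c *\<^sub>R u \<in> borel_measurable lebesgue"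
    unfolding scaleR_fun_def using * by measurable
  moreover have "\<forall>n. test_fun \<Omega> (\<lambda>x. c * \<phi> n x)" using * by (auto intro: test_fun_cmult)
  ultimately show "c *\<^sub>R u \<in> W20" unfolding W20_def using L2f_scale[OF *(2)]
    by (auto intro!: exI[of _ "\<lambda>n x. c * \<phi> n x"])
qed

lemma psd_forms: "psd_form W20 formA" "psd_form W20 formB" "psd_form W20 formC"
proof -
  show "psd_form W20 formA" unfolding formA_def[abs_def]
    by (rule psd_form_L2[OF bounded_bilinear_forms(1) _ _ subspace_W20 W20_L2f]) (simp_all add: mult.commute)
  show "psd_form W20 formB" unfolding formB_def[abs_def]
    by (rule psd_form_L2[OF bounded_bilinear_forms(2) _ _ subspace_W20 W20_L2f]) (simp_all add: inner_commute)
  show "psd_form W20 formC" unfolding formC_def[abs_def]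
    by (rule psd_form_L2[OF bounded_bilinear_forms(3) _ _ subspace_W20 W20_L2f]) (simp_all add: mult.commute)
qed

lemma l2sq_forms:
  assumes "L2f M u" shows "l2sq M u = formC u u + formB u u + formA u u"
proof -
  have eq: "(norm (u x))\<^sup>2 = fst (u x) * fst (u x) + fst (snd (u x)) \<bullet> fst (snd (u x)) + snd (snd (u x)) * snd (snd (u x))" for x
    unfolding power2_norm_eq_inner inner_prod_def inner_real_def by (simp only: add.assoc)
  note int = L2f_bilinear_integrable[OF bounded_bilinear_forms(1) assms assms]
    L2f_bilinear_integrable[OF bounded_bilinear_forms(2) assms assms]
    L2f_bilinear_integrable[OF bounded_bilinear_forms(3) assms assms]
  show ?thesis
    unfolding l2sq_def form_defs eq using int
    by (simp only: Bochner_Integration.integral_add Bochner_Integration.integrable_add)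
qed

lemma W20_approx:
  assumes "u \<in> W20"
  obtains \<phi> where "\<And>n. test_fun \<Omega> (\<phi> n)" "\<And>n. L2f M (jet (\<phi> n))" "(\<lambda>n. l2sq M (jet (\<phi> n) - u)) \<longlonglongrightarrow> 0"
  using assms L2f_jet unfolding W20_def by blast

lemma form_tendsto:
  assumes "\<And>n. L2f M (U n)" "L2f M u" "(\<lambda>n. l2sq M (U n - u)) \<longlonglongrightarrow> 0"
    and "\<And>n. L2f M (V n)" "L2f M v" "(\<lambda>n. l2sq M (V n - v)) \<longlonglongrightarrow> 0"
  shows "(\<lambda>n. formA (U n) (V n)) \<longlonglongrightarrow> formA u v" "(\<lambda>n. formB (U n) (V n)) \<longlonglongrightarrow> formB u v"
    "(\<lambda>n. formC (U n) (V n)) \<longlonglongrightarrow> formC u v" "(\<lambda>n. formE (U n) (V n)) \<longlonglongrightarrow> formE u v"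
  unfolding form_defs
  by (rule L2f_tendsto_bilinear[OF bounded_bilinear_forms(1) assms],
      rule L2f_tendsto_bilinear[OF bounded_bilinear_forms(2) assms],
      rule L2f_tendsto_bilinear[OF bounded_bilinear_forms(3) assms],
      rule L2f_tendsto_bilinear[OF bounded_bilinear_forms(4) assms])

lemma jet_forms:
  assumes "test_fun \<Omega> f" "test_fun \<Omega> g"
  shows "formA (jet f) (jet g) = (\<integral>x. lap f x * lap g x \<partial>lborel)"
    "formB (jet f) (jet g) = (\<integral>x. grad f x \<bullet> grad g x \<partial>lborel)"
    "formC (jet f) (jet g) = (\<integral>x. f x * g x \<partial>lborel)"
    "formE (jet f) (jet g) = (\<integral>x. f x * lap g x \<partial>lborel)"
proof -
  have j0: "f x = 0 \<and> grad f x = 0 \<and> lap f x = 0" if "x \<notin> \<Omega>" for x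
    using arg_cong[OF jet_outside[OF assms(1) that], of fst] arg_cong[OF jet_outside[OF assms(1) that], of "\<lambda>p. fst (snd p)"]
      arg_cong[OF jet_outside[OF assms(1) that], of "\<lambda>p. snd (snd p)"] by (simp add: jet_def)
  have [measurable]: "f \<in> borel_measurable borel" "grad f \<in> borel_measurable borel" "lap f \<in> borel_measurable borel"
    "g \<in> borel_measurable borel" "grad g \<in> borel_measurable borel" "lap g \<in> borel_measurable borel"
    using test_fun_Cc[OF assms(1)] test_fun_grad_Cc[OF assms(1)] test_fun_lap_Cc[OF assms(1)]
      test_fun_Cc[OF assms(2)] test_fun_grad_Cc[OF assms(2)] test_fun_lap_Cc[OF assms(2)]
    by (simp_all add: Cc_measurable)
  show "formA (jet f) (jet g) = (\<integral>x. lap f x * lap g x \<partial>lborel)"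
    unfolding formA_def jet_def fst_conv snd_conv by (rule integral_M) (measurable, simp add: j0)
  show "formB (jet f) (jet g) = (\<integral>x. grad f x \<bullet> grad g x \<partial>lborel)"
    unfolding formB_def jet_def fst_conv snd_conv by (rule integral_M) (measurable, simp add: j0)
  show "formC (jet f) (jet g) = (\<integral>x. f x * g x \<partial>lborel)"
    unfolding formC_def jet_def fst_conv snd_conv by (rule integral_M) (measurable, simp add: j0)
  show "formE (jet f) (jet g) = (\<integral>x. f x * lap g x \<partial>lborel)"
    unfolding formE_def jet_def fst_conv snd_conv by (rule integral_M) (measurable, simp add: j0)
qed

text \<open>Both sides are continuous under L2 convergence of jets, so the identity passes from test
  functions to the closure in both arguments.\<close>

lemma Green_W20:
  assumes "u \<in> W20" "w \<in> W20" shows "formB u w = - formE u w"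
proof -
  obtain \<phi> where \<phi>: "\<And>n. test_fun \<Omega> (\<phi> n)" "\<And>n. L2f M (jet (\<phi> n))" "(\<lambda>n. l2sq M (jet (\<phi> n) - u)) \<longlonglongrightarrow> 0"
    using W20_approx[OF assms(1)] by blast
  obtain \<psi> where \<psi>: "\<And>n. test_fun \<Omega> (\<psi> n)" "\<And>n. L2f M (jet (\<psi> n))" "(\<lambda>n. l2sq M (jet (\<psi> n) - w)) \<longlonglongrightarrow> 0"
    using W20_approx[OF assms(2)] by blast
  note t = form_tendsto[OF \<phi>(2) W20_L2f[OF assms(1)] \<phi>(3) \<psi>(2) W20_L2f[OF assms(2)] \<psi>(3)]
  have "formB (jet (\<phi> n)) (jet (\<psi> n)) = - formE (jet (\<phi> n)) (jet (\<psi> n))" for n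
    unfolding jet_forms[OF \<phi>(1) \<psi>(1)] by (rule Green_identity[OF \<phi>(1) \<psi>(1)])
  then have "(\<lambda>n. formB (jet (\<phi> n)) (jet (\<psi> n))) \<longlonglongrightarrow> - formE u w"
    using tendsto_minus[OF t(4)] by simp
  then show ?thesis using LIMSEQ_unique[OF t(2)] by blast
qed

text \<open>Interpolation: Green's identity turns the gradient energy into a pairing of u with its
  Laplacian, to which Cauchy-Schwarz applies.\<close>

lemma formB_square_le:
  assumes "u \<in> W20" shows "(formB u u)\<^sup>2 \<le> formC u u * formA u u"
proof -
  have psd: "psd_form {u. L2f M u} (\<lambda>u w. \<integral>x. u x * (w x :: real) \<partial>M)"
    by (intro psd_form_L2 bounded_bilinear_mult subspace_L2f) auto
  have "L2f M (\<lambda>x. fst (u x))" "L2f M (\<lambda>x. snd (snd (u x)))"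
    by (rule L2f_linear_image[OF bounded_linear_fst W20_L2f[OF assms]],
        rule L2f_linear_image[OF bounded_linear_compose[OF bounded_linear_snd bounded_linear_snd] W20_L2f[OF assms]])
  then have "(formE u u)\<^sup>2 \<le> formC u u * formA u u"
    using psd_form_Cauchy_Schwarz[OF psd, of "\<lambda>x. fst (u x)" "\<lambda>x. snd (snd (u x))"] unfolding form_defs by simp
  then show ?thesis using Green_W20[OF assms assms] by simp
qed

section \<open>Poincare inequalities, compactness and completeness\<close>

definition cell_functional :: "real \<Rightarrow> 'a \<Rightarrow> ('a \<Rightarrow> real \<times> 'a \<times> real) \<Rightarrow> real" where
  "cell_functional h q u = (\<integral>x. fst (u x) * indicator (cell h q) x \<partial>M)"

lemma L2f_indicator:
  assumes "Q \<in> sets borel" shows "L2f M (indicator Q :: 'a \<Rightarrow> real)"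
proof (rule L2f_dominated)
  show "indicator Q \<in> borel_measurable M" using assms by (intro borel_measurable_M) simp
  show "integrable M (indicator \<Omega> :: 'a \<Rightarrow> real)"
    using \<Omega>_borel emeasure_lborel_\<Omega> by (intro integrable_M integrable_real_indicator) auto
qed (simp add: indicator_def space_restrict_space)

lemma bounded_bilinear_fst_mult: "bounded_bilinear (\<lambda>(x :: real \<times> 'a \<times> real) (y :: real). fst x * y)"
  by (rule bounded_bilinear.comp1[OF bounded_bilinear_mult bounded_linear_fst])

definition gap_const :: real where
  "gap_const = 2 * 2 ^ DIM('a) * (real DIM('a))\<^sup>2"

lemma gap_const_pos: "0 < gap_const"
  unfolding gap_const_def by simp

text \<open>A limit of the bound for test functions; the cell averages are continuous because
  indicators are square integrable over the finite volume of \<Omega>.\<close>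

lemma W20_finite_rank_bound:
  assumes h: "0 < h" and u: "u \<in> W20"
  shows "formC u u \<le> (\<Sum>q\<in>heavy_cells h \<Omega>. 2 / h ^ DIM('a) * (cell_functional h q u)\<^sup>2) + gap_const * h\<^sup>2 * formB u u"
proof -
  obtain \<phi> where \<phi>: "\<And>n. test_fun \<Omega> (\<phi> n)" "\<And>n. L2f M (jet (\<phi> n))" "(\<lambda>n. l2sq M (jet (\<phi> n) - u)) \<longlonglongrightarrow> 0"
    using W20_approx[OF u] by blast
  note t = form_tendsto[OF \<phi>(2) W20_L2f[OF u] \<phi>(3) \<phi>(2) W20_L2f[OF u] \<phi>(3)]
  have l: "(\<lambda>n. cell_functional h q (jet (\<phi> n))) \<longlonglongrightarrow> cell_functional h q u" for q
  proof -
    have ind: "L2f M (indicator (cell h q) :: 'a \<Rightarrow> real)" by (rule L2f_indicator[OF cell_borel])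
    have "(\<lambda>n::nat. l2sq M (indicator (cell h q) - indicator (cell h q) :: 'a \<Rightarrow> real)) \<longlonglongrightarrow> 0"
      by (simp add: l2sq_def)
    from L2f_tendsto_bilinear[OF bounded_bilinear_fst_mult \<phi>(2) W20_L2f[OF u] \<phi>(3) ind ind this]
    show ?thesis unfolding cell_functional_def .
  qed
  have ineq: "formC (jet (\<phi> n)) (jet (\<phi> n)) \<le> (\<Sum>q\<in>heavy_cells h \<Omega>. 2 / h ^ DIM('a) * (cell_functional h q (jet (\<phi> n)))\<^sup>2)
      + gap_const * h\<^sup>2 * formB (jet (\<phi> n)) (jet (\<phi> n))" for n
  proof -
    have [measurable]: "\<phi> n \<in> borel_measurable borel" by (rule Cc_measurable[OF test_fun_Cc[OF \<phi>(1)]])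
    have f0: "\<phi> n x = 0" if "x \<notin> \<Omega>" for x
      using test_fun_dpart_outside[OF \<phi>(1)[of n] that, of "[]"] by simp
    have "cell_functional h q (jet (\<phi> n)) = (\<integral>y. \<phi> n y * indicator (cell h q) y \<partial>lborel)" for q
    proof -
      have "(\<lambda>y. \<phi> n y * indicator (cell h q) y) \<in> borel_measurable borel" by measurable
      from integral_M[OF this] show ?thesis unfolding cell_functional_def jet_def fst_conv using f0 by simp
    qed
    then have cf: "cell_functional h q (jet (\<phi> n)) = (\<integral>y. indicator (cell h q) y * \<phi> n y \<partial>lborel)" for q
      by (simp add: mult.commute)
    have "formC (jet (\<phi> n)) (jet (\<phi> n)) = l2sq lborel (\<phi> n)" "formB (jet (\<phi> n)) (jet (\<phi> n)) = l2sq lborel (grad (\<phi> n))"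
      unfolding jet_forms[OF \<phi>(1) \<phi>(1)] l2sq_def power2_norm_eq_inner by simp_all
    then show ?thesis
      unfolding cf gap_const_def using test_fun_finite_rank_bound[OF h \<phi>(1) \<Omega>_borel emeasure_lborel_\<Omega>, of n] by simp
  qed
  show ?thesis
  proof (rule LIMSEQ_le[OF t(3)])
    show "(\<lambda>n. (\<Sum>q\<in>heavy_cells h \<Omega>. 2 / h ^ DIM('a) * (cell_functional h q (jet (\<phi> n)))\<^sup>2) + gap_const * h\<^sup>2 * formB (jet (\<phi> n)) (jet (\<phi> n)))
      \<longlonglongrightarrow> (\<Sum>q\<in>heavy_cells h \<Omega>. 2 / h ^ DIM('a) * (cell_functional h q u)\<^sup>2) + gap_const * h\<^sup>2 * formB u u"
      by (intro tendsto_add tendsto_sum tendsto_mult_left tendsto_power l t)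
  qed (use ineq in auto)
qed

text \<open>For cells so large that h^d/2 > |\<Omega>| none is heavy, and the finite rank bound has
  no functionals left. The summand 1 in h gives h \<ge> 1, hence h^d \<ge> h.\<close>

lemma Poincare: "\<exists>K>0. \<forall>u\<in>W20. formC u u \<le> K * formB u u"
proof -
  define h where "h = 1 + 2 * measure lborel \<Omega>"
  have h: "1 \<le> h" unfolding h_def by simp
  have "h ^ DIM('a) \<ge> h ^ 1" using h by (intro power_increasing) auto
  then have hd: "h ^ DIM('a) / 2 > measure lborel \<Omega>" unfolding h_def by simp
  have "heavy_cells h \<Omega> = {}"
  proof -
    have "measure lborel (\<Omega> \<inter> cell h q) \<le> measure lborel \<Omega>" for q
      using \<Omega>_borel emeasure_lborel_\<Omega> by (intro measure_mono_fmeasurable) (auto simp: fmeasurable_def)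
    then have "\<not> h ^ DIM('a) / 2 \<le> measure lborel (\<Omega> \<inter> cell h q)" for q
      using hd by (meson le_less_trans not_le)
    then show ?thesis unfolding heavy_cells_def by blast
  qed
  then have "formC u u \<le> (gap_const * h\<^sup>2) * formB u u" if "u \<in> W20" for u
    using W20_finite_rank_bound[OF _ that, of h] h by simp
  then show ?thesis using gap_const_pos h by (intro exI[of _ "gap_const * h\<^sup>2"]) auto
qed

text \<open>From B^2 \<le> C A and C \<le> K B follows B \<le> K A, and then C \<le> K^2 A; the
  constant K + K^2 serves both.\<close>

lemma Poincare_A: "\<exists>K>0. \<forall>u\<in>W20. formC u u \<le> K * formA u u \<and> formB u u \<le> K * formA u u"
proof -
  obtain K where K: "K > 0" "\<And>u. u \<in> W20 \<Longrightarrow> formC u u \<le> K * formB u u" using Poincare by blast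
  have B: "formB u u \<le> K * formA u u" if u: "u \<in> W20" for u
  proof (cases "formB u u = 0")
    case True
    then show ?thesis using K psd_form_nonneg[OF psd_forms(1) u] by simp
  next
    case False
    then have pos: "0 < formB u u" using psd_form_nonneg[OF psd_forms(2) u] by simp
    have "formB u u * formB u u \<le> formC u u * formA u u"
      using formB_square_le[OF u] by (simp add: power2_eq_square)
    also have "\<dots> \<le> K * formB u u * formA u u"
      using K(2)[OF u] psd_form_nonneg[OF psd_forms(1) u] by (intro mult_right_mono)
    finally have "formB u u * formB u u \<le> formB u u * (K * formA u u)" by (simp add: mult_ac)
    then show ?thesis using pos by simp
  qed
  have C: "formC u u \<le> K\<^sup>2 * formA u u" if u: "u \<in> W20" for u
  proof -
    have "formC u u \<le> K * formB u u" by (rule K(2)[OF u])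
    also have "\<dots> \<le> K * (K * formA u u)" using K(1) B[OF u] by simp
    finally show ?thesis by (simp add: power2_eq_square mult_ac)
  qed
  show ?thesis
  proof (intro exI[of _ "K + K\<^sup>2"] conjI ballI)
    show "0 < K + K\<^sup>2" using K(1) by (simp add: add_pos_pos)
    fix u assume u: "u \<in> W20"
    have "0 \<le> K * formA u u" "0 \<le> K\<^sup>2 * formA u u" using K(1) psd_form_nonneg[OF psd_forms(1) u] by auto
    then show "formC u u \<le> (K + K\<^sup>2) * formA u u" "formB u u \<le> (K + K\<^sup>2) * formA u u"
      using B[OF u] C[OF u] by (auto simp: distrib_right)
  qed
qed

text \<open>Interpolation gives B \<le> C/(2\<epsilon>) + (\<epsilon>/2) A, and C is bounded by cell
  functionals plus a multiple of h^2 A. The fineness of the grid is adjusted so that this second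
  remainder is again (\<epsilon>/2) A.\<close>

lemma W20_finite_rank:
  assumes \<epsilon>: "0 < \<epsilon>"
  shows "\<exists>n l K.
        (\<forall>i<n. \<forall>u\<in>W20. \<forall>w\<in>W20. l i (u + w) = l i u + l i w) \<and>
        (\<forall>i<n. \<forall>c. \<forall>u\<in>W20. l i (c *\<^sub>R u) = c * l i u) \<and>
        (\<forall>i<n. \<forall>u\<in>W20. (l i u)\<^sup>2 \<le> K * formA u u) \<and>
        (\<forall>u\<in>W20. formB u u \<le> (\<Sum>i<(n::nat). (l i u)\<^sup>2) + \<epsilon> * formA u u)"
proof -
  obtain K where K: "K > 0" "\<And>u. u \<in> W20 \<Longrightarrow> formC u u \<le> K * formA u u" "\<And>u. u \<in> W20 \<Longrightarrow> formB u u \<le> K * formA u u"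
    using Poincare_A by blast
  \<comment> \<open>Chosen so that \<open>gap_const * h\<^sup>2 * K\<close> equals \<epsilon>^2,
    which becomes \<epsilon>/2 after division by 2\<epsilon>.\<close>
  define h where "h = \<epsilon> / sqrt (gap_const * K)"
  have gK: "0 < gap_const * K" using gap_const_pos K(1) by simp
  have h: "0 < h" unfolding h_def using \<epsilon> gK by simp
  have h2: "gap_const * h\<^sup>2 * K = \<epsilon>\<^sup>2" 
  proof -
    have "h\<^sup>2 = \<epsilon>\<^sup>2 / (gap_const * K)" unfolding h_def using gK by (simp add: power_divide)
    then show ?thesis using gap_const_pos K(1) by simp
  qed
  define v where "v = h ^ DIM('a)"
  have v: "0 < v" unfolding v_def using h by simp
  have fin: "finite (heavy_cells h \<Omega>)"
    unfolding heavy_cells_def using v[unfolded v_def] by (intro finite_heavy_cells \<Omega>_borel emeasure_lborel_\<Omega>) simp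
  obtain e where e: "bij_betw e {..<card (heavy_cells h \<Omega>)} (heavy_cells h \<Omega>)"
    using ex_bij_betw_nat_finite[OF fin] by (auto simp: atLeast0LessThan)
  \<comment> \<open>Its square 1/(\<epsilon> v) is the factor 2/v of the grid estimate divided by
    2\<epsilon>.\<close>
  define c where "c = sqrt (1 / (\<epsilon> * v))"
  have c2: "c\<^sup>2 = 1 / (\<epsilon> * v)" unfolding c_def using \<epsilon> v by simp
  define l where "l = (\<lambda>i u. c * cell_functional h (e i) u)"
  have int: "integrable M (\<lambda>x. fst (u x) * indicator (cell h q) x)" if "u \<in> W20" for u q
    by (rule L2f_bilinear_integrable[OF bounded_bilinear_fst_mult W20_L2f[OF that] L2f_indicator]) simp
  have l_add: "l i (u + w) = l i u + l i w" if "u \<in> W20" "w \<in> W20" for i u w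
    unfolding l_def cell_functional_def using int[OF that(1)] int[OF that(2)] by (simp add: distrib_right distrib_left)
  have l_scale: "l i (d *\<^sub>R u) = d * l i u" for i d u
    unfolding l_def cell_functional_def by (simp add: mult.assoc)
  have l_bd: "(l i u)\<^sup>2 \<le> (c\<^sup>2 * l2sq M (indicator \<Omega> :: 'a \<Rightarrow> real) * K) * formA u u" if u: "u \<in> W20" for i u
  proof -
    have psd: "psd_form {u. L2f M u} (\<lambda>u w. \<integral>x. u x * (w x :: real) \<partial>M)"
      by (intro psd_form_L2 bounded_bilinear_mult subspace_L2f) auto
    have "L2f M (\<lambda>x. fst (u x))"
      using W20_L2f[OF u] by (rule L2f_linear_image[OF bounded_linear_fst])
    moreover have ind: "L2f M (indicator (cell h (e i)) :: 'a \<Rightarrow> real)" "L2f M (indicator \<Omega> :: 'a \<Rightarrow> real)"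
      using \<Omega>_borel by (auto intro: L2f_indicator)
    ultimately have "(cell_functional h (e i) u)\<^sup>2 \<le> formC u u * l2sq M (indicator (cell h (e i)) :: 'a \<Rightarrow> real)"
      using psd_form_Cauchy_Schwarz[OF psd, of "\<lambda>x. fst (u x)" "indicator (cell h (e i))"]
      unfolding form_defs cell_functional_def l2sq_def by (simp add: power2_eq_square)
    also have "\<dots> \<le> (K * formA u u) * l2sq M (indicator \<Omega> :: 'a \<Rightarrow> real)"
    proof (rule mult_mono)
      show "l2sq M (indicator (cell h (e i)) :: 'a \<Rightarrow> real) \<le> l2sq M (indicator \<Omega> :: 'a \<Rightarrow> real)"
        unfolding l2sq_def using ind by (intro integral_mono) (auto simp: L2f_def indicator_def)
    qed (use K psd_form_nonneg[OF psd_forms(1) u] u in auto)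
    finally have "c\<^sup>2 * (cell_functional h (e i) u)\<^sup>2 \<le> c\<^sup>2 * ((K * formA u u) * l2sq M (indicator \<Omega> :: 'a \<Rightarrow> real))"
      by (intro mult_left_mono) auto
    then show ?thesis unfolding l_def by (simp add: power_mult_distrib mult_ac)
  qed
  have main: "formB u u \<le> (\<Sum>i<card (heavy_cells h \<Omega>). (l i u)\<^sup>2) + \<epsilon> * formA u u" if u: "u \<in> W20" for u
  proof -
    let ?S = "\<Sum>q\<in>heavy_cells h \<Omega>. (cell_functional h q u)\<^sup>2"
    have nn: "0 \<le> formA u u" "0 \<le> formB u u" "0 \<le> formC u u" using psd_form_nonneg psd_forms u by blast+
    have "formB u u \<le> formC u u / (2 * \<epsilon>) + \<epsilon> / 2 * formA u u"
    proof (rule power2_le_imp_le)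
      have "(formB u u)\<^sup>2 \<le> formC u u * formA u u" by (rule formB_square_le[OF u])
      also have "\<dots> = 4 * (formC u u / (2 * \<epsilon>)) * (\<epsilon> / 2 * formA u u)" using \<epsilon> by simp
      also have "\<dots> \<le> (formC u u / (2 * \<epsilon>) + \<epsilon> / 2 * formA u u)\<^sup>2"
      proof -
        have "4 * a * b \<le> (a + b)\<^sup>2" for a b :: real
          using sum_squares_bound[of a b] by (simp add: power2_sum)
        then show ?thesis .
      qed
      finally show "(formB u u)\<^sup>2 \<le> (formC u u / (2 * \<epsilon>) + \<epsilon> / 2 * formA u u)\<^sup>2" .
    qed (use nn \<epsilon> in simp)
    also have "formC u u / (2 * \<epsilon>) \<le> (2 / v * ?S + gap_const * h\<^sup>2 * (K * formA u u)) / (2 * \<epsilon>)"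
    proof (rule divide_right_mono)
      have "gap_const * h\<^sup>2 * formB u u \<le> gap_const * h\<^sup>2 * (K * formA u u)"
        using K(3)[OF u] gap_const_pos by (intro mult_left_mono) auto
      then show "formC u u \<le> 2 / v * ?S + gap_const * h\<^sup>2 * (K * formA u u)"
        using W20_finite_rank_bound[OF h u] unfolding v_def by (simp add: sum_distrib_left)
    qed (use \<epsilon> in simp)
    also have "gap_const * h\<^sup>2 * (K * formA u u) = \<epsilon>\<^sup>2 * formA u u"
      using h2 by (metis mult.assoc)
    also have "(2 / v * ?S + \<epsilon>\<^sup>2 * formA u u) / (2 * \<epsilon>) + \<epsilon> / 2 * formA u u = c\<^sup>2 * ?S + \<epsilon> * formA u u"
      unfolding c2 using \<epsilon> v by (simp add: field_simps power2_eq_square)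
    also have "c\<^sup>2 * ?S = (\<Sum>i<card (heavy_cells h \<Omega>). (l i u)\<^sup>2)"
      unfolding l_def power_mult_distrib sum_distrib_left
      by (rule sum.reindex_bij_betw[OF e, symmetric])
    finally show ?thesis by simp
  qed
  show ?thesis using l_add l_scale l_bd main by blast
qed

text \<open>By the Poincare inequalities \<open>formA\<close> dominates the squared L2 norm of the
  whole triple, so an \<open>A\<close>-Cauchy sequence converges in L2; a diagonal choice of test
  functions keeps the limit in the closure.\<close>

lemma W20_complete:
  assumes X: "\<And>n. X n \<in> W20"
    and Cauchy: "\<And>e. 0 < e \<Longrightarrow> \<exists>N. \<forall>m\<ge>N. \<forall>n\<ge>N. formA (X m - X n) (X m - X n) < e"
  shows "\<exists>u\<in>W20. (\<lambda>n. formA (X n - u) (X n - u)) \<longlonglongrightarrow> 0"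
proof -
  obtain K where K: "K > 0" "\<And>u. u \<in> W20 \<Longrightarrow> formC u u \<le> K * formA u u" "\<And>u. u \<in> W20 \<Longrightarrow> formB u u \<le> K * formA u u"
    using Poincare_A by blast
  have le: "l2sq M u \<le> (2 * K + 1) * formA u u" if "u \<in> W20" for u
    using K(2,3)[OF that] l2sq_forms[OF W20_L2f[OF that]] by (simp add: algebra_simps)
  have XL: "L2f M (X n)" for n using X W20_L2f by blast
  have "\<exists>N. \<forall>m\<ge>N. \<forall>n\<ge>N. l2sq M (X m - X n) < e" if e: "0 < e" for e
  proof -
    have "0 < e / (2 * K + 1)" using e K(1) by simp
    then obtain N where N: "\<forall>m\<ge>N. \<forall>n\<ge>N. formA (X m - X n) (X m - X n) < e / (2 * K + 1)" using Cauchy by blast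
    have "l2sq M (X m - X n) < e" if "m \<ge> N" "n \<ge> N" for m n
    proof -
      have "l2sq M (X m - X n) \<le> (2 * K + 1) * formA (X m - X n) (X m - X n)"
        by (intro le subspace_diff[OF subspace_W20] X)
      also have "\<dots> < (2 * K + 1) * (e / (2 * K + 1))" using N that K(1) by (intro mult_strict_left_mono) auto
      also have "\<dots> = e" using K(1) by simp
      finally show ?thesis .
    qed
    then show ?thesis by blast
  qed
  then obtain u0 where u0: "L2f M u0" "(\<lambda>n. l2sq M (X n - u0)) \<longlonglongrightarrow> 0" using L2f_complete[of M X, OF XL] by blast
  \<comment> \<open>The L2 limit is known only on \<Omega>; extension by zero gives the
    measurability on the whole space that \<open>W20\<close> demands.\<close>
  define u where "u = (\<lambda>x. indicator \<Omega> x *\<^sub>R u0 x)"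
  have eq: "x \<in> space M \<Longrightarrow> u x = u0 x" for x unfolding u_def by (simp add: space_restrict_space)
  have lim: "(\<lambda>n. l2sq M (X n - u)) \<longlonglongrightarrow> 0"
  proof -
    have "l2sq M (X n - u) = l2sq M (X n - u0)" for n
      unfolding l2sq_def using eq by (intro Bochner_Integration.integral_cong) auto
    then show ?thesis using u0(2) by simp
  qed
  have um: "u \<in> borel_measurable lebesgue"
    using L2f_measurable[OF u0(1)] borel_measurable_restrict_space_iff[OF \<Omega>_lebesgue(2), of u0] unfolding u_def by simp
  have uL: "L2f M u"
    unfolding L2f_def
  proof
    show "u \<in> borel_measurable M" by (rule measurable_restrict_space1[OF um])
    show "integrable M (\<lambda>x. (norm (u x))\<^sup>2)"
      using L2f_integrable[OF u0(1)] eq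
        Bochner_Integration.integrable_cong[of M M "\<lambda>x. (norm (u x))\<^sup>2" "\<lambda>x. (norm (u0 x))\<^sup>2"] by simp
  qed
  \<comment> \<open>Diagonal choice: one test function within 1/(n+1) of the n-th member.\<close>
  have "\<exists>f. test_fun \<Omega> f \<and> l2sq M (jet f - X n) < 1 / real (Suc n)" for n
  proof -
    obtain \<phi> where \<phi>: "\<And>k. test_fun \<Omega> (\<phi> k)" "(\<lambda>k. l2sq M (jet (\<phi> k) - X n)) \<longlonglongrightarrow> 0"
      using W20_approx[OF X] by blast
    have "\<forall>\<^sub>F k in sequentially. l2sq M (jet (\<phi> k) - X n) < 1 / real (Suc n)"
      using order_tendstoD(2)[OF \<phi>(2)] by simp
    then obtain k where "l2sq M (jet (\<phi> k) - X n) < 1 / real (Suc n)"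
      unfolding eventually_sequentially by blast
    then show ?thesis using \<phi>(1) by blast
  qed
  then obtain \<psi> where \<psi>: "\<And>n. test_fun \<Omega> (\<psi> n)" "\<And>n. l2sq M (jet (\<psi> n) - X n) < 1 / real (Suc n)" by metis
  have bound: "l2sq M (jet (\<psi> n) - u) \<le> 2 * (1 / real (Suc n)) + 2 * l2sq M (X n - u)" for n
  proof -
    have eq: "jet (\<psi> n) - u = (jet (\<psi> n) - X n) + (X n - u)" by simp
    have "l2sq M (jet (\<psi> n) - u) \<le> 2 * l2sq M (jet (\<psi> n) - X n) + 2 * l2sq M (X n - u)"
      unfolding eq by (rule l2sq_add_le[OF L2f_diff[OF L2f_jet[OF \<psi>(1)] XL] L2f_diff[OF XL uL]])
    then show ?thesis using \<psi>(2)[of n] by linarith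
  qed
  have lim': "(\<lambda>n. 2 * (1 / real (Suc n)) + 2 * l2sq M (X n - u)) \<longlonglongrightarrow> 0"
    using tendsto_add[OF tendsto_mult_left[OF LIMSEQ_inverse_real_of_nat, of 2] tendsto_mult_left[OF lim, of 2]]
    by (simp add: inverse_eq_divide)
  have "(\<lambda>n. l2sq M (jet (\<psi> n) - u)) \<longlonglongrightarrow> 0"
    by (rule tendsto_zero_dominated[OF l2sq_nonneg bound lim'])
  then have uW: "u \<in> W20" unfolding W20_def using um uL \<psi>(1) by blast
  have XuW: "X n - u \<in> W20" for n by (intro subspace_diff[OF subspace_W20] X uW)
  have le_l2: "formA (X n - u) (X n - u) \<le> l2sq M (X n - u)" for n
    using l2sq_forms[OF W20_L2f[OF XuW]] psd_form_nonneg[OF psd_forms(2) XuW] psd_form_nonneg[OF psd_forms(3) XuW]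
    by simp
  have "(\<lambda>n. formA (X n - u) (X n - u)) \<longlonglongrightarrow> 0"
    by (rule tendsto_zero_dominated[OF psd_form_nonneg[OF psd_forms(1) XuW] le_l2 lim])
  then show ?thesis using uW by blast
qed

sublocale pair: compact_form_pair W20 formA formB
  by (unfold_locales; rule psd_forms(1) psd_forms(2) W20_finite_rank W20_complete; assumption?)

end

section \<open>Buckling eigenvalues\<close>

context finite_volume_domain
begin

lemma l2dist_M: "l2dist \<Omega> f g = (\<integral>\<^sup>+x. ennreal ((norm (f x - g x))\<^sup>2) \<partial>M)"
  unfolding l2dist_def by (rule nn_integral_restrict_space[OF \<Omega>_lebesgue(2), symmetric])

lemma nn_integral_jet_diff:
  assumes f: "test_fun \<Omega> f"
    and m: "v \<in> borel_measurable M" "g \<in> borel_measurable M" "L \<in> borel_measurable M"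
  shows "(\<integral>\<^sup>+x. ennreal ((norm ((jet f - (\<lambda>x. (v x, g x, L x))) x))\<^sup>2) \<partial>M)
    = l2dist \<Omega> f v + (l2dist \<Omega> (grad f) g + l2dist \<Omega> (lap f) L)"
proof -
  have fm: "f \<in> borel_measurable M" "grad f \<in> borel_measurable M" "lap f \<in> borel_measurable M"
    using L2f_measurable[OF L2f_Cc] test_fun_Cc[OF f] test_fun_grad_Cc[OF f] test_fun_lap_Cc[OF f] by auto
  have meas: "(\<lambda>x. ennreal ((norm (f x - v x))\<^sup>2)) \<in> borel_measurable M"
    "(\<lambda>x. ennreal ((norm (grad f x - g x))\<^sup>2)) \<in> borel_measurable M"
    "(\<lambda>x. ennreal ((norm (lap f x - L x))\<^sup>2)) \<in> borel_measurable M"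
    using fm m by measurable
  have eq: "ennreal ((norm ((jet f - (\<lambda>x. (v x, g x, L x))) x))\<^sup>2)
      = ennreal ((norm (f x - v x))\<^sup>2) + (ennreal ((norm (grad f x - g x))\<^sup>2) + ennreal ((norm (lap f x - L x))\<^sup>2))" for x
  proof -
    have "(norm ((jet f - (\<lambda>x. (v x, g x, L x))) x))\<^sup>2
        = (norm (f x - v x))\<^sup>2 + ((norm (grad f x - g x))\<^sup>2 + (norm (lap f x - L x))\<^sup>2)"
      unfolding minus_apply jet_def by (simp add: norm_Pair)
    then show ?thesis by (simp add: ennreal_plus[symmetric] del: ennreal_plus)
  qed
  show ?thesis
    unfolding eq l2dist_M using meas
    by (subst nn_integral_add, simp, simp, subst nn_integral_add, simp_all)
qed

text \<open>The squared distance between jets is the sum of the three \<open>l2dist\<close> terms.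
  \<open>H20\<close> demands no square integrability of v, g and L, so the forward direction has to
  derive it.\<close>

lemma H20_iff: "H20 \<Omega> v g L \<longleftrightarrow> (\<lambda>x. (v x, g x, L x)) \<in> W20"
proof
  let ?u = "\<lambda>x. (v x, g x, L x)"
  assume "H20 \<Omega> v g L"
  then obtain \<phi> where m: "v \<in> borel_measurable lebesgue" "g \<in> borel_measurable lebesgue" "L \<in> borel_measurable lebesgue"
    and \<phi>: "\<And>n. test_fun \<Omega> (\<phi> n)" "(\<lambda>n. l2dist \<Omega> (\<phi> n) v) \<longlonglongrightarrow> 0"
      "(\<lambda>n. l2dist \<Omega> (grad (\<phi> n)) g) \<longlonglongrightarrow> 0" "(\<lambda>n. l2dist \<Omega> (lap (\<phi> n)) L) \<longlonglongrightarrow> 0"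
    unfolding H20_def by blast
  note mM = m[THEN measurable_restrict_space1, of \<Omega>]
  define T where "T = (\<lambda>n. \<integral>\<^sup>+x. ennreal ((norm ((jet (\<phi> n) - ?u) x))\<^sup>2) \<partial>M)"
  have T: "T \<longlonglongrightarrow> 0"
    unfolding T_def nn_integral_jet_diff[OF \<phi>(1) mM]
    using tendsto_add[OF \<phi>(2) tendsto_add[OF \<phi>(3,4)]] by simp
  have um: "?u \<in> borel_measurable lebesgue" by (intro borel_measurable_Pair m)
  have umM: "?u \<in> borel_measurable M" by (intro borel_measurable_Pair mM)
  \<comment> \<open>One test function at finite distance suffices: the triple is then a difference
    of two square integrable functions.\<close>
  have "\<forall>\<^sub>F n in sequentially. T n < 1" using T by (intro order_tendstoD(2)) auto
  then obtain n where n: "T n < 1" unfolding eventually_sequentially by blast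
  have dm: "(jet (\<phi> n) - ?u) \<in> borel_measurable M"
    using borel_measurable_diff[OF L2f_measurable[OF L2f_jet[OF \<phi>(1)]] umM] unfolding fun_diff_def .
  have "integrable M (\<lambda>x. (norm ((jet (\<phi> n) - ?u) x))\<^sup>2)"
  proof (rule integrableI_bounded)
    show "(\<lambda>x. (norm ((jet (\<phi> n) - ?u) x))\<^sup>2) \<in> borel_measurable M"
      using measurable_compose[OF dm borel_measurable_norm] by measurable
    have "(\<integral>\<^sup>+x. ennreal (norm ((norm ((jet (\<phi> n) - ?u) x))\<^sup>2)) \<partial>M) = T n" unfolding T_def by simp
    then show "(\<integral>\<^sup>+x. ennreal (norm ((norm ((jet (\<phi> n) - ?u) x))\<^sup>2)) \<partial>M) < \<infinity>"
      using n by (metis ennreal_one_less_top infinity_ennreal_def less_trans)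
  qed
  then have "L2f M (jet (\<phi> n) - ?u)" unfolding L2f_def using dm by blast
  from L2f_diff[OF L2f_jet[OF \<phi>(1)[of n]] this] have "L2f M (jet (\<phi> n) - (jet (\<phi> n) - ?u))" .
  moreover have "jet (\<phi> n) - (jet (\<phi> n) - ?u) = ?u" by (simp add: fun_eq_iff)
  ultimately have uL: "L2f M ?u" by metis
  have "T = (\<lambda>n. ennreal (l2sq M (jet (\<phi> n) - ?u)))"
    unfolding T_def using nn_integral_l2sq[OF L2f_diff[OF L2f_jet[OF \<phi>(1)] uL]] by blast
  then have "(\<lambda>n. ennreal (l2sq M (jet (\<phi> n) - ?u))) \<longlonglongrightarrow> 0" using T by simp
  then have "(\<lambda>n. l2sq M (jet (\<phi> n) - ?u)) \<longlonglongrightarrow> 0"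
    by (subst (asm) ennreal_tendsto_0_iff) auto
  then show "?u \<in> W20" unfolding W20_def using um uL \<phi>(1) by blast
next
  let ?u = "\<lambda>x. (v x, g x, L x)"
  assume u: "?u \<in> W20"
  then have um: "?u \<in> borel_measurable lebesgue" and uL: "L2f M ?u" unfolding W20_def by auto
  have m: "v \<in> borel_measurable lebesgue" "g \<in> borel_measurable lebesgue" "L \<in> borel_measurable lebesgue"
  proof -
    have c: "continuous_on UNIV (fst :: real \<times> 'a \<times> real \<Rightarrow> real)" "continuous_on UNIV (\<lambda>p :: real \<times> 'a \<times> real. fst (snd p))"
      "continuous_on UNIV (\<lambda>p :: real \<times> 'a \<times> real. snd (snd p))" by (intro continuous_intros)+
    show "v \<in> borel_measurable lebesgue" "g \<in> borel_measurable lebesgue" "L \<in> borel_measurable lebesgue"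
      using c[THEN borel_measurable_continuous_on, OF um] by simp_all
  qed
  note mM = m[THEN measurable_restrict_space1, of \<Omega>]
  have "\<exists>\<phi>. (\<forall>n. test_fun \<Omega> (\<phi> n)) \<and> (\<lambda>n. l2sq M (jet (\<phi> n) - ?u)) \<longlonglongrightarrow> 0"
    using u unfolding W20_def mem_Collect_eq by (elim conjE)
  then obtain \<phi> where \<phi>0: "(\<forall>n. test_fun \<Omega> (\<phi> n)) \<and> (\<lambda>n. l2sq M (jet (\<phi> n) - ?u)) \<longlonglongrightarrow> 0" ..
  have \<phi>: "\<And>n. test_fun \<Omega> (\<phi> n)" "(\<lambda>n. l2sq M (jet (\<phi> n) - ?u)) \<longlonglongrightarrow> 0"
    using \<phi>0 by simp_all
  have T: "(\<lambda>n. l2dist \<Omega> (\<phi> n) v + (l2dist \<Omega> (grad (\<phi> n)) g + l2dist \<Omega> (lap (\<phi> n)) L)) \<longlonglongrightarrow> 0"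
    unfolding nn_integral_jet_diff[OF \<phi>(1) mM, symmetric] nn_integral_l2sq[OF L2f_diff[OF L2f_jet[OF \<phi>(1)] uL]]
    by (subst ennreal_tendsto_0_iff) (rule l2sq_nonneg, rule \<phi>(2))
  have le: "l2dist \<Omega> (\<phi> n) v \<le> l2dist \<Omega> (\<phi> n) v + (l2dist \<Omega> (grad (\<phi> n)) g + l2dist \<Omega> (lap (\<phi> n)) L)"
    "l2dist \<Omega> (grad (\<phi> n)) g \<le> l2dist \<Omega> (\<phi> n) v + (l2dist \<Omega> (grad (\<phi> n)) g + l2dist \<Omega> (lap (\<phi> n)) L)"
    "l2dist \<Omega> (lap (\<phi> n)) L \<le> l2dist \<Omega> (\<phi> n) v + (l2dist \<Omega> (grad (\<phi> n)) g + l2dist \<Omega> (lap (\<phi> n)) L)" for n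
    by (simp_all add: add_increasing add_increasing2)
  have sq: "(f :: nat \<Rightarrow> ennreal) \<longlonglongrightarrow> 0" if "\<And>n. f n \<le> t n" "t \<longlonglongrightarrow> 0" for f t
    by (rule tendsto_sandwich[OF _ _ tendsto_const that(2)]) (simp_all add: that)
  show "H20 \<Omega> v g L"
    unfolding H20_def
  proof (intro conjI m exI[of _ \<phi>] allI)
    show "test_fun \<Omega> (\<phi> n)" for n by (rule \<phi>(1))
  qed (rule sq[OF le(1) T] sq[OF le(2) T] sq[OF le(3) T])+
qed

lemma set_integral_M: "(LINT x:\<Omega>|lebesgue. (f x :: real)) = integral\<^sup>L M f"
  unfolding set_lebesgue_integral_def by (rule integral_restrict_space[OF \<Omega>_lebesgue(2), symmetric])

lemma buckling_eigenspace_iff: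
  "buckling_eigenspace \<Omega> \<sigma> v \<longleftrightarrow>
    (\<exists>u\<in>W20. (\<forall>x. fst (u x) = v x) \<and> (\<forall>w\<in>W20. formA u w = \<sigma> * formB u w))"
proof
  assume "buckling_eigenspace \<Omega> \<sigma> v"
  then obtain g L where H: "H20 \<Omega> v g L" and eq: "\<And>\<psi> g' L'. H20 \<Omega> \<psi> g' L' \<Longrightarrow>
      (LINT x:\<Omega>|lebesgue. L x * L' x) = \<sigma> * (LINT x:\<Omega>|lebesgue. g x \<bullet> g' x)"
    unfolding buckling_eigenspace_def by blast
  have "formA (\<lambda>x. (v x, g x, L x)) w = \<sigma> * formB (\<lambda>x. (v x, g x, L x)) w" if w: "w \<in> W20" for w
  proof -
    have "H20 \<Omega> (\<lambda>x. fst (w x)) (\<lambda>x. fst (snd (w x))) (\<lambda>x. snd (snd (w x)))"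
      unfolding H20_iff using w by simp
    from eq[OF this] show ?thesis unfolding set_integral_M formA_def formB_def by simp
  qed
  then show "\<exists>u\<in>W20. (\<forall>x. fst (u x) = v x) \<and> (\<forall>w\<in>W20. formA u w = \<sigma> * formB u w)"
    using H unfolding H20_iff by (intro bexI[of _ "\<lambda>x. (v x, g x, L x)"]) auto
next
  assume "\<exists>u\<in>W20. (\<forall>x. fst (u x) = v x) \<and> (\<forall>w\<in>W20. formA u w = \<sigma> * formB u w)"
  then obtain u where u: "u \<in> W20" "\<And>x. fst (u x) = v x" "\<And>w. w \<in> W20 \<Longrightarrow> formA u w = \<sigma> * formB u w"
    by blast
  have "H20 \<Omega> v (\<lambda>x. fst (snd (u x))) (\<lambda>x. snd (snd (u x)))"
    unfolding H20_iff using u(1) unfolding u(2)[symmetric] by simp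
  moreover have "(LINT x:\<Omega>|lebesgue. snd (snd (u x)) * L' x) = \<sigma> * (LINT x:\<Omega>|lebesgue. fst (snd (u x)) \<bullet> g' x)"
    if "H20 \<Omega> \<psi> g' L'" for \<psi> g' L'
    using u(3)[of "\<lambda>x. (\<psi> x, g' x, L' x)"] that
    unfolding H20_iff set_integral_M formA_def formB_def by simp
  ultimately show "buckling_eigenspace \<Omega> \<sigma> v" unfolding buckling_eigenspace_def by blast
qed

section \<open>Multiplicities and finiteness of the spectrum below a threshold\<close>

definition mult_set :: "real \<Rightarrow> nat set" where
  "mult_set \<sigma> = {n. \<exists>vs :: nat \<Rightarrow> 'a \<Rightarrow> real.
      (\<forall>i<n. buckling_eigenspace \<Omega> \<sigma> (vs i)) \<and>
      (\<forall>c :: nat \<Rightarrow> real. (AE x in lebesgue. x \<in> \<Omega> \<longrightarrow> (\<Sum>i<n. c i * vs i x) = 0)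
          \<longrightarrow> (\<forall>i<n. c i = 0))}"

lemma AE_M: "(AE x in M. P x) \<longleftrightarrow> (AE x in lebesgue. x \<in> \<Omega> \<longrightarrow> P x)"
  by (rule AE_restrict_space_iff[OF \<Omega>_lebesgue(2)])

lemma formC_zero_AE:
  assumes "u \<in> W20" "formC u u = 0" shows "AE x in lebesgue. x \<in> \<Omega> \<longrightarrow> fst (u x) = 0"
proof -
  have "AE x in M. fst (u x) * fst (u x) = 0"
    using assms(2) integral_nonneg_eq_0_iff_AE[OF L2f_bilinear_integrable[OF bounded_bilinear_forms(3) W20_L2f[OF assms(1)] W20_L2f[OF assms(1)]]]
    unfolding formC_def by simp
  then show ?thesis unfolding AE_M by simp
qed

text \<open>On an eigenspace A = \<sigma> B \<le> z B. If A(w,w) = 0 then C(w,w) = 0, so the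
  combination of the functions vanishes almost everywhere and their independence forces zero
  coefficients. The bound holds uniformly for \<sigma> < z.\<close>

lemma mult_set_bounded:
  assumes z: "0 < z"
  obtains N where "\<And>\<sigma> n. \<sigma> < z \<Longrightarrow> n \<in> mult_set \<sigma> \<Longrightarrow> n \<le> N"
proof -
  obtain N where N: "\<And>n u. (\<forall>i<n. u i \<in> W20) \<Longrightarrow>
     (\<forall>c :: nat \<Rightarrow> real. let w = (\<Sum>i<n. c i *\<^sub>R u i) in formA w w \<le> z * formB w w \<and> (formA w w = 0 \<longrightarrow> (\<forall>i<n. c i = 0)))
     \<Longrightarrow> n \<le> (N::nat)"
    using pair.finite_dimension_bound[OF z] by blast
  obtain K where K: "\<And>u. u \<in> W20 \<Longrightarrow> formC u u \<le> K * formA u u" using Poincare_A by blast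
  have "n \<le> N" if \<sigma>: "\<sigma> < z" and n: "n \<in> mult_set \<sigma>" for \<sigma> n
  proof -
    obtain vs where vs: "\<And>i. i < n \<Longrightarrow> buckling_eigenspace \<Omega> \<sigma> (vs i)"
      and indep: "\<And>c. (AE x in lebesgue. x \<in> \<Omega> \<longrightarrow> (\<Sum>i<n. c i * vs i x) = 0) \<Longrightarrow> (\<forall>i<n. c i = (0::real))"
      using n unfolding mult_set_def by blast
    have "\<forall>i. \<exists>u. i < n \<longrightarrow> u \<in> W20 \<and> (\<forall>x. fst (u x) = vs i x) \<and> (\<forall>w\<in>W20. formA u w = \<sigma> * formB u w)"
      using vs unfolding buckling_eigenspace_iff by blast
    then obtain u where "\<forall>i. i < n \<longrightarrow> u i \<in> W20 \<and> (\<forall>x. fst (u i x) = vs i x) \<and> (\<forall>w\<in>W20. formA (u i) w = \<sigma> * formB (u i) w)"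
      unfolding choice_iff by blast
    then have u: "\<And>i. i < n \<Longrightarrow> u i \<in> W20" "\<And>i x. i < n \<Longrightarrow> fst (u i x) = vs i x"
      "\<And>i w. i < n \<Longrightarrow> w \<in> W20 \<Longrightarrow> formA (u i) w = \<sigma> * formB (u i) w" by auto
    show "n \<le> N"
    proof (rule N[of n u])
      show "\<forall>i<n. u i \<in> W20" using u by blast
      show "\<forall>c :: nat \<Rightarrow> real. let w = (\<Sum>i<n. c i *\<^sub>R u i) in formA w w \<le> z * formB w w \<and> (formA w w = 0 \<longrightarrow> (\<forall>i<n. c i = 0))"
      proof (intro allI, unfold Let_def, intro conjI impI)
        fix c :: "nat \<Rightarrow> real"
        define w where "w = (\<Sum>i<n. c i *\<^sub>R u i)"
        have wW: "w \<in> W20"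
          unfolding w_def using u(1) by (intro subspace_sum[OF subspace_W20] subspace_scale[OF subspace_W20]) auto
        have "formA w w = (\<Sum>i<n. c i * formA (u i) w)"
          unfolding w_def using u(1) wW[unfolded w_def] by (intro psd_form_sum_left[OF psd_forms(1)]) auto
        also have "\<dots> = \<sigma> * (\<Sum>i<n. c i * formB (u i) w)"
          unfolding sum_distrib_left using u(3) wW by (intro sum.cong) auto
        also have "(\<Sum>i<n. c i * formB (u i) w) = formB w w"
          unfolding w_def using u(1) wW[unfolded w_def] by (intro psd_form_sum_left[OF psd_forms(2), symmetric]) auto
        also have "\<sigma> * formB w w \<le> z * formB w w"
          using \<sigma> psd_form_nonneg[OF psd_forms(2) wW] by (intro mult_right_mono) auto
        finally show "formA (\<Sum>i<n. c i *\<^sub>R u i) (\<Sum>i<n. c i *\<^sub>R u i)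
            \<le> z * formB (\<Sum>i<n. c i *\<^sub>R u i) (\<Sum>i<n. c i *\<^sub>R u i)"
          unfolding w_def .
        assume "formA (\<Sum>i<n. c i *\<^sub>R u i) (\<Sum>i<n. c i *\<^sub>R u i) = 0"
        then have "formC w w = 0" using K[OF wW] psd_form_nonneg[OF psd_forms(3) wW] unfolding w_def by simp
        from formC_zero_AE[OF wW this] have "AE x in lebesgue. x \<in> \<Omega> \<longrightarrow> fst (w x) = 0" .
        moreover have "fst (w x) = (\<Sum>i<n. c i * vs i x)" for x
          unfolding w_def sum_scaleR_fun_apply using u(2) by (simp add: fst_sum)
        ultimately show "\<forall>i<n. c i = 0" using indep[of c] by simp
      qed
    qed
  qed
  then show thesis using that by blast
qed

text \<open>The set contains 0 and is bounded, so its \<open>Sup\<close> is an attained maximum and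
  a genuine multiplicity.\<close>

lemma buckling_mult_bounds:
  assumes "0 < z" "\<sigma> < z"
  shows "n \<in> mult_set \<sigma> \<Longrightarrow> n \<le> buckling_mult \<Omega> \<sigma>" "buckling_mult \<Omega> \<sigma> \<in> mult_set \<sigma>"
proof -
  obtain N where N: "\<And>n. n \<in> mult_set \<sigma> \<Longrightarrow> n \<le> N" using mult_set_bounded assms by metis
  have eq: "buckling_mult \<Omega> \<sigma> = Sup (mult_set \<sigma>)" unfolding buckling_mult_def mult_set_def ..
  have bdd: "bdd_above (mult_set \<sigma>)" using N by (intro bdd_aboveI)
  show "n \<in> mult_set \<sigma> \<Longrightarrow> n \<le> buckling_mult \<Omega> \<sigma>" unfolding eq using bdd by (intro cSup_upper)
  have ne: "mult_set \<sigma> \<noteq> {}" unfolding mult_set_def by (intro ex_in_conv[THEN iffD1] exI[of _ 0]) simp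
  have "finite (mult_set \<sigma>)" using N finite_nat_set_iff_bounded_le by blast
  then show "buckling_mult \<Omega> \<sigma> \<in> mult_set \<sigma>"
    unfolding eq Sup_nat_def using ne Max_in[of "mult_set \<sigma>"] by simp
qed

text \<open>Normalisation by \<open>formB\<close> requires B(u,u) to be nonzero. Otherwise A(u,u) =
  \<sigma> B(u,u) = 0, hence u vanishes almost everywhere, which contradicts independence.\<close>

lemma positive_mult_eigenvector:
  assumes z: "0 < z" "\<sigma> < z" and m: "0 < buckling_mult \<Omega> \<sigma>"
  shows "\<exists>u. u \<in> W20 \<and> formB u u = 1 \<and> (\<forall>w\<in>W20. formA u w = \<sigma> * formB u w)"
proof -
  define n where "n = buckling_mult \<Omega> \<sigma>"
  have n: "0 < n" "n \<in> mult_set \<sigma>" using m buckling_mult_bounds(2)[OF z] unfolding n_def by auto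
  then obtain vs where vs: "\<And>i. i < n \<Longrightarrow> buckling_eigenspace \<Omega> \<sigma> (vs i)"
    and indep: "\<And>c. (AE x in lebesgue. x \<in> \<Omega> \<longrightarrow> (\<Sum>i<n. c i * vs i x) = 0) \<Longrightarrow> (\<forall>i<n. c i = (0::real))"
    unfolding mult_set_def by blast
  obtain u where u: "u \<in> W20" "\<And>x. fst (u x) = vs 0 x" "\<And>w. w \<in> W20 \<Longrightarrow> formA u w = \<sigma> * formB u w"
    using vs[OF n(1)] unfolding buckling_eigenspace_iff by blast
  obtain K where K: "\<And>u. u \<in> W20 \<Longrightarrow> formC u u \<le> K * formA u u" using Poincare_A by blast
  have "formB u u \<noteq> 0"
  proof
    assume "formB u u = 0"
    then have "formC u u = 0" using K[OF u(1)] u(3)[OF u(1)] psd_form_nonneg[OF psd_forms(3) u(1)] by simp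
    \<comment> \<open>The coefficient vector that picks out \<open>vs 0\<close> violates
      independence.\<close>
    from formC_zero_AE[OF u(1) this] have "AE x in lebesgue. x \<in> \<Omega> \<longrightarrow> (\<Sum>i<n. (if i = 0 then 1 else 0) * vs i x) = 0"
      using n(1) u(2) by (simp add: if_distrib[of "\<lambda>c. c * _"] sum.delta cong: if_cong)
    from indep[OF this] n(1) show False by auto
  qed
  then have pos: "0 < formB u u" using psd_form_nonneg[OF psd_forms(2) u(1)] by simp
  let ?c = "1 / sqrt (formB u u)"
  have cu: "?c *\<^sub>R u \<in> W20" using u(1) subspace_scale[OF subspace_W20] by blast
  have "formB (?c *\<^sub>R u) (?c *\<^sub>R u) = ?c * (?c * formB u u)"
    using psd_form_scale_left[OF psd_forms(2) u(1) cu] psd_form_scale_right[OF psd_forms(2) u(1) u(1)] by simp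
  then have "formB (?c *\<^sub>R u) (?c *\<^sub>R u) = 1" using pos by simp
  moreover have "formA (?c *\<^sub>R u) w = \<sigma> * formB (?c *\<^sub>R u) w" if "w \<in> W20" for w
    using psd_form_scale_left[OF psd_forms(1) u(1) that] psd_form_scale_left[OF psd_forms(2) u(1) that] u(3)[OF that] by simp
  ultimately show ?thesis using cu by blast
qed

text \<open>Symmetry of both forms makes eigenvectors for distinct values B-orthogonal, so one per
  eigenvalue gives an eigen family, whose length is bounded. Without finiteness the sum defining
  \<open>R2\<close> would collapse to 0.\<close>

lemma finite_spectrum_below:
  assumes z: "0 < z" shows "finite {\<sigma>. 0 < buckling_mult \<Omega> \<sigma> \<and> \<sigma> < z}" (is "finite ?F")
proof -
  obtain N where N: "\<And>n e s. pair.eigen_family z n e s \<Longrightarrow> n \<le> N" using pair.eigen_family_bound[OF z] by blast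
  have "\<forall>\<sigma>. \<exists>u. \<sigma> \<in> ?F \<longrightarrow> u \<in> W20 \<and> formB u u = 1 \<and> (\<forall>w\<in>W20. formA u w = \<sigma> * formB u w)"
    using positive_mult_eigenvector[OF z] by blast
  then obtain U where "\<forall>\<sigma>. \<sigma> \<in> ?F \<longrightarrow> U \<sigma> \<in> W20 \<and> formB (U \<sigma>) (U \<sigma>) = 1 \<and> (\<forall>w\<in>W20. formA (U \<sigma>) w = \<sigma> * formB (U \<sigma>) w)"
    unfolding choice_iff by blast
  then have U: "\<And>\<sigma>. \<sigma> \<in> ?F \<Longrightarrow> U \<sigma> \<in> W20" "\<And>\<sigma>. \<sigma> \<in> ?F \<Longrightarrow> formB (U \<sigma>) (U \<sigma>) = 1"
    "\<And>\<sigma> w. \<sigma> \<in> ?F \<Longrightarrow> w \<in> W20 \<Longrightarrow> formA (U \<sigma>) w = \<sigma> * formB (U \<sigma>) w" by blast+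
  have orth: "formB (U \<sigma>) (U \<tau>) = 0" if "\<sigma> \<in> ?F" "\<tau> \<in> ?F" "\<sigma> \<noteq> \<tau>" for \<sigma> \<tau>
  proof -
    have "\<sigma> * formB (U \<sigma>) (U \<tau>) = formA (U \<sigma>) (U \<tau>)" using U that by simp
    also have "\<dots> = formA (U \<tau>) (U \<sigma>)" using psd_form_sym[OF psd_forms(1)] U(1) that by blast
    also have "\<dots> = \<tau> * formB (U \<tau>) (U \<sigma>)" using U that by simp
    also have "formB (U \<tau>) (U \<sigma>) = formB (U \<sigma>) (U \<tau>)" using psd_form_sym[OF psd_forms(2)] U(1) that by blast
    finally show ?thesis using that(3) by simp
  qed
  have "card T \<le> N" if T: "T \<subseteq> ?F" "finite T" for T
  proof -
    obtain s where s: "bij_betw s {..<card T} T" using ex_bij_betw_nat_finite[OF T(2)] by (auto simp: atLeast0LessThan)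
    then have sT: "s i \<in> ?F" if "i < card T" for i using that T(1) bij_betwE[OF s] by blast
    have inj: "s i \<noteq> s j" if "i < card T" "j < card T" "i \<noteq> j" for i j
      using that s unfolding bij_betw_def inj_on_def by blast
    have "pair.eigen_family z (card T) (\<lambda>i. U (s i)) s"
      unfolding pair.eigen_family_def
    proof (intro conjI allI impI ballI)
      fix i assume i: "i < card T"
      show "U (s i) \<in> W20" by (rule U(1)[OF sT[OF i]])
      show "s i < z" using sT[OF i] by blast
      show "formA (U (s i)) w = s i * formB (U (s i)) w" if "w \<in> W20" for w by (rule U(3)[OF sT[OF i] that])
      fix j assume j: "j < card T"
      show "formB (U (s i)) (U (s j)) = (if i = j then 1 else 0)"
        using U(2)[OF sT[OF i]] orth[OF sT[OF i] sT[OF j]] inj[OF i j] by auto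
    qed
    then show ?thesis by (rule N)
  qed
  then show ?thesis using finite_if_finite_subsets_card_bdd by blast
qed

text \<open>Multiplicity is defined by independence of the functions alone, whereas the family is
  orthonormal in the gradients. Green's identity bridges this: a combination whose first component
  vanishes almost everywhere has B(w,w) = -E(w,w) = 0, so its coefficients are zero.\<close>

lemma eigen_family_card_in_mult_set:
  assumes ef: "pair.eigen_family z n e s"
  shows "card {i. i < n \<and> s i = \<sigma>} \<in> mult_set \<sigma>"
proof -
  let ?I = "{i. i < n \<and> s i = \<sigma>}"
  have fin: "finite ?I" by simp
  obtain r where r: "bij_betw r {..<card ?I} ?I" using ex_bij_betw_nat_finite[OF fin] by (auto simp: atLeast0LessThan)
  have rI: "r k < n" "s (r k) = \<sigma>" if "k < card ?I" for k using bij_betwE[OF r] that by auto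
  define vs where "vs = (\<lambda>k x. fst (e (r k) x))"
  have eW: "e i \<in> W20" "\<And>w. w \<in> W20 \<Longrightarrow> formA (e i) w = s i * formB (e i) w" if "i < n" for i
    using ef that unfolding pair.eigen_family_def by auto
  have "buckling_eigenspace \<Omega> \<sigma> (vs k)" if "k < card ?I" for k
    unfolding buckling_eigenspace_iff vs_def using eW[OF rI(1)[OF that]] rI(2)[OF that] by (intro bexI[of _ "e (r k)"]) auto
  moreover have "\<forall>k<card ?I. c k = 0" if c: "AE x in lebesgue. x \<in> \<Omega> \<longrightarrow> (\<Sum>k<card ?I. c k * vs k x) = 0" for c :: "nat \<Rightarrow> real"
  proof -
    define c' where "c' = (\<lambda>i. if i \<in> ?I then c (inv_into {..<card ?I} r i) else 0)"
    have c'r: "c' (r k) = c k" if "k < card ?I" for k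
      unfolding c'_def using rI[OF that] that r bij_betw_inv_into_left[OF r] by auto
    define w where "w = (\<Sum>i<n. c' i *\<^sub>R e i)"
    note f = pair.eigen_family_forms[OF ef, where c = c', folded w_def]
    have "fst (w x) = (\<Sum>k<card ?I. c k * vs k x)" for x
    proof -
      have "fst (w x) = (\<Sum>i<n. c' i * fst (e i x))"
        unfolding w_def sum_scaleR_fun_apply by (simp add: fst_sum)
      also have "\<dots> = (\<Sum>i\<in>?I. c' i * fst (e i x))"
        by (rule sum.mono_neutral_right) (auto simp: c'_def)
      also have "\<dots> = (\<Sum>k<card ?I. c' (r k) * fst (e (r k) x))"
        by (rule sum.reindex_bij_betw[OF r, symmetric])
      also have "\<dots> = (\<Sum>k<card ?I. c k * vs k x)" using c'r by (simp add: vs_def)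
      finally show ?thesis .
    qed
    then have "AE x in M. fst (w x) = 0" unfolding AE_M using c by simp
    then have "AE x in M. fst (w x) * snd (snd (w x)) = 0" by eventually_elim simp
    then have "formE w w = 0" unfolding formE_def by (rule integral_eq_zero_AE)
    then have "(\<Sum>i<n. (c' i)\<^sup>2) = 0" using Green_W20[OF f(1) f(1)] f(2) by simp
    then have "\<forall>i\<in>{..<n}. (c' i)\<^sup>2 = 0" by (subst (asm) sum_nonneg_eq_0_iff) auto
    then show ?thesis using c'r rI by fastforce
  qed
  ultimately show ?thesis unfolding mult_set_def by blast
qed

text \<open>The family is grouped by the value of \<open>s\<close>; each group is no larger than the
  multiplicity, and eigenvalues not represented contribute nonnegative terms.\<close>

lemma R2_ge_eigen_family:
  assumes z: "0 < z" and ef: "pair.eigen_family z n e s"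
  shows "(\<Sum>i<n. (z - s i)\<^sup>2) \<le> R2 \<Omega> z"
proof -
  let ?F = "{\<sigma>. 0 < buckling_mult \<Omega> \<sigma> \<and> \<sigma> < z}"
  have sz: "s i < z" if "i < n" for i using ef that unfolding pair.eigen_family_def by auto
  have card_le: "card {i. i < n \<and> s i = \<sigma>} \<le> buckling_mult \<Omega> \<sigma>" if "\<sigma> < z" for \<sigma>
    by (rule buckling_mult_bounds(1)[OF z that eigen_family_card_in_mult_set[OF ef]])
  have sub: "s ` {..<n} \<subseteq> ?F"
  proof
    fix \<sigma> assume "\<sigma> \<in> s ` {..<n}"
    then obtain i where i: "i < n" "\<sigma> = s i" by auto
    then have "0 < card {i. i < n \<and> s i = \<sigma>}" by (subst card_gt_0_iff) auto
    then show "\<sigma> \<in> ?F" using card_le[of \<sigma>] sz[OF i(1)] i(2) by auto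
  qed
  have "(\<Sum>i<n. (z - s i)\<^sup>2) = (\<Sum>\<sigma>\<in>s ` {..<n}. \<Sum>i\<in>{i\<in>{..<n}. s i = \<sigma>}. (z - s i)\<^sup>2)"
    by (rule sum.image_gen) simp
  also have "\<dots> = (\<Sum>\<sigma>\<in>s ` {..<n}. real (card {i. i < n \<and> s i = \<sigma>}) * (z - \<sigma>)\<^sup>2)"
    by (rule sum.cong) auto
  also have "\<dots> \<le> (\<Sum>\<sigma>\<in>s ` {..<n}. real (buckling_mult \<Omega> \<sigma>) * (z - \<sigma>)\<^sup>2)"
    using card_le sz by (intro sum_mono mult_right_mono) auto
  also have "\<dots> \<le> R2 \<Omega> z"
    unfolding R2_def using sub finite_spectrum_below[OF z] by (intro sum_mono2) auto
  finally show ?thesis .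
qed

end

section \<open>Smooth cutoff functions\<close>

text \<open>The classical flat function divided by a power of t. The powers make the family closed
  under differentiation up to linear combinations.\<close>

definition flat :: "nat \<Rightarrow> real \<Rightarrow> real" where
  "flat k t = (if t \<le> 0 then 0 else exp (- 1 / t) / t ^ k)"

lemma exp_ge_power_div_fact:
  fixes x :: real
  assumes "0 \<le> x" shows "x ^ n / fact n \<le> exp x"
proof -
  have s: "(\<lambda>n. x ^ n / fact n) sums exp x"
    using exp_converges[of x] by (simp add: divide_inverse mult.commute)
  have "(\<Sum>i\<in>{n}. x ^ i / fact i) \<le> (\<Sum>i. x ^ i / fact i)"
    using assms sums_summable[OF s] by (intro sum_le_suminf) auto
  then show ?thesis using sums_unique[OF s] by simp
qed

lemma flat_nonneg: "0 \<le> flat k t"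
  by (simp add: flat_def)

text \<open>The term of order k+1 of the exponential series at 1/t beats the denominator t^k with
  one power of t to spare. Applied to k+1, it makes the difference quotient at 0 vanish.\<close>

lemma flat_le: "flat k t \<le> fact (Suc k) * \<bar>t\<bar>"
proof (cases "t \<le> 0")
  case False
  then have t: "0 < t" by simp
  have "(1 / t) ^ Suc k / fact (Suc k) \<le> exp (1 / t)" using t by (intro exp_ge_power_div_fact) simp
  then have "1 \<le> exp (1 / t) * (fact (Suc k) * t ^ Suc k)"
    using t by (simp add: field_simps power_divide del: fact_Suc)
  then have "exp (- 1 / t) * 1 \<le> exp (- 1 / t) * (exp (1 / t) * (fact (Suc k) * t ^ Suc k))"
    by (intro mult_left_mono) auto
  also have "\<dots> = fact (Suc k) * t ^ Suc k"
    by (simp add: mult.assoc[symmetric] exp_add[symmetric] del: fact_Suc)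
  finally have "exp (- 1 / t) \<le> (fact (Suc k) * t) * t ^ k" by (simp del: fact_Suc add: mult_ac)
  then show ?thesis unfolding flat_def using t by (simp add: pos_divide_le_eq del: fact_Suc)
next
  case True
  moreover have "0 \<le> fact (Suc k) * \<bar>t\<bar>" by (intro mult_nonneg_nonneg) auto
  ultimately show ?thesis by (simp only: flat_def if_True)
qed

lemma flat_Suc: "flat k t = t * flat (Suc k) t"
  by (simp add: flat_def)

lemma flat_0_le_1: "flat 0 t \<le> 1"
  by (simp add: flat_def)

lemma flat_has_derivative:
  "(flat k has_real_derivative (- real k * flat (Suc k) t + flat (Suc (Suc k)) t)) (at t)"
proof (cases t "0 :: real" rule: linorder_cases)
  case less
  have "\<forall>\<^sub>F s in nhds t. flat k s = 0"
    using eventually_nhds_in_open[of "{..<0}" t] less by (auto elim!: eventually_mono simp: flat_def)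
  then show ?thesis using less by (subst DERIV_cong_ev[OF refl _ refl]) (auto simp: flat_def)
next
  case equal
  have "((\<lambda>s. flat k s / s) \<longlongrightarrow> 0) (at 0)"
  proof (rule Lim_null_comparison)
    show "((\<lambda>s. fact (Suc (Suc k)) * \<bar>s\<bar>) \<longlongrightarrow> 0) (at (0::real))"
      by (auto intro!: tendsto_eq_intros simp del: fact_Suc)
    have "norm (flat k s / s) \<le> fact (Suc (Suc k)) * \<bar>s\<bar>" for s
      using flat_le[of "Suc k" s] flat_nonneg[of "Suc k" s]
      by (cases "s = 0") (auto simp: flat_Suc[of k s] simp del: fact_Suc)
    then show "\<forall>\<^sub>F s in at 0. norm (flat k s / s) \<le> fact (Suc (Suc k)) * \<bar>s\<bar>" by (rule always_eventually[OF allI])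
  qed
  then show ?thesis using equal by (simp add: has_field_derivative_iff flat_def)
next
  case greater
  have "((\<lambda>s. exp (- 1 / s) / s ^ k) has_real_derivative (- real k * (exp (- 1 / t) / t ^ Suc k) + exp (- 1 / t) / t ^ Suc (Suc k))) (at t)"
  \<comment> \<open>The power rule produces the exponent k - 1, truncated at 0, so k = 0 is treated
    apart.\<close>
  proof (cases k)
    case 0
    then show ?thesis
      using greater by (auto intro!: derivative_eq_intros simp: field_simps power2_eq_square)
  next
    case (Suc m)
    have d1: "((\<lambda>s. exp (- 1 / s)) has_real_derivative exp (- 1 / t) / (t * t)) (at t)"
      using greater by (auto intro!: derivative_eq_intros)
    have d2: "((\<lambda>s. s ^ k) has_real_derivative real k * t ^ m) (at t)"
      using DERIV_pow[of k t] Suc by simp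
    have "(E / (t * t) * (t * y) - E * (r * y)) / (t * y * (t * y)) = - r * (E / (t * (t * y))) + E / (t * (t * (t * y)))"
      if "y \<noteq> 0" for E r y :: real
      using that greater by (simp add: field_simps)
    from this[of "t ^ m" "exp (- 1 / t)" "real k"] show ?thesis
      using DERIV_divide[OF d1 d2] greater Suc by simp
  qed
  moreover have "\<forall>\<^sub>F s in nhds t. flat k s = exp (- 1 / s) / s ^ k"
    using eventually_nhds_in_open[of "{0<..}" t] greater by (auto elim!: eventually_mono simp: flat_def)
  ultimately show ?thesis using greater by (subst DERIV_cong_ev[OF refl _ refl]) (auto simp: flat_def)
qed

text \<open>A class closed under directional derivatives, so differentiability of every iterated
  \<open>dpart\<close> in \<open>test_fun\<close> follows from a single induction. The trigonometric
  generators keep the trial functions in the class.\<close>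

inductive elem_smooth :: "('a::euclidean_space \<Rightarrow> real) \<Rightarrow> bool" where
  es_const: "elem_smooth (\<lambda>x. c)"
| es_flat: "elem_smooth (\<lambda>x. flat k (x \<bullet> a + \<beta>))"
| es_cos: "elem_smooth (\<lambda>x. cos (p \<bullet> x))"
| es_sin: "elem_smooth (\<lambda>x. sin (p \<bullet> x))"
| es_add: "elem_smooth f \<Longrightarrow> elem_smooth g \<Longrightarrow> elem_smooth (\<lambda>x. f x + g x)"
| es_mult: "elem_smooth f \<Longrightarrow> elem_smooth g \<Longrightarrow> elem_smooth (\<lambda>x. f x * g x)"

lemma frechet_derivative_eqI:
  assumes "(f has_derivative D) (at x)" shows "f differentiable (at x)" "frechet_derivative f (at x) = D"
  using assms frechet_derivative_at[OF assms] by (auto simp: differentiable_def)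

lemma elem_smooth_deriv:
  assumes "elem_smooth f"
  shows "(\<forall>x. f differentiable (at x)) \<and> (\<forall>b. elem_smooth (\<lambda>x. frechet_derivative f (at x) b))"
  using assms
proof induction
  case (es_const c)
  then show ?case by (simp add: elem_smooth.es_const)
next
  case (es_flat k a \<beta>)
  have D: "((\<lambda>x. flat k (x \<bullet> a + \<beta>)) has_derivative
      (\<lambda>h. (- real k * flat (Suc k) (x \<bullet> a + \<beta>) + flat (Suc (Suc k)) (x \<bullet> a + \<beta>)) * (h \<bullet> a))) (at x)" for x
  proof -
    have "((\<lambda>x. x \<bullet> a + \<beta>) has_derivative (\<lambda>h. h \<bullet> a)) (at x)" by (auto intro!: derivative_eq_intros)
    from has_derivative_compose[OF this flat_has_derivative[of k "x \<bullet> a + \<beta>", unfolded has_field_derivative_def]]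
    show ?thesis .
  qed
  show ?case
    unfolding frechet_derivative_eqI(2)[OF D]
    by (intro conjI allI frechet_derivative_eqI(1)[OF D] elem_smooth.intros)
next
  case (es_cos p)
  have D: "((\<lambda>x. cos (p \<bullet> x)) has_derivative (\<lambda>h. (- 1 * sin (p \<bullet> x)) * (p \<bullet> h))) (at x)" for x
    by (auto intro!: derivative_eq_intros)
  show ?case
    unfolding frechet_derivative_eqI(2)[OF D]
    by (intro conjI allI frechet_derivative_eqI(1)[OF D] elem_smooth.intros)
next
  case (es_sin p)
  have D: "((\<lambda>x. sin (p \<bullet> x)) has_derivative (\<lambda>h. cos (p \<bullet> x) * (p \<bullet> h))) (at x)" for x
    by (auto intro!: derivative_eq_intros)
  show ?case
    unfolding frechet_derivative_eqI(2)[OF D]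
    by (intro conjI allI frechet_derivative_eqI(1)[OF D] elem_smooth.intros)
next
  case (es_add f g)
  then show ?case by (auto simp: frechet_derivative_add intro!: elem_smooth.es_add)
next
  case (es_mult f g)
  then show ?case by (auto simp: frechet_derivative_mult intro!: elem_smooth.es_add elem_smooth.es_mult)
qed

lemma elem_smooth_dpart: "elem_smooth f \<Longrightarrow> elem_smooth (dpart bs f)"
  by (induction bs) (auto dest: elem_smooth_deriv)

lemma elem_smooth_sum: "(\<And>i. i \<in> I \<Longrightarrow> elem_smooth (f i)) \<Longrightarrow> elem_smooth (\<lambda>x. \<Sum>i\<in>I. f i x)"
  by (induction I rule: infinite_finite_induct) (auto intro: elem_smooth.intros)

lemma elem_smooth_prod: "(\<And>i. i \<in> I \<Longrightarrow> elem_smooth (f i)) \<Longrightarrow> elem_smooth (\<lambda>x. \<Prod>i\<in>I. f i x)"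
  by (induction I rule: infinite_finite_induct) (auto intro: elem_smooth.intros)

lemma elem_smooth_test_fun:
  assumes "elem_smooth f" "compact S" "S \<subseteq> \<Omega>" "\<And>x. f x \<noteq> 0 \<Longrightarrow> x \<in> S"
  shows "test_fun \<Omega> f"
proof -
  have sub: "closure {x. f x \<noteq> 0} \<subseteq> S"
    using assms(2,4) by (intro closure_minimal) (auto simp: compact_imp_closed)
  have "bounded {x. f x \<noteq> 0}" using assms(4) compact_imp_bounded[OF assms(2)] by (auto intro: bounded_subset)
  then show ?thesis
    unfolding test_fun_def using elem_smooth_deriv[OF elem_smooth_dpart[OF assms(1)]] sub assms(3) by auto
qed

lemma elem_smooth_continuous: "elem_smooth f \<Longrightarrow> continuous_on UNIV f"
  using elem_smooth_deriv differentiable_continuous_UNIV by blast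

text \<open>Each coordinate contributes one factor per face, with argument n times the signed
  distance to that face. The product stays in [0,1], vanishes off the open box and increases to 1
  inside as the factor n removes the decay.\<close>

definition bump :: "nat \<Rightarrow> 'a::euclidean_space \<Rightarrow> 'a \<Rightarrow> 'a \<Rightarrow> real" where
  "bump n l u x = (\<Prod>b\<in>Basis. flat 0 (x \<bullet> (real n *\<^sub>R b) + (- real n * (l \<bullet> b)))
      * flat 0 (x \<bullet> (- real n *\<^sub>R b) + real n * (u \<bullet> b)))"

lemma elem_smooth_bump: "elem_smooth (bump n l u)"
  unfolding bump_def[abs_def] by (intro elem_smooth_prod es_mult es_flat)

lemma bump_bounds: "0 \<le> bump n l u x" "bump n l u x \<le> 1"
  unfolding bump_def
  by (intro prod_nonneg mult_nonneg_nonneg flat_nonneg ballI)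
     (intro prod_le_1 conjI mult_nonneg_nonneg flat_nonneg mult_le_one flat_0_le_1)

lemma bump_outside: "x \<notin> box l u \<Longrightarrow> bump n l u x = 0"
proof -
  assume "x \<notin> box l u"
  then obtain b where b: "b \<in> Basis" "x \<bullet> b \<le> l \<bullet> b \<or> u \<bullet> b \<le> x \<bullet> b" by (auto simp: mem_box not_less)
  have "real n * (x \<bullet> b) \<le> real n * (l \<bullet> b) \<or> real n * (u \<bullet> b) \<le> real n * (x \<bullet> b)"
    using b(2) by (auto intro: mult_left_mono)
  then have "flat 0 (x \<bullet> (real n *\<^sub>R b) + (- real n * (l \<bullet> b)))
      * flat 0 (x \<bullet> (- real n *\<^sub>R b) + real n * (u \<bullet> b)) = 0"
    by (auto simp: flat_def)
  then show "bump n l u x = 0" unfolding bump_def using b(1) by (intro prod_zero) auto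
qed

lemma bump_tendsto: "(\<lambda>n. bump n l u x) \<longlonglongrightarrow> indicator (box l u) x"
proof (cases "x \<in> box l u")
  case True
  \<comment> \<open>At distance c from a face the factor is exp(-1/(n c)), which tends to 1.\<close>
  have lim: "(\<lambda>n. flat 0 (real n * c)) \<longlonglongrightarrow> 1" if c: "0 < c" for c
  proof -
    have "(\<lambda>n. exp (- (1 / c) * (1 / real n))) \<longlonglongrightarrow> exp (- (1 / c) * 0)"
      by (intro tendsto_intros lim_1_over_n)
    moreover have "\<forall>\<^sub>F n in sequentially. exp (- (1 / c) * (1 / real n)) = flat 0 (real n * c)"
      using eventually_gt_at_top[of 0] by eventually_elim (use c in \<open>simp add: flat_def not_le field_simps\<close>)
    ultimately show ?thesis by (simp add: tendsto_cong)
  qed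
  have "(\<lambda>n. bump n l u x) \<longlonglongrightarrow> (\<Prod>b\<in>(Basis::'a set). 1 * 1)"
    unfolding bump_def
  proof (intro tendsto_prod tendsto_mult)
    fix b :: 'a assume b: "b \<in> Basis"
    have "0 < x \<bullet> b - l \<bullet> b" "0 < u \<bullet> b - x \<bullet> b" using True b by (auto simp: mem_box)
    from lim[OF this(1)] lim[OF this(2)]
    show "(\<lambda>n. flat 0 (x \<bullet> (real n *\<^sub>R b) + (- real n * (l \<bullet> b)))) \<longlonglongrightarrow> 1"
      "(\<lambda>n. flat 0 (x \<bullet> (- real n *\<^sub>R b) + real n * (u \<bullet> b))) \<longlonglongrightarrow> 1"
      by (simp_all add: algebra_simps)
  qed
  then show ?thesis using True by simp
next
  case False
  then show ?thesis using bump_outside[OF False] by simp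
qed

text \<open>Finitely many boxes of a countable cover exhaust the volume up to \<epsilon>; cutting
  them into nonoverlapping boxes makes volumes additive and later keeps a sum of bumps at most 1.
  Interiors may be used since box boundaries are null.\<close>

lemma open_inner_division:
  fixes \<Omega> :: "'a::euclidean_space set"
  assumes "open \<Omega>" "emeasure lborel \<Omega> < \<infinity>" "0 < \<epsilon>"
  obtains p where "p division_of \<Union>p" "\<Union>p \<subseteq> \<Omega>" "measure lborel \<Omega> - \<epsilon> \<le> (\<Sum>K\<in>p. measure lborel (interior K))"
proof -
  obtain \<D> where \<D>: "countable \<D>" "\<D> \<subseteq> Pow \<Omega>" "\<And>X. X \<in> \<D> \<Longrightarrow> \<exists>a b. X = cbox a b" "\<Union>\<D> = \<Omega>"
    using open_countable_Union_open_cbox[OF assms(1)] by metis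
  show thesis
  proof (cases "\<D> = {}")
    case True
    then have "\<Omega> = {}" using \<D>(4) by simp
    then show ?thesis using that[of "{}"] assms(3) by auto
  next
    case False
    define X where "X = from_nat_into \<D>"
    have X: "X i \<in> \<D>" for i unfolding X_def by (rule from_nat_into[OF False])
    have rX: "range X = \<D>" unfolding X_def using range_from_nat_into[OF False \<D>(1)] .
    define A where "A = (\<lambda>n. \<Union>i<n. X i)"
    have Xb: "X i \<in> sets borel" for i using \<D>(3)[OF X[of i]] by auto
    have A: "range A \<subseteq> sets lborel" unfolding A_def using Xb by auto
    have incA: "incseq A" unfolding A_def incseq_def by (auto intro: order.strict_trans2)
    have UA: "(\<Union>n. A n) = \<Omega>" unfolding A_def \<D>(4)[symmetric] rX[symmetric] by auto
    have "(\<lambda>n. measure lborel (A n)) \<longlonglongrightarrow> measure lborel (\<Union>n. A n)"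
      using A incA UA assms(2) by (intro Lim_measure_incseq) (auto simp: less_top)
    then have "\<forall>\<^sub>F n in sequentially. measure lborel \<Omega> - \<epsilon> < measure lborel (A n)"
      unfolding UA using assms(3) by (intro order_tendstoD(1)) auto
    then obtain n where n: "measure lborel \<Omega> - \<epsilon> < measure lborel (A n)"
      unfolding eventually_sequentially by blast
    have "finite (X ` {..<n})" by simp
    then obtain p where p: "p division_of \<Union>(X ` {..<n})"
      using elementary_unions_intervals[of "X ` {..<n}"] \<D>(3) X by blast
    then have pA: "p division_of A n" unfolding A_def by simp
    note pD = division_ofD[OF pA]
    have "measure lborel (A n) \<le> (\<Sum>K\<in>p. measure lborel K)"
    proof -
      have "A n = (\<Union>K\<in>p. K)" using pD(6) by simp
      moreover have "K \<in> fmeasurable lborel" if "K \<in> p" for K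
      proof -
        obtain a b where "K = cbox a b" using pD(4)[OF \<open>K \<in> p\<close>] by blast
        then show ?thesis using emeasure_lborel_cbox_finite[of a b] by (auto simp: fmeasurable_def)
      qed
      ultimately show ?thesis
        using measure_UNION_le[OF pD(1), of "\<lambda>K. K" lborel] by (auto simp: fmeasurable_def)
    qed
    also have "\<dots> = (\<Sum>K\<in>p. measure lborel (interior K))"
    proof (rule sum.cong[OF refl])
      fix K assume "K \<in> p"
      then obtain a b where K: "K = cbox a b" using pD(4) by blast
      then show "measure lborel K = measure lborel (interior K)"
        by (simp add: measure_lborel_cbox_eq measure_lborel_box_eq)
    qed
    finally have "measure lborel \<Omega> - \<epsilon> \<le> (\<Sum>K\<in>p. measure lborel (interior K))" using n by simp
    moreover have "\<Union>p \<subseteq> \<Omega>" using pD(6) UA by auto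
    moreover have "p division_of \<Union>p" using pA pD(6) by simp
    ultimately show ?thesis using that by blast
  qed
qed

text \<open>At most one bump is nonzero at any point, so their sum lies in [0,1]. Its square
  converges to the indicator of the interiors, and dominated convergence recovers their total
  volume.\<close>

lemma exists_cutoff:
  fixes \<Omega> :: "'a::euclidean_space set"
  assumes \<Omega>: "open \<Omega>" "emeasure lborel \<Omega> < \<infinity>" and \<epsilon>: "0 < \<epsilon>"
  obtains \<phi> where "elem_smooth \<phi>" "test_fun \<Omega> \<phi>" "\<And>x. 0 \<le> \<phi> x" "\<And>x. \<phi> x \<le> 1"
    "measure lborel \<Omega> - \<epsilon> < (\<integral>x. (\<phi> x)\<^sup>2 \<partial>lborel)"
proof -
  obtain p where p: "p division_of \<Union>p" "\<Union>p \<subseteq> \<Omega>" "measure lborel \<Omega> - \<epsilon> / 2 \<le> (\<Sum>K\<in>p. measure lborel (interior K))"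
    using open_inner_division[OF \<Omega>, of "\<epsilon> / 2"] \<epsilon> by auto
  note pD = division_ofD[OF p(1)]
  have "\<forall>K. \<exists>l u. K \<in> p \<longrightarrow> K = cbox l u" using pD(4) by blast
  then obtain l u where lu: "\<And>K. K \<in> p \<Longrightarrow> K = cbox (l K) (u K)" by metis
  have int: "interior K = box (l K) (u K)" if "K \<in> p" for K using lu[OF that] interior_cbox by metis
  define \<phi> where "\<phi> = (\<lambda>n x. \<Sum>K\<in>p. bump n (l K) (u K) x)"
  define U where "U = (\<Union>K\<in>p. interior K)"
  have unique: "K = K'" if "K \<in> p" "K' \<in> p" "x \<in> interior K" "x \<in> interior K'" for K K' x
    using pD(5)[OF that(1,2)] that(3,4) by blast
  have single: "\<phi> n x = bump n (l K) (u K) x" if "K \<in> p" "x \<in> interior K" for n x K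
  proof -
    have "bump n (l K') (u K') x = 0" if "K' \<in> p - {K}" for K'
      using unique[of K' K x] that \<open>K \<in> p\<close> \<open>x \<in> interior K\<close> int[of K'] by (intro bump_outside) auto
    then show ?thesis unfolding \<phi>_def using pD(1) that(1) by (subst sum.remove) auto
  qed
  have out: "\<phi> n x = 0" if "x \<notin> U" for n x
    unfolding \<phi>_def using that int by (intro sum.neutral ballI bump_outside) (auto simp: U_def)
  have bounds: "0 \<le> \<phi> n x" "\<phi> n x \<le> 1" for n x
  proof -
    show "0 \<le> \<phi> n x" unfolding \<phi>_def by (intro sum_nonneg bump_bounds)
    show "\<phi> n x \<le> 1"
    proof (cases "x \<in> U")
      case True
      then obtain K where "K \<in> p" "x \<in> interior K" by (auto simp: U_def)
      then show ?thesis using single bump_bounds(2) by simp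
    qed (simp add: out)
  qed
  have es: "elem_smooth (\<phi> n)" for n unfolding \<phi>_def by (intro elem_smooth_sum elem_smooth_bump)
  have cpt: "compact (\<Union>p)" using pD(1) lu by (intro compact_Union) (auto, metis compact_cbox)
  have Up: "U \<subseteq> \<Union>p" unfolding U_def using interior_subset by fastforce
  have tf: "test_fun \<Omega> (\<phi> n)" for n
    by (rule elem_smooth_test_fun[OF es cpt p(2)]) (use out Up in blast)
  have Ub: "U \<in> sets borel" unfolding U_def by (intro borel_open open_UN) auto
  have finU: "emeasure lborel U < \<infinity>"
  proof (rule le_less_trans[OF emeasure_mono \<Omega>(2)])
    show "U \<subseteq> \<Omega>" using Up p(2) by blast
    show "\<Omega> \<in> sets lborel" using \<Omega>(1) by simp
  qed
  have lim: "(\<lambda>n. (\<phi> n x)\<^sup>2) \<longlonglongrightarrow> indicator U x" for x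
  proof (cases "x \<in> U")
    case True
    then obtain K where K: "K \<in> p" "x \<in> interior K" by (auto simp: U_def)
    have "(\<lambda>n. (bump n (l K) (u K) x)\<^sup>2) \<longlonglongrightarrow> (indicator (box (l K) (u K)) x)\<^sup>2"
      by (intro tendsto_power bump_tendsto)
    then show ?thesis using single[OF K] K int[OF K(1)] True by simp
  qed (simp add: out)
  have "(\<lambda>n. \<integral>x. (\<phi> n x)\<^sup>2 \<partial>lborel) \<longlonglongrightarrow> (\<integral>x. indicator U x \<partial>lborel)"
  proof (rule integral_dominated_convergence[where w = "indicator U"])
    show "(indicator U :: 'a \<Rightarrow> real) \<in> borel_measurable lborel" using Ub by simp
    show "(\<lambda>x. (\<phi> n x)\<^sup>2) \<in> borel_measurable lborel" for n
      using borel_measurable_continuous_onI[OF elem_smooth_continuous[OF es]] by simp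
    show "integrable lborel (indicator U :: 'a \<Rightarrow> real)" using Ub finU by (intro integrable_real_indicator) auto
    show "AE x in lborel. norm ((\<phi> n x)\<^sup>2) \<le> indicator U x" for n
      using bounds out by (intro AE_I2) (auto simp: indicator_def power_le_one)
  qed (use lim in simp)
  moreover have "(\<integral>x. indicator U x \<partial>lborel) = measure lborel U" using Ub by simp
  moreover have "measure lborel U = (\<Sum>K\<in>p. measure lborel (interior K))"
    unfolding U_def
  proof (rule measure_finite_Union[OF pD(1)])
    show "disjoint_family_on interior p" using pD(5) by (auto simp: disjoint_family_on_def)
    show "interior ` p \<subseteq> sets lborel" by auto
    show "emeasure lborel (interior K) \<noteq> \<infinity>" if "K \<in> p" for K
      using int[OF that] emeasure_lborel_box_finite[of "l K" "u K"] by simp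
  qed
  ultimately have "\<forall>\<^sub>F n in sequentially. measure lborel \<Omega> - \<epsilon> < (\<integral>x. (\<phi> n x)\<^sup>2 \<partial>lborel)"
    using p(3) \<epsilon> by (intro order_tendstoD(1)) auto
  then obtain n where "measure lborel \<Omega> - \<epsilon> < (\<integral>x. (\<phi> n x)\<^sup>2 \<partial>lborel)"
    unfolding eventually_sequentially by blast
  then show thesis using that[of "\<phi> n"] es tf bounds by blast
qed

section \<open>Bessel's inequality on a cube\<close>

text \<open>For \<kappa> \<noteq> 0 the interval of length 2 pi/h is a whole number of periods, so
  the antiderivative takes equal values at both ends.\<close>

lemma integral_cis_interval:
  assumes h: "0 < h" and \<kappa>: "\<kappa> = h * of_int m"
  shows "(\<integral>t. indicator {- (pi / h)..pi / h} t *\<^sub>R cis (\<kappa> * t) \<partial>lborel)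
    = (if \<kappa> = 0 then complex_of_real (2 * pi / h) else 0)"
proof (cases "\<kappa> = 0")
  case True
  have "(\<integral>t. indicator {- (pi / h)..pi / h} t *\<^sub>R (1::complex) \<partial>lborel) = of_real (2 * pi / h)"
    using h by (simp add: scaleR_conv_of_real)
  then show ?thesis using True by simp
next
  case False
  let ?A = "pi / h"
  define F where "F = (\<lambda>z. exp (\<i> * of_real \<kappa> * z) / (\<i> * of_real \<kappa>))"
  have FD: "(F has_field_derivative exp (\<i> * of_real \<kappa> * z)) (at z)" for z
    unfolding F_def using False by (auto intro!: derivative_eq_intros)
  have D: "((\<lambda>t. F (of_real t)) has_vector_derivative cis (\<kappa> * t)) (at t within {- ?A..?A})" for t
    using has_vector_derivative_real_field[OF FD, of t "{- ?A..?A}"]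
    by (simp add: cis_conv_exp mult.assoc)
  have "(\<integral>t. indicator {- ?A..?A} t *\<^sub>R cis (\<kappa> * t) \<partial>lborel) = F (of_real ?A) - F (of_real (- ?A))"
    using h by (intro integral_FTC_atLeastAtMost D) (auto intro!: continuous_intros)
  also have "\<dots> = (cis (\<kappa> * ?A) - cis (- (\<kappa> * ?A))) / (\<i> * of_real \<kappa>)"
    unfolding F_def by (simp add: cis_conv_exp diff_divide_distrib mult_ac)
  also have "\<kappa> * ?A = pi * of_int m" using h \<kappa> by simp
  also have "cis (pi * of_int m) - cis (- (pi * of_int m)) = 0"
    by (simp add: complex_eq_iff)
  finally show ?thesis using False by simp
qed

lemma integral_product_coordinates:
  fixes f :: "'a::euclidean_space \<Rightarrow> real \<Rightarrow> complex"
  assumes int: "\<And>b. b \<in> Basis \<Longrightarrow> integrable lborel (f b)"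
  shows "(\<integral>x. (\<Prod>b\<in>Basis. f b (x \<bullet> b)) \<partial>lborel) = (\<Prod>b\<in>Basis. \<integral>t. f b t \<partial>lborel)"
proof -
  interpret product_sigma_finite "\<lambda>_. lborel :: real measure" ..
  have m: "f b \<in> borel_measurable borel" if "b \<in> Basis" for b
    using borel_measurable_integrable[OF int[OF that]] by simp
  have "(\<lambda>x. \<Prod>b\<in>Basis. f b (x \<bullet> b)) \<in> borel_measurable (borel :: 'a measure)"
  proof (rule borel_measurable_prod)
    fix b :: 'a assume "b \<in> Basis"
    then show "(\<lambda>x. f b (x \<bullet> b)) \<in> borel_measurable borel"
      by (intro measurable_compose[OF _ m]) auto
  qed
  then have "(\<integral>x. (\<Prod>b\<in>Basis. f b (x \<bullet> b)) \<partial>lborel)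
      = (\<integral>g. (\<Prod>b\<in>Basis. f b ((\<Sum>c\<in>Basis. g c *\<^sub>R c) \<bullet> b)) \<partial>(\<Pi>\<^sub>M b\<in>Basis. lborel))"
    by (subst lborel_eq) (subst integral_distr, auto)
  also have "\<dots> = (\<integral>g. (\<Prod>b\<in>Basis. f b (g b)) \<partial>(\<Pi>\<^sub>M b\<in>Basis. lborel))"
    by (intro Bochner_Integration.integral_cong refl prod.cong) simp_all
  also have "\<dots> = (\<Prod>b\<in>Basis. \<integral>t. f b t \<partial>lborel)"
    using int by (intro product_integral_prod) auto
  finally show ?thesis .
qed

text \<open>The side length 2 pi/h is chosen so that the lattice of mesh h consists of frequencies
  periodic on the cube.\<close>

definition cube :: "real \<Rightarrow> 'a::euclidean_space set" where
  "cube h = cbox (- (pi / h) *\<^sub>R One) ((pi / h) *\<^sub>R One)"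

lemma cis_sum_prod: "finite I \<Longrightarrow> cis (\<Sum>i\<in>I. a i) = (\<Prod>i\<in>I. cis (a i))"
  by (induction I rule: finite_induct) (auto simp: cis_mult[symmetric])

text \<open>The exponential factorises over the coordinates, and a single nonzero component of
  \<open>k\<close> annihilates the product.\<close>

lemma integral_cis_cube:
  fixes k :: "'a::euclidean_space"
  assumes h: "0 < h" and k: "\<And>b. b \<in> Basis \<Longrightarrow> \<exists>m. k \<bullet> b = h * of_int m"
  shows "(\<integral>x. indicator (cube h) x *\<^sub>R cis (k \<bullet> x) \<partial>lborel) = (if k = 0 then complex_of_real ((2 * pi / h) ^ DIM('a)) else 0)"
proof -
  let ?I = "{- (pi / h)..pi / h}"
  let ?f = "\<lambda>b t. indicator ?I t *\<^sub>R cis ((k \<bullet> b) * t)"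
  have int: "integrable lborel (?f b)" for b
    by (intro borel_integrable_compact) (auto intro!: continuous_intros)
  have "indicator (cube h) x *\<^sub>R cis (k \<bullet> x) = (\<Prod>b\<in>Basis. ?f b (x \<bullet> b))" for x
  proof -
    have "k \<bullet> x = (\<Sum>b\<in>Basis. (k \<bullet> b) * (x \<bullet> b))" by (rule euclidean_inner)
    then have "cis (k \<bullet> x) = (\<Prod>b\<in>Basis. cis ((k \<bullet> b) * (x \<bullet> b)))" by (simp add: cis_sum_prod)
    moreover have "complex_of_real (indicator (cube h) x) = (\<Prod>b\<in>Basis. complex_of_real (indicator ?I (x \<bullet> b)))"
    proof (cases "x \<in> cube h")
      case True
      then show ?thesis by (auto simp: cube_def mem_box indicator_def intro!: prod.neutral[symmetric])
    next
      case False
      then obtain b where "b \<in> Basis" "x \<bullet> b \<notin> ?I" by (auto simp: cube_def mem_box)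
      then show ?thesis using False by (auto simp: indicator_def intro!: prod_zero[symmetric] bexI[of _ b])
    qed
    ultimately show ?thesis by (simp add: scaleR_conv_of_real prod.distrib)
  qed
  then have "(\<integral>x. indicator (cube h) x *\<^sub>R cis (k \<bullet> x) \<partial>lborel) = (\<integral>x. (\<Prod>b\<in>Basis. ?f b (x \<bullet> b)) \<partial>lborel)" by simp
  also have "\<dots> = (\<Prod>b\<in>Basis. \<integral>t. ?f b t \<partial>lborel)" by (rule integral_product_coordinates[OF int])
  also have "\<dots> = (\<Prod>b\<in>Basis. if k \<bullet> b = 0 then complex_of_real (2 * pi / h) else 0)"
    using integral_cis_interval[OF h] k by (intro prod.cong refl) metis
  also have "\<dots> = (if k = 0 then complex_of_real ((2 * pi / h) ^ DIM('a)) else 0)"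
  proof (cases "k = 0")
    case False
    then obtain b where "b \<in> Basis" "k \<bullet> b \<noteq> 0" using euclidean_all_zero_iff by blast
    then show ?thesis using False by (auto intro!: prod_zero)
  qed simp
  finally show ?thesis .
qed

lemma lattice_diff:
  assumes "p \<in> range (rnd h)" "q \<in> range (rnd h)" "b \<in> Basis"
  shows "\<exists>m. (p - q) \<bullet> b = h * of_int m"
proof -
  obtain x y where "p = rnd h x" "q = rnd h y" using assms by auto
  then have "(p - q) \<bullet> b = h * of_int (\<lfloor>x \<bullet> b / h\<rfloor> - \<lfloor>y \<bullet> b / h\<rfloor>)"
    using assms(3) by (simp add: inner_diff_left rnd_inner right_diff_distrib)
  then show ?thesis by blast
qed

abbreviation cube_measure :: "real \<Rightarrow> 'a::euclidean_space measure" where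
  "cube_measure h \<equiv> lebesgue_on (cube h)"

lemma cube_lebesgue: "cube h \<in> sets lebesgue" "cube h \<inter> space lebesgue \<in> sets lebesgue"
  by (auto simp: cube_def)

lemma cube_measure_continuous:
  fixes f :: "'a::euclidean_space \<Rightarrow> 'b::euclidean_space"
  assumes "continuous_on UNIV f"
  shows "integrable (cube_measure h) f" "integral\<^sup>L (cube_measure h) f = (\<integral>x. indicator (cube h) x *\<^sub>R f x \<partial>lborel)"
proof -
  have int: "integrable lborel (\<lambda>x. indicator (cube h) x *\<^sub>R f x)"
    using assms unfolding cube_def by (intro borel_integrable_compact) (auto intro: continuous_on_subset)
  have m: "(\<lambda>x. indicator (cube h) x *\<^sub>R f x) \<in> borel_measurable lborel"
    using borel_measurable_integrable[OF int] .
  show "integrable (cube_measure h) f"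
    unfolding integrable_restrict_space[OF cube_lebesgue(2)] integrable_completion[OF m] by (rule int)
  show "integral\<^sup>L (cube_measure h) f = (\<integral>x. indicator (cube h) x *\<^sub>R f x \<partial>lborel)"
    unfolding integral_restrict_space[OF cube_lebesgue(2)] by (rule integral_completion[OF m])
qed

lemma integral_trig_cube:
  fixes p q :: "'a::euclidean_space"
  assumes h: "0 < h" and pq: "p \<in> range (rnd h)" "q \<in> range (rnd h)"
  shows "(\<integral>x. cos ((p - q) \<bullet> x) \<partial>cube_measure h) = (if p = q then (2 * pi / h) ^ DIM('a) else 0)"
    "(\<integral>x. sin ((p - q) \<bullet> x) \<partial>cube_measure h) = 0"
proof -
  have c: "continuous_on UNIV (\<lambda>x. cis ((p - q) \<bullet> x))" by (intro continuous_intros)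
  have v: "(\<integral>x. cis ((p - q) \<bullet> x) \<partial>cube_measure h) = (if p = q then complex_of_real ((2 * pi / h) ^ DIM('a)) else 0)"
    unfolding cube_measure_continuous(2)[OF c]
    using integral_cis_cube[OF h lattice_diff[OF pq]] by simp
  have "(\<integral>x. cos ((p - q) \<bullet> x) \<partial>cube_measure h) = (\<integral>x. Re (cis ((p - q) \<bullet> x)) \<partial>cube_measure h)" by simp
  also have "\<dots> = Re (\<integral>x. cis ((p - q) \<bullet> x) \<partial>cube_measure h)"
    by (rule integral_bounded_linear[OF bounded_linear_Re cube_measure_continuous(1)[OF c]])
  finally show "(\<integral>x. cos ((p - q) \<bullet> x) \<partial>cube_measure h) = (if p = q then (2 * pi / h) ^ DIM('a) else 0)"
    unfolding v by simp
  have "(\<integral>x. sin ((p - q) \<bullet> x) \<partial>cube_measure h) = (\<integral>x. Im (cis ((p - q) \<bullet> x)) \<partial>cube_measure h)" by simp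
  also have "\<dots> = Im (\<integral>x. cis ((p - q) \<bullet> x) \<partial>cube_measure h)"
    by (rule integral_bounded_linear[OF bounded_linear_Im cube_measure_continuous(1)[OF c]])
  finally show "(\<integral>x. sin ((p - q) \<bullet> x) \<partial>cube_measure h) = 0"
    unfolding v by simp
qed

text \<open>The complex proof in real terms: the squared distance of g to its Fourier sum divided by
  \<open>V\<close> is nonnegative. Complex exponentials rather than cosines and sines are the
  orthogonal system, because P may contain both p and -p.\<close>

lemma Bessel_cube:
  fixes g :: "'a::euclidean_space \<Rightarrow> real"
  assumes h: "0 < h" and P: "finite P" "P \<subseteq> range (rnd h)" and g: "L2f (cube_measure h) g"
  shows "(\<Sum>p\<in>P. (\<integral>x. g x * cos (p \<bullet> x) \<partial>cube_measure h)\<^sup>2 + (\<integral>x. g x * sin (p \<bullet> x) \<partial>cube_measure h)\<^sup>2)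
     \<le> (2 * pi / h) ^ DIM('a) * l2sq (cube_measure h) g"
proof -
  let ?N = "cube_measure h :: 'a measure"
  define V where "V = (2 * pi / h) ^ DIM('a)"
  have V: "0 < V" unfolding V_def using h by simp
  define C where "C = (\<lambda>p. \<integral>x. g x * cos (p \<bullet> x) \<partial>?N)"
  define S where "S = (\<lambda>p. \<integral>x. g x * sin (p \<bullet> x) \<partial>?N)"
  define Y where "Y = (\<Sum>p\<in>P. (C p)\<^sup>2 + (S p)\<^sup>2)"
  \<comment> \<open>With Fourier coefficient C - iS, \<open>t1\<close> and \<open>t2\<close> are the
    real and imaginary parts of the sum of (C p - i S p) e^(i p x).\<close>
  define t1 where "t1 = (\<lambda>x. \<Sum>p\<in>P. C p * cos (p \<bullet> x) + S p * sin (p \<bullet> x))"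
  define t2 where "t2 = (\<lambda>x. \<Sum>p\<in>P. C p * sin (p \<bullet> x) - S p * cos (p \<bullet> x))"
  have L2c: "L2f ?N f" if "continuous_on UNIV f" for f :: "'a \<Rightarrow> real"
    unfolding L2f_def
    using borel_measurable_integrable[OF cube_measure_continuous(1)[OF that]] that
    by (auto intro!: cube_measure_continuous(1) continuous_intros)
  have gf: "integrable ?N (\<lambda>x. g x * f x)" if "continuous_on UNIV f" for f :: "'a \<Rightarrow> real"
    by (rule L2f_bilinear_integrable[OF bounded_bilinear_mult g L2c[OF that]])
  have gc: "integrable ?N (\<lambda>x. g x * cos (p \<bullet> x))" "integrable ?N (\<lambda>x. g x * sin (p \<bullet> x))" for p
    by (intro gf continuous_intros)+
  have tc: "continuous_on UNIV t1" "continuous_on UNIV t2"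
    unfolding t1_def t2_def by (intro continuous_intros)+
  have gt1: "(\<integral>x. g x * t1 x \<partial>?N) = Y"
  proof -
    have "(\<integral>x. g x * t1 x \<partial>?N) = (\<integral>x. (\<Sum>p\<in>P. C p * (g x * cos (p \<bullet> x)) + S p * (g x * sin (p \<bullet> x))) \<partial>?N)"
      unfolding t1_def sum_distrib_left by (simp add: algebra_simps)
    also have "\<dots> = (\<Sum>p\<in>P. C p * C p + S p * S p)"
      unfolding C_def S_def using gc by (subst Bochner_Integration.integral_sum) auto
    finally show ?thesis unfolding Y_def by (simp add: power2_eq_square)
  qed
  have tt: "(\<integral>x. (t1 x)\<^sup>2 + (t2 x)\<^sup>2 \<partial>?N) = V * Y"
  proof -
    let ?a = "\<lambda>p q. C p * C q + S p * S q" and ?b = "\<lambda>p q. S p * C q - C p * S q"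
    have ic: "integrable ?N (\<lambda>x. cos ((p - q) \<bullet> x))" "integrable ?N (\<lambda>x. sin ((p - q) \<bullet> x))" for p q
      by (intro cube_measure_continuous(1) continuous_intros)+
    have "(t1 x)\<^sup>2 + (t2 x)\<^sup>2 = (\<Sum>p\<in>P. \<Sum>q\<in>P. ?a p q * cos ((p - q) \<bullet> x) + ?b p q * sin ((p - q) \<bullet> x))" for x
      unfolding t1_def t2_def power2_eq_square sum_product sum.distrib[symmetric]
      by (intro sum.cong refl) (simp add: inner_diff_left cos_diff sin_diff algebra_simps)
    then have "(\<integral>x. (t1 x)\<^sup>2 + (t2 x)\<^sup>2 \<partial>?N)
        = (\<integral>x. (\<Sum>p\<in>P. \<Sum>q\<in>P. ?a p q * cos ((p - q) \<bullet> x) + ?b p q * sin ((p - q) \<bullet> x)) \<partial>?N)" by simp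
    also have "\<dots> = (\<Sum>p\<in>P. \<integral>x. (\<Sum>q\<in>P. ?a p q * cos ((p - q) \<bullet> x) + ?b p q * sin ((p - q) \<bullet> x)) \<partial>?N)"
      using ic by (intro Bochner_Integration.integral_sum Bochner_Integration.integrable_sum
          Bochner_Integration.integrable_add integrable_mult_right)
    also have "\<dots> = (\<Sum>p\<in>P. \<Sum>q\<in>P. \<integral>x. ?a p q * cos ((p - q) \<bullet> x) + ?b p q * sin ((p - q) \<bullet> x) \<partial>?N)"
      using ic by (intro sum.cong refl Bochner_Integration.integral_sum
          Bochner_Integration.integrable_add integrable_mult_right)
    also have "\<dots> = (\<Sum>p\<in>P. \<Sum>q\<in>P. if p = q then ?a p q * V else 0)"
    proof (intro sum.cong refl)
      fix p q assume "p \<in> P" "q \<in> P"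
      then have pq: "p \<in> range (rnd h)" "q \<in> range (rnd h)" using P(2) by auto
      have "(\<integral>x. ?a p q * cos ((p - q) \<bullet> x) + ?b p q * sin ((p - q) \<bullet> x) \<partial>?N)
          = ?a p q * (\<integral>x. cos ((p - q) \<bullet> x) \<partial>?N) + ?b p q * (\<integral>x. sin ((p - q) \<bullet> x) \<partial>?N)"
        using ic[of p q] by simp
      then show "(\<integral>x. ?a p q * cos ((p - q) \<bullet> x) + ?b p q * sin ((p - q) \<bullet> x) \<partial>?N) = (if p = q then ?a p q * V else 0)"
        unfolding integral_trig_cube[OF h pq] V_def by simp
    qed
    also have "\<dots> = (\<Sum>p\<in>P. ?a p p * V)" using P(1) by (intro sum.cong refl) (simp add: sum.delta)
    also have "\<dots> = V * Y" unfolding Y_def by (simp add: sum_distrib_left power2_eq_square mult.commute)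
    finally show ?thesis .
  qed
  have int: "integrable ?N (\<lambda>x. (g x)\<^sup>2)" "integrable ?N (\<lambda>x. g x * t1 x)" "integrable ?N (\<lambda>x. (t1 x)\<^sup>2 + (t2 x)\<^sup>2)"
    using L2f_integrable[OF g] gf[OF tc(1)] tc
    by (auto intro!: cube_measure_continuous(1) continuous_intros)
  have "0 \<le> (\<integral>x. (g x - t1 x / V)\<^sup>2 + (t2 x / V)\<^sup>2 \<partial>?N)" by (intro integral_nonneg_AE) auto
  also have "\<dots> = (\<integral>x. (g x)\<^sup>2 - 2 / V * (g x * t1 x) + 1 / V\<^sup>2 * ((t1 x)\<^sup>2 + (t2 x)\<^sup>2) \<partial>?N)"
    by (simp add: power2_diff power_divide algebra_simps add_divide_distrib)
  also have "\<dots> = (\<integral>x. (g x)\<^sup>2 \<partial>?N) - 2 / V * (\<integral>x. g x * t1 x \<partial>?N) + 1 / V\<^sup>2 * (\<integral>x. (t1 x)\<^sup>2 + (t2 x)\<^sup>2 \<partial>?N)"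
    using int by simp
  also have "\<dots> = (\<integral>x. (g x)\<^sup>2 \<partial>?N) - 2 / V * Y + 1 / V\<^sup>2 * (V * Y)"
    unfolding gt1 tt ..
  also have "\<dots> = l2sq ?N g - Y / V" unfolding l2sq_def using V by (simp add: field_simps power2_eq_square)
  finally have "Y \<le> V * l2sq ?N g" using V by (simp add: field_simps)
  then show ?thesis unfolding Y_def C_def S_def V_def .
qed

section \<open>The averaged variational principle\<close>

lemma frechet_derivative_mult_cos:
  fixes f :: "'a::euclidean_space \<Rightarrow> real"
  assumes "f differentiable (at x)"
  shows "(\<lambda>x. f x * cos (p \<bullet> x)) differentiable (at x)"
    "frechet_derivative (\<lambda>x. f x * cos (p \<bullet> x)) (at x) b
      = frechet_derivative f (at x) b * cos (p \<bullet> x) - (p \<bullet> b) * (f x * sin (p \<bullet> x))"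
proof -
  have D: "((\<lambda>x. cos (p \<bullet> x)) has_derivative (\<lambda>h. - sin (p \<bullet> x) * (p \<bullet> h))) (at x)"
    by (auto intro!: derivative_eq_intros)
  show "(\<lambda>x. f x * cos (p \<bullet> x)) differentiable (at x)"
    by (rule differentiable_mult[OF assms frechet_derivative_eqI(1)[OF D]])
  show "frechet_derivative (\<lambda>x. f x * cos (p \<bullet> x)) (at x) b
      = frechet_derivative f (at x) b * cos (p \<bullet> x) - (p \<bullet> b) * (f x * sin (p \<bullet> x))"
    unfolding frechet_derivative_mult[OF assms frechet_derivative_eqI(1)[OF D]] frechet_derivative_eqI(2)[OF D]
    by (simp add: algebra_simps)
qed

lemma frechet_derivative_mult_sin:
  fixes f :: "'a::euclidean_space \<Rightarrow> real"
  assumes "f differentiable (at x)"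
  shows "(\<lambda>x. f x * sin (p \<bullet> x)) differentiable (at x)"
    "frechet_derivative (\<lambda>x. f x * sin (p \<bullet> x)) (at x) b
      = frechet_derivative f (at x) b * sin (p \<bullet> x) + (p \<bullet> b) * (f x * cos (p \<bullet> x))"
proof -
  have D: "((\<lambda>x. sin (p \<bullet> x)) has_derivative (\<lambda>h. cos (p \<bullet> x) * (p \<bullet> h))) (at x)"
    by (auto intro!: derivative_eq_intros)
  show "(\<lambda>x. f x * sin (p \<bullet> x)) differentiable (at x)"
    by (rule differentiable_mult[OF assms frechet_derivative_eqI(1)[OF D]])
  show "frechet_derivative (\<lambda>x. f x * sin (p \<bullet> x)) (at x) b
      = frechet_derivative f (at x) b * sin (p \<bullet> x) + (p \<bullet> b) * (f x * cos (p \<bullet> x))"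
    unfolding frechet_derivative_mult[OF assms frechet_derivative_eqI(1)[OF D]] frechet_derivative_eqI(2)[OF D]
    by (simp add: algebra_simps)
qed

text \<open>Expansion of (x - \<eta> y)^2/\<eta> \<ge> 0. The lopsided weights let the main term y
  lose only a factor 1 + \<eta>, both for trial coefficients and for rounding to the
  lattice.\<close>

lemma square_add_le_weighted:
  fixes x y \<eta> :: real
  assumes "0 < \<eta>" shows "(x + y)\<^sup>2 \<le> (1 + 1 / \<eta>) * x\<^sup>2 + (1 + \<eta>) * y\<^sup>2"
proof -
  have "0 \<le> (x - \<eta> * y)\<^sup>2 / \<eta>" using assms by simp
  also have "\<dots> = x\<^sup>2 / \<eta> - 2 * x * y + \<eta> * y\<^sup>2" using assms by (simp add: field_simps power2_eq_square)
  finally show ?thesis by (simp add: power2_sum algebra_simps)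
qed

locale cutoff_domain = finite_volume_domain \<Omega> for \<Omega> :: "'a::euclidean_space set" +
  fixes \<phi> :: "'a \<Rightarrow> real"
  assumes smooth: "elem_smooth \<phi>" and test: "test_fun \<Omega> \<phi>"
    and nonneg: "\<And>x. 0 \<le> \<phi> x" and le_1: "\<And>x. \<phi> x \<le> 1"
    and mass: "0 < (\<integral>x. (\<phi> x)\<^sup>2 \<partial>lborel)"
begin

text \<open>Together with \<open>fs\<close>, the real and imaginary parts of \<phi> times a plane
  wave; \<open>H20\<close> consists of real functions.\<close>

definition fc :: "'a \<Rightarrow> 'a \<Rightarrow> real" where "fc p x = \<phi> x * cos (p \<bullet> x)"
definition fs :: "'a \<Rightarrow> 'a \<Rightarrow> real" where "fs p x = \<phi> x * sin (p \<bullet> x)"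
definition m0 :: real where "m0 = (\<integral>x. (\<phi> x)\<^sup>2 \<partial>lborel)"
definition k1 :: real where "k1 = (\<integral>x. grad \<phi> x \<bullet> grad \<phi> x \<partial>lborel)"
definition k2 :: real where "k2 = (\<integral>x. (lap \<phi> x)\<^sup>2 \<partial>lborel)"

lemma test_trial: "test_fun \<Omega> (fc p)" "test_fun \<Omega> (fs p)"
proof -
  have S: "compact (closure {x. \<phi> x \<noteq> 0})" "closure {x. \<phi> x \<noteq> 0} \<subseteq> \<Omega>" using test by (auto simp: test_fun_def)
  have out: "x \<in> closure {x. \<phi> x \<noteq> 0}" if "\<phi> x \<noteq> 0" for x using that closure_subset[of "{x. \<phi> x \<noteq> 0}"] by auto
  show "test_fun \<Omega> (fc p)" "test_fun \<Omega> (fs p)"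
    unfolding fc_def[abs_def] fs_def[abs_def]
    by (rule elem_smooth_test_fun[OF es_mult[OF smooth es_cos] S], rule out, simp)
       (rule elem_smooth_test_fun[OF es_mult[OF smooth es_sin] S], rule out, simp)
qed

lemma diff_\<phi>: "\<phi> differentiable (at x)" "b \<in> Basis \<Longrightarrow> dpart [b] \<phi> differentiable (at x)"
  using test_fun_differentiable[OF test, of "[]"] test_fun_differentiable[OF test, of "[b]"] by auto

lemma dpart_trial:
  "dpart [b] (fc p) = (\<lambda>x. dpart [b] \<phi> x * cos (p \<bullet> x) + (- (p \<bullet> b)) * (\<phi> x * sin (p \<bullet> x)))"
  "dpart [b] (fs p) = (\<lambda>x. dpart [b] \<phi> x * sin (p \<bullet> x) + (p \<bullet> b) * (\<phi> x * cos (p \<bullet> x)))"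
  unfolding fc_def[abs_def] fs_def[abs_def]
  by (simp_all add: fun_eq_iff frechet_derivative_mult_cos[OF diff_\<phi>(1)] frechet_derivative_mult_sin[OF diff_\<phi>(1)])

lemma dpart2_trial:
  assumes b: "b \<in> Basis"
  shows "dpart [b, b] (fc p) x = dpart [b, b] \<phi> x * cos (p \<bullet> x) - 2 * ((p \<bullet> b) * dpart [b] \<phi> x) * sin (p \<bullet> x)
      - (p \<bullet> b)\<^sup>2 * (\<phi> x * cos (p \<bullet> x))"
    "dpart [b, b] (fs p) x = dpart [b, b] \<phi> x * sin (p \<bullet> x) + 2 * ((p \<bullet> b) * dpart [b] \<phi> x) * cos (p \<bullet> x)
      - (p \<bullet> b)\<^sup>2 * (\<phi> x * sin (p \<bullet> x))"
proof -
  note d = diff_\<phi>(2)[OF b]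
  note c1 = frechet_derivative_mult_cos[OF d] and s1 = frechet_derivative_mult_sin[OF d]
  note c0 = frechet_derivative_mult_cos[OF diff_\<phi>(1)] and s0 = frechet_derivative_mult_sin[OF diff_\<phi>(1)]
  have dcm: "(\<lambda>x. c * g x) differentiable (at x)" if "g differentiable (at x)" for c and g :: "'a \<Rightarrow> real"
    using that by (intro differentiable_mult) auto
  have "frechet_derivative (dpart [b] (fc p)) (at x) b
    = (frechet_derivative (dpart [b] \<phi>) (at x) b * cos (p \<bullet> x) - (p \<bullet> b) * (dpart [b] \<phi> x * sin (p \<bullet> x)))
     + (- (p \<bullet> b)) * (frechet_derivative \<phi> (at x) b * sin (p \<bullet> x) + (p \<bullet> b) * (\<phi> x * cos (p \<bullet> x)))"
    unfolding dpart_trial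
    unfolding frechet_derivative_add[OF c1(1) dcm[OF s0(1)]] frechet_derivative_cmult[OF s0(1)] c1(2) s0(2) ..
  then show "dpart [b, b] (fc p) x = dpart [b, b] \<phi> x * cos (p \<bullet> x) - 2 * ((p \<bullet> b) * dpart [b] \<phi> x) * sin (p \<bullet> x)
      - (p \<bullet> b)\<^sup>2 * (\<phi> x * cos (p \<bullet> x))"
    by (simp add: power2_eq_square algebra_simps)
  have "frechet_derivative (dpart [b] (fs p)) (at x) b
    = (frechet_derivative (dpart [b] \<phi>) (at x) b * sin (p \<bullet> x) + (p \<bullet> b) * (dpart [b] \<phi> x * cos (p \<bullet> x)))
     + (p \<bullet> b) * (frechet_derivative \<phi> (at x) b * cos (p \<bullet> x) - (p \<bullet> b) * (\<phi> x * sin (p \<bullet> x)))"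
    unfolding dpart_trial
    unfolding frechet_derivative_add[OF s1(1) dcm[OF c0(1)]] frechet_derivative_cmult[OF c0(1)] s1(2) c0(2) ..
  then show "dpart [b, b] (fs p) x = dpart [b, b] \<phi> x * sin (p \<bullet> x) + 2 * ((p \<bullet> b) * dpart [b] \<phi> x) * cos (p \<bullet> x)
      - (p \<bullet> b)\<^sup>2 * (\<phi> x * sin (p \<bullet> x))"
    by (simp add: power2_eq_square algebra_simps)
qed

lemma inner_grad: "p \<bullet> grad f x = (\<Sum>b\<in>Basis. (p \<bullet> b) * dpart [b] f x)"
  unfolding grad_def by (simp add: inner_sum_right mult.commute)

lemma norm_sq_sum: "(norm (p::'a))\<^sup>2 = (\<Sum>b\<in>Basis. (p \<bullet> b)\<^sup>2)"
  unfolding power2_norm_eq_inner by (subst euclidean_inner) (simp add: power2_eq_square)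

lemma grad_trial:
  "grad (fc p) x = cos (p \<bullet> x) *\<^sub>R grad \<phi> x - (\<phi> x * sin (p \<bullet> x)) *\<^sub>R p"
  "grad (fs p) x = sin (p \<bullet> x) *\<^sub>R grad \<phi> x + (\<phi> x * cos (p \<bullet> x)) *\<^sub>R p"
proof -
  have p: "(\<Sum>b\<in>Basis. ((p \<bullet> b) * c) *\<^sub>R b) = c *\<^sub>R p" for c
    by (subst (2) euclidean_representation[of p, symmetric]) (simp add: scaleR_sum_right mult.commute)
  have "grad (fc p) x = (\<Sum>b\<in>Basis. cos (p \<bullet> x) *\<^sub>R (dpart [b] \<phi> x *\<^sub>R b) - ((p \<bullet> b) * (\<phi> x * sin (p \<bullet> x))) *\<^sub>R b)"
    unfolding grad_def dpart_trial by (simp add: scaleR_left_distrib mult.commute scaleR_diff_left)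
  then show "grad (fc p) x = cos (p \<bullet> x) *\<^sub>R grad \<phi> x - (\<phi> x * sin (p \<bullet> x)) *\<^sub>R p"
    by (simp only: sum_subtractf p scaleR_sum_right[symmetric] grad_def)
  have "grad (fs p) x = (\<Sum>b\<in>Basis. sin (p \<bullet> x) *\<^sub>R (dpart [b] \<phi> x *\<^sub>R b) + ((p \<bullet> b) * (\<phi> x * cos (p \<bullet> x))) *\<^sub>R b)"
    unfolding grad_def dpart_trial by (simp add: scaleR_left_distrib mult.commute)
  then show "grad (fs p) x = sin (p \<bullet> x) *\<^sub>R grad \<phi> x + (\<phi> x * cos (p \<bullet> x)) *\<^sub>R p"
    by (simp only: sum.distrib p scaleR_sum_right[symmetric] grad_def)
qed

lemma lap_trial:
  "lap (fc p) x = (lap \<phi> x - (norm p)\<^sup>2 * \<phi> x) * cos (p \<bullet> x) - 2 * (p \<bullet> grad \<phi> x) * sin (p \<bullet> x)"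
  "lap (fs p) x = (lap \<phi> x - (norm p)\<^sup>2 * \<phi> x) * sin (p \<bullet> x) + 2 * (p \<bullet> grad \<phi> x) * cos (p \<bullet> x)"
proof -
  have "lap (fc p) x = (\<Sum>b\<in>Basis. dpart [b, b] \<phi> x * cos (p \<bullet> x) - 2 * ((p \<bullet> b) * dpart [b] \<phi> x) * sin (p \<bullet> x)
      - (p \<bullet> b)\<^sup>2 * (\<phi> x * cos (p \<bullet> x)))"
    unfolding lap_def by (intro sum.cong refl dpart2_trial)
  also have "\<dots> = lap \<phi> x * cos (p \<bullet> x) - 2 * (p \<bullet> grad \<phi> x) * sin (p \<bullet> x) - (norm p)\<^sup>2 * (\<phi> x * cos (p \<bullet> x))"
    unfolding sum_subtractf lap_def inner_grad norm_sq_sum sum_distrib_right sum_distrib_left ..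
  finally show "lap (fc p) x = (lap \<phi> x - (norm p)\<^sup>2 * \<phi> x) * cos (p \<bullet> x) - 2 * (p \<bullet> grad \<phi> x) * sin (p \<bullet> x)"
    by (simp add: algebra_simps)
  have "lap (fs p) x = (\<Sum>b\<in>Basis. dpart [b, b] \<phi> x * sin (p \<bullet> x) + 2 * ((p \<bullet> b) * dpart [b] \<phi> x) * cos (p \<bullet> x)
      - (p \<bullet> b)\<^sup>2 * (\<phi> x * sin (p \<bullet> x)))"
    unfolding lap_def by (intro sum.cong refl dpart2_trial)
  also have "\<dots> = lap \<phi> x * sin (p \<bullet> x) + 2 * (p \<bullet> grad \<phi> x) * cos (p \<bullet> x) - (norm p)\<^sup>2 * (\<phi> x * sin (p \<bullet> x))"
    unfolding sum_subtractf sum.distrib lap_def inner_grad norm_sq_sum sum_distrib_right sum_distrib_left ..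
  finally show "lap (fs p) x = (lap \<phi> x - (norm p)\<^sup>2 * \<phi> x) * sin (p \<bullet> x) + 2 * (p \<bullet> grad \<phi> x) * cos (p \<bullet> x)"
    by (simp add: algebra_simps)
qed

text \<open>The reason for using cosine and sine together: the sum of squares does not depend on the
  phase, so the energies of a trial pair contain no oscillating integrals.\<close>

lemma rotate_squares: "(a * cos t - b * sin t)\<^sup>2 + (a * sin t + b * cos t)\<^sup>2 = a\<^sup>2 + (b::real)\<^sup>2"
proof -
  have "(a * c - b * s)\<^sup>2 + (a * s + b * c)\<^sup>2 = (a\<^sup>2 + b\<^sup>2) * (c\<^sup>2 + s\<^sup>2)" for c s :: real
    by (simp add: power2_eq_square algebra_simps)
  from this[of "cos t" "sin t"] show ?thesis by simp
qed

lemma grad_trial_square: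
  "grad (fc p) x \<bullet> grad (fc p) x + grad (fs p) x \<bullet> grad (fs p) x = grad \<phi> x \<bullet> grad \<phi> x + (norm p)\<^sup>2 * (\<phi> x)\<^sup>2"
proof -
  have "(c *\<^sub>R u - (f * s) *\<^sub>R p) \<bullet> (c *\<^sub>R u - (f * s) *\<^sub>R p) + (s *\<^sub>R u + (f * c) *\<^sub>R p) \<bullet> (s *\<^sub>R u + (f * c) *\<^sub>R p)
      = (c\<^sup>2 + s\<^sup>2) * (u \<bullet> u) + (c\<^sup>2 + s\<^sup>2) * (f\<^sup>2 * (p \<bullet> p))" for c s f and u :: 'a
    by (simp add: inner_diff_left inner_diff_right inner_add_left inner_add_right power2_eq_square algebra_simps inner_commute)
  from this[of "cos (p \<bullet> x)" "grad \<phi> x" "\<phi> x" "sin (p \<bullet> x)"] show ?thesis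
    unfolding grad_trial by (simp add: dot_square_norm mult.commute)
qed

lemma lap_trial_square:
  "lap (fc p) x * lap (fc p) x + lap (fs p) x * lap (fs p) x = (lap \<phi> x - (norm p)\<^sup>2 * \<phi> x)\<^sup>2 + 4 * (p \<bullet> grad \<phi> x)\<^sup>2"
  unfolding lap_trial power2_eq_square[symmetric]
  using rotate_squares[of "lap \<phi> x - (norm p)\<^sup>2 * \<phi> x" "p \<bullet> x" "2 * (p \<bullet> grad \<phi> x)"]
  by (simp add: power_mult_distrib)

lemma Cc_trial_data:
  "Cc \<phi>" "Cc (grad \<phi>)" "Cc (lap \<phi>)"
  using test_fun_Cc[OF test] test_fun_grad_Cc[OF test] test_fun_lap_Cc[OF test] .

lemma trial_integrable:
  "integrable lborel (\<lambda>x. (\<phi> x)\<^sup>2)" "integrable lborel (\<lambda>x. grad \<phi> x \<bullet> grad \<phi> x)" "integrable lborel (\<lambda>x. (lap \<phi> x)\<^sup>2)"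
  "integrable lborel (\<lambda>x. \<phi> x * lap \<phi> x)"
  using Cc_integrable[OF Cc_norm_square[OF Cc_trial_data(1)]] Cc_integrable[OF Cc_norm_square[OF Cc_trial_data(2)]]
    Cc_integrable[OF Cc_norm_square[OF Cc_trial_data(3)]]
    Cc_integrable[OF Cc_mult_left[OF Cc_trial_data(1) Cc_continuous[OF Cc_trial_data(3)]]]
  by (simp_all add: dot_square_norm)

lemma test_product_integrable:
  assumes "test_fun \<Omega> f"
  shows "integrable lborel (\<lambda>x. grad f x \<bullet> grad f x)" "integrable lborel (\<lambda>x. lap f x * lap f x)"
  using Cc_integrable[OF Cc_norm_square[OF test_fun_grad_Cc[OF assms]]]
    Cc_integrable[OF Cc_norm_square[OF test_fun_lap_Cc[OF assms]]]
  by (simp_all add: dot_square_norm power2_eq_square)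

lemma formB_trial:
  "formB (jet (fc p)) (jet (fc p)) + formB (jet (fs p)) (jet (fs p)) = k1 + (norm p)\<^sup>2 * m0"
proof -
  have "formB (jet (fc p)) (jet (fc p)) + formB (jet (fs p)) (jet (fs p))
      = (\<integral>x. grad (fc p) x \<bullet> grad (fc p) x + grad (fs p) x \<bullet> grad (fs p) x \<partial>lborel)"
    unfolding jet_forms[OF test_trial(1) test_trial(1)] jet_forms[OF test_trial(2) test_trial(2)]
    using test_product_integrable(1)[OF test_trial(1)] test_product_integrable(1)[OF test_trial(2)] by simp
  also have "\<dots> = k1 + (norm p)\<^sup>2 * m0"
    unfolding grad_trial_square k1_def m0_def using trial_integrable by simp
  finally show ?thesis .
qed

text \<open>The coefficient 6 is 4 + 2: the gradient term 4 (p . grad \<phi>)^2 is bounded by 4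
  |p|^2 |grad \<phi>|^2, and the cross term -2 |p|^2 \<phi> lap \<phi> integrates to 2 |p|^2
  \<open>k1\<close> by Green's identity.\<close>

lemma formA_trial:
  "formA (jet (fc p)) (jet (fc p)) + formA (jet (fs p)) (jet (fs p)) \<le> k2 + 6 * (norm p)\<^sup>2 * k1 + ((norm p)\<^sup>2)\<^sup>2 * m0"
proof -
  have "formA (jet (fc p)) (jet (fc p)) + formA (jet (fs p)) (jet (fs p))
      = (\<integral>x. lap (fc p) x * lap (fc p) x + lap (fs p) x * lap (fs p) x \<partial>lborel)"
    unfolding jet_forms[OF test_trial(1) test_trial(1)] jet_forms[OF test_trial(2) test_trial(2)]
    using test_product_integrable(2)[OF test_trial(1)] test_product_integrable(2)[OF test_trial(2)] by simp
  also have "\<dots> \<le> (\<integral>x. (lap \<phi> x)\<^sup>2 - 2 * (norm p)\<^sup>2 * (\<phi> x * lap \<phi> x) + ((norm p)\<^sup>2)\<^sup>2 * (\<phi> x)\<^sup>2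
      + 4 * (norm p)\<^sup>2 * (grad \<phi> x \<bullet> grad \<phi> x) \<partial>lborel)"
  proof (rule integral_mono)
    show "integrable lborel (\<lambda>x. lap (fc p) x * lap (fc p) x + lap (fs p) x * lap (fs p) x)"
      using test_product_integrable(2)[OF test_trial(1)] test_product_integrable(2)[OF test_trial(2)]
      by (rule Bochner_Integration.integrable_add)
    show "integrable lborel (\<lambda>x. (lap \<phi> x)\<^sup>2 - 2 * (norm p)\<^sup>2 * (\<phi> x * lap \<phi> x) + ((norm p)\<^sup>2)\<^sup>2 * (\<phi> x)\<^sup>2
      + 4 * (norm p)\<^sup>2 * (grad \<phi> x \<bullet> grad \<phi> x))"
      using trial_integrable by simp
    fix x
    have "(p \<bullet> grad \<phi> x)\<^sup>2 \<le> (norm p)\<^sup>2 * (grad \<phi> x \<bullet> grad \<phi> x)"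
      using Cauchy_Schwarz_ineq[of p "grad \<phi> x"] by (simp add: power2_norm_eq_inner)
    then show "lap (fc p) x * lap (fc p) x + lap (fs p) x * lap (fs p) x
      \<le> (lap \<phi> x)\<^sup>2 - 2 * (norm p)\<^sup>2 * (\<phi> x * lap \<phi> x) + ((norm p)\<^sup>2)\<^sup>2 * (\<phi> x)\<^sup>2
      + 4 * (norm p)\<^sup>2 * (grad \<phi> x \<bullet> grad \<phi> x)"
      unfolding lap_trial_square by (simp add: power2_diff power_mult_distrib mult_ac)
  qed
  also have "\<dots> = k2 - 2 * (norm p)\<^sup>2 * (\<integral>x. \<phi> x * lap \<phi> x \<partial>lborel) + ((norm p)\<^sup>2)\<^sup>2 * m0 + 4 * (norm p)\<^sup>2 * k1"
    unfolding k1_def k2_def m0_def using trial_integrable by simp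
  also have "(\<integral>x. \<phi> x * lap \<phi> x \<partial>lborel) = - k1"
    unfolding k1_def using Green_identity[OF test test] by simp
  finally show ?thesis by (simp add: mult_ac add_ac)
qed

lemma energies_nonneg: "0 < m0" "0 \<le> k1" "0 \<le> k2"
  using mass unfolding m0_def k1_def k2_def by (auto intro!: integral_nonneg_AE)

text \<open>The amount by which the quotient may exceed |p|^2. For |p| \<ge> 1, multiplying
  \<open>shift * m0\<close> by |p|^2 supplies 5 |p|^2 \<open>k1\<close> and at least
  \<open>k2\<close>; the sixth |p|^2 \<open>k1\<close> is already in the product of |p|^2 with the
  gradient energy.\<close>

definition shift :: real where "shift = (5 * k1 + k2) / m0"

lemma trial_Rayleigh:
  assumes "1 \<le> norm p"
  defines "Bp \<equiv> formB (jet (fc p)) (jet (fc p)) + formB (jet (fs p)) (jet (fs p))"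
    and "Ap \<equiv> formA (jet (fc p)) (jet (fc p)) + formA (jet (fs p)) (jet (fs p))"
  shows "Ap \<le> ((norm p)\<^sup>2 + shift) * Bp" "(norm p)\<^sup>2 * m0 \<le> Bp" "0 \<le> shift"
proof -
  let ?n = "(norm p)\<^sup>2"
  note e = energies_nonneg
  have n: "1 \<le> ?n" using assms(1) power_mono[of 1 "norm p" 2] by simp
  show s: "0 \<le> shift" unfolding shift_def using e by simp
  have sm: "shift * m0 = 5 * k1 + k2" unfolding shift_def using e(1) by simp
  have "k2 \<le> ?n * k2" using mult_right_mono[OF n e(3)] by simp
  moreover have "0 \<le> shift * k1" using s e by simp
  moreover have "(?n + shift) * (k1 + ?n * m0) = ?n * k1 + ?n\<^sup>2 * m0 + shift * k1 + ?n * (shift * m0)"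
    by (simp add: algebra_simps power2_eq_square)
  ultimately have "k2 + 6 * ?n * k1 + ?n\<^sup>2 * m0 \<le> (?n + shift) * (k1 + ?n * m0)"
    unfolding sm by (simp add: algebra_simps)
  then show "Ap \<le> (?n + shift) * Bp" unfolding Ap_def Bp_def formB_trial using formA_trial[of p] by simp
  show "?n * m0 \<le> Bp" unfolding Bp_def formB_trial using e by simp
qed

section \<open>Fourier coefficients of weak gradients against the trial pairs\<close>

lemma integral_M_cube:
  fixes f :: "'a \<Rightarrow> real"
  assumes "\<And>x. x \<notin> \<Omega> \<Longrightarrow> f x = 0" "\<And>x. x \<notin> cube h \<Longrightarrow> f x = 0"
  shows "integral\<^sup>L M f = integral\<^sup>L (cube_measure h) f" "integrable M f \<longleftrightarrow> integrable (cube_measure h) f"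
proof -
  have "(\<lambda>x. indicator \<Omega> x *\<^sub>R f x) = f" "(\<lambda>x. indicator (cube h) x *\<^sub>R f x) = f"
    using assms by (auto simp: fun_eq_iff indicator_def)
  then show "integral\<^sup>L M f = integral\<^sup>L (cube_measure h) f" "integrable M f \<longleftrightarrow> integrable (cube_measure h) f"
    unfolding integral_restrict_space[OF \<Omega>_lebesgue(2)] integral_restrict_space[OF cube_lebesgue(2)]
      integrable_restrict_space[OF \<Omega>_lebesgue(2)] integrable_restrict_space[OF cube_lebesgue(2)] by simp_all
qed

lemma Bessel_M:
  fixes G :: "'a \<Rightarrow> real"
  assumes h: "0 < h" and P: "finite P" "P \<subseteq> range (rnd h)"
    and G: "G \<in> borel_measurable lebesgue" "L2f M G" "\<And>x. x \<notin> \<Omega> \<Longrightarrow> G x = 0" "\<And>x. x \<notin> cube h \<Longrightarrow> G x = 0"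
  shows "(\<Sum>p\<in>P. (\<integral>x. G x * cos (p \<bullet> x) \<partial>M)\<^sup>2 + (\<integral>x. G x * sin (p \<bullet> x) \<partial>M)\<^sup>2)
     \<le> (2 * pi / h) ^ DIM('a) * l2sq M G"
proof -
  have z: "\<And>x. x \<notin> \<Omega> \<Longrightarrow> (norm (G x))\<^sup>2 = 0" "\<And>x. x \<notin> cube h \<Longrightarrow> (norm (G x))\<^sup>2 = 0"
    "\<And>x p. x \<notin> \<Omega> \<Longrightarrow> G x * cos (p \<bullet> x) = 0" "\<And>x p. x \<notin> cube h \<Longrightarrow> G x * cos (p \<bullet> x) = 0"
    "\<And>x p. x \<notin> \<Omega> \<Longrightarrow> G x * sin (p \<bullet> x) = 0" "\<And>x p. x \<notin> cube h \<Longrightarrow> G x * sin (p \<bullet> x) = 0"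
    using G(3,4) by auto
  have "L2f (cube_measure h) G"
    unfolding L2f_def
  proof
    show "G \<in> borel_measurable (cube_measure h)" by (rule measurable_restrict_space1[OF G(1)])
    show "integrable (cube_measure h) (\<lambda>x. (norm (G x))\<^sup>2)"
      using L2f_integrable[OF G(2)] integral_M_cube(2)[of "\<lambda>x. (norm (G x))\<^sup>2" h, OF z(1,2)] by simp
  qed
  note bes = Bessel_cube[OF h P this]
  have e: "(\<integral>x. (norm (G x))\<^sup>2 \<partial>M) = (\<integral>x. (norm (G x))\<^sup>2 \<partial>cube_measure h)"
    "(\<integral>x. G x * cos (p \<bullet> x) \<partial>M) = (\<integral>x. G x * cos (p \<bullet> x) \<partial>cube_measure h)"
    "(\<integral>x. G x * sin (p \<bullet> x) \<partial>M) = (\<integral>x. G x * sin (p \<bullet> x) \<partial>cube_measure h)" for p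
    by (rule integral_M_cube(1); rule z; assumption)+
  show ?thesis unfolding l2sq_def e by (rule bes[unfolded l2sq_def])
qed

text \<open>Pairing with the gradient of a trial function gives a main part linear in p, with
  Fourier coefficients of \<phi> times the weak gradient of w, and an error from grad \<phi>. After
  division by |p|^2 Cauchy-Schwarz over the coordinates and Bessel bound the main part by the
  gradient energy of w, while the error carries 1/\<rho>^2.\<close>

lemma trial_coefficients:
  assumes h: "0 < h" and P: "finite P" "P \<subseteq> range (rnd h)"
    and supp: "\<And>x. x \<notin> cube h \<Longrightarrow> x \<notin> closure {x. \<phi> x \<noteq> 0}"
    and \<rho>: "0 < \<rho>" "\<And>p. p \<in> P \<Longrightarrow> \<rho> \<le> norm p" and \<eta>: "0 < \<eta>"
    and S: "\<And>x. norm (grad \<phi> x) \<le> S" and w: "w \<in> W20"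
  shows "(\<Sum>p\<in>P. ((formB (jet (fc p)) w)\<^sup>2 + (formB (jet (fs p)) w)\<^sup>2) / (norm p)\<^sup>2)
    \<le> (2 * pi / h) ^ DIM('a) * ((1 + \<eta>) + (1 + 1 / \<eta>) * S\<^sup>2 / \<rho>\<^sup>2) * formB w w"
proof -
  let ?V = "(2 * pi / h) ^ DIM('a)"
  have V: "0 < ?V" using h by simp
  define g where "g = (\<lambda>x. fst (snd (w x)))"
  \<comment> \<open>\<open>G0\<close> collects the derivative falling on \<phi>; \<open>G b\<close>
    below is the b-th component of the cut-off weak gradient, which is multiplied by the component
    of p.\<close>
  define G0 where "G0 = (\<lambda>x. grad \<phi> x \<bullet> g x)"
  define G where "G = (\<lambda>b x. \<phi> x * (g x \<bullet> b))"
  have wm: "w \<in> borel_measurable lebesgue" and wL: "L2f M w" using w by (auto simp: W20_def)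
  have cont: "continuous_on UNIV (\<lambda>p :: real \<times> 'a \<times> real. fst (snd p))" by (intro continuous_intros)
  have gm: "g \<in> borel_measurable lebesgue"
    unfolding g_def by (rule borel_measurable_continuous_on[OF cont wm])
  have gint: "integrable M (\<lambda>x. (norm (g x))\<^sup>2)"
    using L2f_bilinear_integrable[OF bounded_bilinear_forms(2) wL wL] unfolding g_def power2_norm_eq_inner .
  have Bw: "formB w w = (\<integral>x. (norm (g x))\<^sup>2 \<partial>M)" unfolding formB_def g_def power2_norm_eq_inner ..
  have \<phi>m: "\<phi> \<in> borel_measurable lebesgue" "grad \<phi> \<in> borel_measurable lebesgue"
    using Cc_measurable[OF Cc_trial_data(1)] Cc_measurable[OF Cc_trial_data(2)]
    by (intro measurable_completion; simp)+
  have Gm: "G0 \<in> borel_measurable lebesgue" "G b \<in> borel_measurable lebesgue" for b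
    unfolding G0_def G_def using \<phi>m gm by measurable
  have zero\<Omega>: "\<phi> x = 0" "grad \<phi> x = 0" if "x \<notin> \<Omega>" for x
    using test_fun_dpart_outside[OF test that, of "[]"] test_fun_dpart_outside[OF test that]
    by (simp_all add: grad_def del: dpart.simps(2))
  have zeroQ: "\<phi> x = 0" "grad \<phi> x = 0" if "x \<notin> cube h" for x
    using dpart_zero_outside_support[OF supp[OF that], of "[]"] dpart_zero_outside_support[OF supp[OF that]]
    by (simp_all add: grad_def del: dpart.simps(2))
  have sq_le: "(norm (G0 x))\<^sup>2 \<le> S\<^sup>2 * (norm (g x))\<^sup>2" for x
  proof -
    have "\<bar>G0 x\<bar> \<le> norm (grad \<phi> x) * norm (g x)" unfolding G0_def by (rule Cauchy_Schwarz_ineq2)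
    also have "\<dots> \<le> S * norm (g x)" using S by (intro mult_right_mono) auto
    finally have "\<bar>G0 x\<bar>\<^sup>2 \<le> (S * norm (g x))\<^sup>2" by (intro power_mono) auto
    then show ?thesis by (simp add: power_mult_distrib)
  qed
  have \<phi>2: "(\<phi> x)\<^sup>2 \<le> 1" for x using nonneg le_1 by (simp add: power_le_one)
  have GL: "L2f M G0" "b \<in> Basis \<Longrightarrow> L2f M (G b)" for b
  proof -
    show "L2f M G0"
      by (rule L2f_dominated[OF measurable_restrict_space1[OF Gm(1)] integrable_mult_right[OF gint] sq_le])
    assume b: "b \<in> Basis"
    have "(norm (G b x))\<^sup>2 \<le> (norm (g x))\<^sup>2" for x
    proof -
      have "(g x \<bullet> b)\<^sup>2 \<le> (norm (g x))\<^sup>2" using power_mono[OF Basis_le_norm[OF b, of "g x"], of 2] by simp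
      then have "(\<phi> x)\<^sup>2 * (g x \<bullet> b)\<^sup>2 \<le> 1 * (norm (g x))\<^sup>2" using \<phi>2 by (intro mult_mono) auto
      then show ?thesis unfolding G_def by (simp add: power_mult_distrib)
    qed
    then show "L2f M (G b)" by (rule L2f_dominated[OF measurable_restrict_space1[OF Gm(2)] gint])
  qed
  have bounded_trig: "integrable M (\<lambda>x. f x * cos (p \<bullet> x))" "integrable M (\<lambda>x. f x * sin (p \<bullet> x))"
    if "L2f M f" for f and p :: 'a
  proof -
    have one: "integrable M (indicator \<Omega> :: 'a \<Rightarrow> real)"
      using \<Omega>_borel emeasure_lborel_\<Omega> by (intro integrable_M integrable_real_indicator) auto
    have "L2f M (\<lambda>x. cos (p \<bullet> x))" "L2f M (\<lambda>x. sin (p \<bullet> x))"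
      by (rule L2f_dominated[OF borel_measurable_M one]; simp add: indicator_def space_restrict_space abs_square_le_1)+
    then show "integrable M (\<lambda>x. f x * cos (p \<bullet> x))" "integrable M (\<lambda>x. f x * sin (p \<bullet> x))"
      using L2f_bilinear_integrable[OF bounded_bilinear_mult that] by auto
  qed
  define C where "C = (\<lambda>f p. \<integral>x. f x * cos (p \<bullet> x) \<partial>M)"
  define T where "T = (\<lambda>f p. \<integral>x. f x * sin (p \<bullet> x) \<partial>M)"
  have gx: "fst (snd (w x)) = g x" for x by (simp add: g_def)
  have rep: "p \<bullet> g x = (\<Sum>b\<in>Basis. (p \<bullet> b) * (g x \<bullet> b))" for p x by (rule euclidean_inner)
  have Bc: "formB (jet (fc p)) w = C G0 p + - (\<Sum>b\<in>Basis. (p \<bullet> b) * T (G b) p)" for p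
  proof -
    have "formB (jet (fc p)) w = (\<integral>x. G0 x * cos (p \<bullet> x) - (\<Sum>b\<in>Basis. (p \<bullet> b) * (G b x * sin (p \<bullet> x))) \<partial>M)"
      unfolding formB_def jet_def fst_conv snd_conv grad_trial gx
      by (intro Bochner_Integration.integral_cong refl)
         (simp add: inner_diff_left G0_def G_def rep[of p] sum_distrib_left mult_ac)
    also have "\<dots> = C G0 p - (\<Sum>b\<in>Basis. (p \<bullet> b) * T (G b) p)"
      unfolding C_def T_def using bounded_trig[OF GL(1)] bounded_trig[OF GL(2)]
      by (subst Bochner_Integration.integral_diff) (auto simp: Bochner_Integration.integral_sum)
    finally show ?thesis by simp
  qed
  have Bs: "formB (jet (fs p)) w = T G0 p + (\<Sum>b\<in>Basis. (p \<bullet> b) * C (G b) p)" for p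
  proof -
    have "formB (jet (fs p)) w = (\<integral>x. G0 x * sin (p \<bullet> x) + (\<Sum>b\<in>Basis. (p \<bullet> b) * (G b x * cos (p \<bullet> x))) \<partial>M)"
      unfolding formB_def jet_def fst_conv snd_conv grad_trial gx
      by (intro Bochner_Integration.integral_cong refl)
         (simp add: inner_add_left G0_def G_def rep[of p] sum_distrib_left mult_ac)
    also have "\<dots> = T G0 p + (\<Sum>b\<in>Basis. (p \<bullet> b) * C (G b) p)"
      unfolding C_def T_def using bounded_trig[OF GL(1)] bounded_trig[OF GL(2)]
      by (subst Bochner_Integration.integral_add) (auto simp: Bochner_Integration.integral_sum)
    finally show ?thesis .
  qed
  let ?L = "\<lambda>p. (C G0 p)\<^sup>2 + (T G0 p)\<^sup>2" and ?E = "\<lambda>p. \<Sum>b\<in>Basis. (C (G b) p)\<^sup>2 + (T (G b) p)\<^sup>2"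
  \<comment> \<open>The large weight 1 + 1/\<eta> goes to the error, which gains from |p| \<ge>
    \<rho>, and 1 + \<eta> to the main part.\<close>
  have key: "((formB (jet (fc p)) w)\<^sup>2 + (formB (jet (fs p)) w)\<^sup>2) / (norm p)\<^sup>2
      \<le> (1 + 1 / \<eta>) / \<rho>\<^sup>2 * ?L p + (1 + \<eta>) * ?E p" if p: "p \<in> P" for p
  proof -
    let ?n = "(norm p)\<^sup>2"
    have n: "0 < ?n" "\<rho>\<^sup>2 \<le> ?n" using \<rho>(1) \<rho>(2)[OF p] by (auto intro: power_mono)
    have cs: "(\<Sum>b\<in>Basis. (p \<bullet> b) * y b)\<^sup>2 \<le> ?n * (\<Sum>b\<in>Basis. (y b)\<^sup>2)" for y
      unfolding norm_sq_sum by (rule Cauchy_Schwarz_ineq_sum)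
    have "(formB (jet (fc p)) w)\<^sup>2 + (formB (jet (fs p)) w)\<^sup>2
      \<le> ((1 + 1 / \<eta>) * (C G0 p)\<^sup>2 + (1 + \<eta>) * (- (\<Sum>b\<in>Basis. (p \<bullet> b) * T (G b) p))\<^sup>2)
       + ((1 + 1 / \<eta>) * (T G0 p)\<^sup>2 + (1 + \<eta>) * (\<Sum>b\<in>Basis. (p \<bullet> b) * C (G b) p)\<^sup>2)"
      unfolding Bc Bs by (intro add_mono square_add_le_weighted \<eta>)
    also have "\<dots> \<le> ((1 + 1 / \<eta>) * (C G0 p)\<^sup>2 + (1 + \<eta>) * (?n * (\<Sum>b\<in>Basis. (T (G b) p)\<^sup>2)))
       + ((1 + 1 / \<eta>) * (T G0 p)\<^sup>2 + (1 + \<eta>) * (?n * (\<Sum>b\<in>Basis. (C (G b) p)\<^sup>2)))"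
      using cs \<eta> by (intro add_mono mult_left_mono order_refl) auto
    also have "\<dots> = (1 + 1 / \<eta>) * ?L p + (1 + \<eta>) * (?n * ?E p)"
    proof -
      have "(a * X + b * (n * A)) + (a * Y + b * (n * B)) = a * (X + Y) + b * (n * (B + A))" for a b n A B X Y :: real
        by (simp add: algebra_simps)
      then show ?thesis unfolding sum.distrib .
    qed
    finally have "((formB (jet (fc p)) w)\<^sup>2 + (formB (jet (fs p)) w)\<^sup>2) / ?n
      \<le> ((1 + 1 / \<eta>) * ?L p + (1 + \<eta>) * (?n * ?E p)) / ?n" using n by (intro divide_right_mono) auto
    also have "\<dots> = (1 + 1 / \<eta>) * ?L p / ?n + (1 + \<eta>) * ?E p" using n(1) by (simp add: add_divide_distrib)
    also have "(1 + 1 / \<eta>) * ?L p / ?n \<le> (1 + 1 / \<eta>) * ?L p / \<rho>\<^sup>2"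
      using n \<rho>(1) \<eta> by (intro divide_left_mono mult_nonneg_nonneg) auto
    finally show ?thesis by simp
  qed
  have b0: "(\<Sum>p\<in>P. ?L p) \<le> ?V * (S\<^sup>2 * formB w w)"
  proof -
    have "(\<Sum>p\<in>P. ?L p) \<le> ?V * l2sq M G0"
      unfolding C_def T_def by (rule Bessel_M[OF h P Gm(1) GL(1)]) (simp_all add: G0_def zero\<Omega> zeroQ)
    also have "l2sq M G0 \<le> (\<integral>x. S\<^sup>2 * (norm (g x))\<^sup>2 \<partial>M)"
      unfolding l2sq_def by (intro integral_mono L2f_integrable GL integrable_mult_right gint sq_le)
    also have "\<dots> = S\<^sup>2 * formB w w" unfolding Bw by simp
    finally show ?thesis using V by simp
  qed
  \<comment> \<open>Bessel is applied to each component separately; the sum over components of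
    |\<open>G b\<close>|^2 is \<phi>^2 |g|^2 \<le> |g|^2, so no factor of the dimension is
    lost.\<close>
  have b1: "(\<Sum>p\<in>P. ?E p) \<le> ?V * formB w w"
  proof -
    have "(\<Sum>p\<in>P. ?E p) = (\<Sum>b\<in>Basis. \<Sum>p\<in>P. (C (G b) p)\<^sup>2 + (T (G b) p)\<^sup>2)" by (rule sum.swap)
    also have "\<dots> \<le> (\<Sum>b\<in>Basis. ?V * l2sq M (G b))"
      unfolding C_def T_def
      by (intro sum_mono Bessel_M[OF h P Gm(2) GL(2)]) (simp_all add: G_def zero\<Omega> zeroQ)
    also have "\<dots> = ?V * (\<integral>x. (\<Sum>b\<in>Basis. (norm (G b x))\<^sup>2) \<partial>M)"
      unfolding l2sq_def sum_distrib_left[symmetric] using L2f_integrable[OF GL(2)]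
      by (subst Bochner_Integration.integral_sum) auto
    also have "(\<integral>x. (\<Sum>b\<in>Basis. (norm (G b x))\<^sup>2) \<partial>M) \<le> (\<integral>x. (norm (g x))\<^sup>2 \<partial>M)"
    proof (rule integral_mono)
      show "integrable M (\<lambda>x. \<Sum>b\<in>Basis. (norm (G b x))\<^sup>2)" using L2f_integrable[OF GL(2)] by simp
      show "(\<Sum>b\<in>Basis. (norm (G b x))\<^sup>2) \<le> (norm (g x))\<^sup>2" for x
      proof -
        have "(\<Sum>b\<in>Basis. (norm (G b x))\<^sup>2) = (\<phi> x)\<^sup>2 * (norm (g x))\<^sup>2"
          unfolding G_def norm_sq_sum by (simp add: power_mult_distrib sum_distrib_left)
        also have "\<dots> \<le> 1 * (norm (g x))\<^sup>2" using \<phi>2 by (intro mult_right_mono) auto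
        finally show ?thesis by simp
      qed
    qed (rule gint)
    finally show ?thesis unfolding Bw using V by simp
  qed
  have "(\<Sum>p\<in>P. ((formB (jet (fc p)) w)\<^sup>2 + (formB (jet (fs p)) w)\<^sup>2) / (norm p)\<^sup>2)
      \<le> (\<Sum>p\<in>P. (1 + 1 / \<eta>) / \<rho>\<^sup>2 * ?L p + (1 + \<eta>) * ?E p)" by (intro sum_mono key)
  also have "\<dots> = (1 + 1 / \<eta>) / \<rho>\<^sup>2 * (\<Sum>p\<in>P. ?L p) + (1 + \<eta>) * (\<Sum>p\<in>P. ?E p)"
    unfolding sum_distrib_left by (rule sum.distrib)
  also have "\<dots> \<le> (1 + 1 / \<eta>) / \<rho>\<^sup>2 * (?V * (S\<^sup>2 * formB w w)) + (1 + \<eta>) * (?V * formB w w)"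
    by (rule add_mono[OF mult_left_mono[OF b0] mult_left_mono[OF b1]]) (use \<eta> in simp_all)
  also have "\<dots> = ?V * ((1 + \<eta>) + (1 + 1 / \<eta>) * S\<^sup>2 / \<rho>\<^sup>2) * formB w w"
  proof -
    have "a / r * (V * (s * B)) + b * (V * B) = V * (b + a * s / r) * B" for a b r s V B :: real
      by (simp add: algebra_simps)
    then show ?thesis .
  qed
  finally show ?thesis .
qed

text \<open>Averaged variational principle: the trial functions \<open>\<phi> cos (p \<bullet> x)\<close>, \<open>\<phi> sin (p \<bullet> x)\<close> are expanded in
  the eigenfunctions, and \<open>(z - \<sigma>)\<^sup>2 \<ge> 2 t (z - \<sigma>) - t\<^sup>2\<close> is used with \<open>t = z - shift - \<bar>p\<bar>\<^sup>2\<close>.\<close>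
lemma R2_lattice_lower_bound:
  fixes P :: "'a set"
  assumes h: "0 < h" and P: "finite P" "P \<subseteq> range (rnd h)"
    and supp: "\<And>x. x \<notin> cube h \<Longrightarrow> x \<notin> closure {x. \<phi> x \<noteq> 0}"
    and \<rho>: "1 \<le> \<rho>" "\<And>p. p \<in> P \<Longrightarrow> \<rho> \<le> norm p" and \<eta>: "0 < \<eta>"
    and S: "\<And>x. norm (grad \<phi> x) \<le> S"
    and z: "0 < z" "\<And>p. p \<in> P \<Longrightarrow> (norm p)\<^sup>2 \<le> z - shift"
  shows "m0 * (\<Sum>p\<in>P. (z - shift - (norm p)\<^sup>2)\<^sup>2)
    \<le> (2 * pi / h) ^ DIM('a) * ((1 + \<eta>) + (1 + 1 / \<eta>) * S\<^sup>2 / \<rho>\<^sup>2) * R2 \<Omega> z"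
proof -
  let ?D = "(2 * pi / h) ^ DIM('a) * ((1 + \<eta>) + (1 + 1 / \<eta>) * S\<^sup>2 / \<rho>\<^sup>2)"
  obtain n e s where ef: "pair.eigen_family z n e s"
    and low: "\<And>w. w \<in> W20 \<Longrightarrow> z * formB w w - formA w w \<le> (\<Sum>i<n. (z - s i) * (formB w (e i))\<^sup>2)"
    and bes: "\<And>w. w \<in> W20 \<Longrightarrow> (\<Sum>i<n. (formB w (e i))\<^sup>2) \<le> formB w w"
  proof -
    have "\<exists>n e s. pair.eigen_family z n e s \<and>
        (\<forall>w\<in>W20. z * formB w w - formA w w \<le> (\<Sum>i<n. (z - s i) * (formB w (e i))\<^sup>2)) \<and>
        (\<forall>w\<in>W20. (\<Sum>i<n. (formB w (e i))\<^sup>2) \<le> formB w w)"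
      by (rule pair.maximal_eigen_family[OF z(1)]) blast
    then show thesis using that by (elim exE conjE) blast
  qed
  define c where "c = (\<lambda>p i. (formB (jet (fc p)) (e i))\<^sup>2 + (formB (jet (fs p)) (e i))\<^sup>2)"
  have c0: "0 \<le> c p i" for p :: 'a and i unfolding c_def by simp
  have eW: "e i \<in> W20" "formB (e i) (e i) = 1" if "i < n" for i
    using ef that unfolding pair.eigen_family_def by auto
  have key: "m0 * (z - shift - (norm p)\<^sup>2)\<^sup>2 \<le> (\<Sum>i<n. (z - s i)\<^sup>2 * (c p i / (norm p)\<^sup>2))" if p: "p \<in> P" for p :: 'a
  proof -
    define t where "t = z - shift - (norm p)\<^sup>2"
    have t: "0 \<le> t" unfolding t_def using z(2)[OF p] by simp
    have np: "1 \<le> norm p" using \<rho>(1) \<rho>(2)[OF p] by simp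
    define Bp where "Bp = formB (jet (fc p)) (jet (fc p)) + formB (jet (fs p)) (jet (fs p))"
    define Ap where "Ap = formA (jet (fc p)) (jet (fc p)) + formA (jet (fs p)) (jet (fs p))"
    note ray = trial_Rayleigh[OF np, folded Bp_def Ap_def]
    note W = jet_in_W20[OF test_trial(1)[of p]] jet_in_W20[OF test_trial(2)[of p]]
    have "z * Bp - Ap \<le> (\<Sum>i<n. (z - s i) * c p i)"
      using add_mono[OF low[OF W(1)] low[OF W(2)]]
      unfolding Bp_def Ap_def c_def distrib_left sum.distrib by simp
    moreover have "t * Bp \<le> z * Bp - Ap" using ray(1) unfolding t_def by (simp add: algebra_simps)
    ultimately have l1: "t * Bp \<le> (\<Sum>i<n. (z - s i) * c p i)" by linarith
    have l2: "(\<Sum>i<n. c p i) \<le> Bp"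
      using add_mono[OF bes[OF W(1)] bes[OF W(2)]] unfolding Bp_def c_def sum.distrib .
    \<comment> \<open>Writing t^2 as 2t t - t^2 lets the spectral bound \<open>l1\<close> enter with
      the factor 2t \<ge> 0 and the Bessel bound \<open>l2\<close> with -t^2, so each is used in the
      direction in which it holds.\<close>
    have "t\<^sup>2 * Bp = 2 * t * (t * Bp) - t\<^sup>2 * Bp" by (simp add: power2_eq_square)
    also have "\<dots> \<le> 2 * t * (\<Sum>i<n. (z - s i) * c p i) - t\<^sup>2 * (\<Sum>i<n. c p i)"
      using l1 l2 t by (intro diff_mono mult_left_mono) auto
    also have "\<dots> = (\<Sum>i<n. (2 * t * (z - s i) - t\<^sup>2) * c p i)"
      unfolding sum_distrib_left sum_subtractf[symmetric] by (intro sum.cong refl) (simp add: algebra_simps)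
    also have "\<dots> \<le> (\<Sum>i<n. (z - s i)\<^sup>2 * c p i)"
    proof (intro sum_mono mult_right_mono c0)
      show "2 * t * (z - s i) - t\<^sup>2 \<le> (z - s i)\<^sup>2" for i
        using sum_squares_bound[of t "z - s i"] by simp
    qed
    finally have "t\<^sup>2 * Bp \<le> (\<Sum>i<n. (z - s i)\<^sup>2 * c p i)" .
    moreover have "t\<^sup>2 * ((norm p)\<^sup>2 * m0) \<le> t\<^sup>2 * Bp" using ray(2) by (intro mult_left_mono) auto
    ultimately have "t\<^sup>2 * ((norm p)\<^sup>2 * m0) / (norm p)\<^sup>2 \<le> (\<Sum>i<n. (z - s i)\<^sup>2 * c p i) / (norm p)\<^sup>2"
      by (intro divide_right_mono) auto
    moreover have "t\<^sup>2 * ((norm p)\<^sup>2 * m0) / (norm p)\<^sup>2 = m0 * t\<^sup>2" using np by (auto simp: field_simps)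
    ultimately show ?thesis unfolding t_def[symmetric] by (simp add: sum_divide_distrib)
  qed
  have "m0 * (\<Sum>p\<in>P. (z - shift - (norm p)\<^sup>2)\<^sup>2) \<le> (\<Sum>p\<in>P. \<Sum>i<n. (z - s i)\<^sup>2 * (c p i / (norm p)\<^sup>2))"
    unfolding sum_distrib_left by (intro sum_mono key)
  also have "\<dots> = (\<Sum>i<n. (z - s i)\<^sup>2 * (\<Sum>p\<in>P. c p i / (norm p)\<^sup>2))"
    unfolding sum_distrib_left by (rule sum.swap)
  \<comment> \<open>After interchanging the sums, the total weight of one eigenfunction is bounded
    by \<open>?D\<close> because B(e_i,e_i) = 1.\<close>
  also have "\<dots> \<le> (\<Sum>i<n. (z - s i)\<^sup>2 * ?D)"
  proof (intro sum_mono mult_left_mono)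
    fix i assume "i \<in> {..<n}"
    then have i: "i < n" by simp
    show "(\<Sum>p\<in>P. c p i / (norm p)\<^sup>2) \<le> ?D"
      using trial_coefficients[OF h P supp _ \<rho>(2) \<eta> S eW(1)[OF i]] \<rho>(1) eW(2)[OF i] unfolding c_def by simp
  qed simp
  also have "\<dots> = ?D * (\<Sum>i<n. (z - s i)\<^sup>2)" by (simp add: sum_distrib_right mult.commute)
  also have "\<dots> \<le> ?D * R2 \<Omega> z"
    using h \<eta> by (intro mult_left_mono R2_ge_eigen_family[OF z(1) ef]) auto
  finally show ?thesis .
qed

end

section \<open>Lattice sums and the leading asymptotics\<close>

text \<open>Layer-cake integration over the radius, which keeps all powers of \<open>r\<close> integral.\<close>
lemma integral_truncated_paraboloid:
  fixes w \<alpha> :: real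
  assumes w: "0 < w" and \<alpha>: "0 < \<alpha>"
  defines "F \<equiv> \<lambda>x::'a::euclidean_space. (max 0 (w - \<alpha> * (norm x)\<^sup>2))\<^sup>2"
  shows "integrable lborel F"
    "(\<integral>x. F x \<partial>lborel) = 8 / ((real DIM('a) + 2) * (real DIM('a) + 4)) * unit_ball_vol (real DIM('a)) * w\<^sup>2 * sqrt (w / \<alpha>) ^ DIM('a)"
proof -
  define R where "R = sqrt (w / \<alpha>)"
  have R: "0 < R" "\<alpha> * R\<^sup>2 = w" unfolding R_def using w \<alpha> by auto
  let ?v = "unit_ball_vol (real DIM('a))" and ?d = "DIM('a)"
  have beyond: "w \<le> \<alpha> * r\<^sup>2" if "R \<le> r" for r
    unfolding R(2)[symmetric] using that R(1) \<alpha> by (intro mult_left_mono power_mono) auto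
  have below: "\<alpha> * r\<^sup>2 \<le> w" if "0 \<le> r" "r \<le> R" for r
    unfolding R(2)[symmetric] using that \<alpha> by (intro mult_left_mono power_mono) auto
  have "continuous_on UNIV F" unfolding F_def by (intro continuous_intros)
  moreover have "F x = 0" if "R < norm x" for x
    unfolding F_def using beyond[of "norm x"] that by simp
  ultimately have CF: "Cc F" unfolding Cc_def by blast
  show int: "integrable lborel F" by (rule Cc_integrable[OF CF])
  \<comment> \<open>\<open>f\<close> is the derivative in r of -(w - \<alpha> r^2)^2, so integrating
    it from |x| to R recovers \<open>F x\<close>.\<close>
  define f where "f = (\<lambda>r. 4 * \<alpha> * r * (w - \<alpha> * r\<^sup>2))"
  have fm: "f \<in> borel_measurable borel" unfolding f_def by measurable
  have f0: "0 \<le> f r" if "0 \<le> r" "r \<le> R" for r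
    unfolding f_def using that below[OF that] \<alpha> by simp
  have layer: "ennreal (F x) = (\<integral>\<^sup>+r. ennreal (f r) * indicator {norm x..R} r \<partial>lborel)" for x
  proof (cases "norm x \<le> R")
    case True
    have "(\<integral>\<^sup>+r. ennreal (f r) * indicator {norm x..R} r \<partial>lborel)
        = (- (w - \<alpha> * R\<^sup>2)\<^sup>2) - (- (w - \<alpha> * (norm x)\<^sup>2)\<^sup>2)"
    proof (rule nn_integral_FTC_Icc[OF fm _ _ True])
      fix r assume r: "r \<in> {norm x..R}"
      show "((\<lambda>r. - (w - \<alpha> * r\<^sup>2)\<^sup>2) has_real_derivative f r) (at r)"
        unfolding f_def by (auto intro!: derivative_eq_intros simp: power2_eq_square algebra_simps)
      show "0 \<le> f r" using r order_trans[OF norm_ge_zero[of x], of r] by (intro f0) auto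
    qed
    also have "(- (w - \<alpha> * R\<^sup>2)\<^sup>2) - (- (w - \<alpha> * (norm x)\<^sup>2)\<^sup>2) = F x"
      unfolding F_def R(2) using below[OF norm_ge_zero True] by simp
    finally show ?thesis by simp
  next
    case False
    then show ?thesis unfolding F_def using beyond[of "norm x"] by (simp add: max_def)
  qed
  have m: "(\<lambda>(x :: 'a, r :: real). ennreal (f r) * indicator {q. norm (fst q) \<le> snd q \<and> snd q \<le> R} (x, r))
      \<in> borel_measurable (lborel \<Otimes>\<^sub>M lborel)"
    using fm by measurable
  have "(\<integral>\<^sup>+(x::'a). ennreal (F x) \<partial>lborel)
      = (\<integral>\<^sup>+(x::'a). (\<integral>\<^sup>+r. ennreal (f r) * indicator {q. norm (fst q) \<le> snd q \<and> snd q \<le> R} (x, r) \<partial>lborel) \<partial>lborel)"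
    unfolding layer by (intro nn_integral_cong) (simp add: indicator_def)
  also have "\<dots> = (\<integral>\<^sup>+r. (\<integral>\<^sup>+(x::'a). ennreal (f r) * indicator {q. norm (fst q) \<le> snd q \<and> snd q \<le> R} (x, r) \<partial>lborel) \<partial>lborel)"
    by (rule lborel_pair.Fubini'[OF m, symmetric])
  also have "\<dots> = (\<integral>\<^sup>+r. ennreal (f r * (?v * r ^ ?d)) * indicator {0..R} r \<partial>lborel)"
  proof (rule nn_integral_cong)
    fix r :: real
    show "(\<integral>\<^sup>+(x::'a). ennreal (f r) * indicator {q. norm (fst q) \<le> snd q \<and> snd q \<le> R} (x, r) \<partial>lborel)
      = ennreal (f r * (?v * r ^ ?d)) * indicator {0..R} r"
    proof (cases "r \<in> {0..R}")
      case True
      then have r: "0 \<le> r" "r \<le> R" by auto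
      have "(\<integral>\<^sup>+(x::'a). ennreal (f r) * indicator {q. norm (fst q) \<le> snd q \<and> snd q \<le> R} (x, r) \<partial>lborel)
          = (\<integral>\<^sup>+(x::'a). ennreal (f r) * indicator (cball 0 r) x \<partial>lborel)"
        using r by (intro nn_integral_cong) (simp add: indicator_def)
      also have "\<dots> = ennreal (f r) * ennreal (?v * r ^ ?d)"
        by (subst nn_integral_cmult_indicator) (simp_all add: emeasure_cball[OF r(1)])
      also have "\<dots> = ennreal (f r * (?v * r ^ ?d))"
        using f0[OF r] r by (intro ennreal_mult[symmetric]) auto
      finally show ?thesis using True by simp
    next
      case False
      have "indicator {q. norm (fst q) \<le> snd q \<and> snd q \<le> R} (x, r) = (0::ennreal)" for x :: 'a
        using False order_trans[OF norm_ge_zero[of x], of r] by (auto simp: indicator_def)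
      moreover have "indicator {0..R} r = (0::ennreal)" using False by (rule indicator_simps(2))
      ultimately show ?thesis by (simp only: mult_zero_right nn_integral_const mult_zero_left)
    qed
  qed
  also have "\<dots> = 4 * \<alpha> * ?v * (w * R ^ (?d + 2) / (?d + 2) - \<alpha> * R ^ (?d + 4) / (?d + 4))
      - 4 * \<alpha> * ?v * (w * 0 ^ (?d + 2) / (?d + 2) - \<alpha> * 0 ^ (?d + 4) / (?d + 4))"
  proof (rule nn_integral_FTC_Icc)
    show "(\<lambda>r. f r * (?v * r ^ ?d)) \<in> borel_measurable borel" using fm by measurable
    fix r assume r: "r \<in> {0..R}"
    have pw: "((\<lambda>r. r ^ (?d + k) / real (?d + k)) has_real_derivative r ^ (?d + k - 1)) (at r)" for k
    proof -
      have "real (?d + k) \<noteq> 0" by (simp del: of_nat_add)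
      from DERIV_cdivide[OF DERIV_pow[of "?d + k" r UNIV], of "real (?d + k)"]
      show ?thesis unfolding nonzero_mult_div_cancel_left[OF \<open>real (?d + k) \<noteq> 0\<close>] One_nat_def .
    qed
    have "((\<lambda>r. 4 * \<alpha> * ?v * (w * (r ^ (?d + 2) / real (?d + 2)) - \<alpha> * (r ^ (?d + 4) / real (?d + 4))))
        has_real_derivative 4 * \<alpha> * ?v * (w * r ^ (?d + 2 - 1) - \<alpha> * r ^ (?d + 4 - 1))) (at r)"
      by (intro DERIV_cmult DERIV_diff pw)
    moreover have "4 * \<alpha> * ?v * (w * r ^ (?d + 2 - 1) - \<alpha> * r ^ (?d + 4 - 1)) = f r * (?v * r ^ ?d)"
      unfolding f_def by (simp add: algebra_simps power_add numeral_3_eq_3 power2_eq_square)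
    ultimately show "((\<lambda>r. 4 * \<alpha> * ?v * (w * r ^ (?d + 2) / (?d + 2) - \<alpha> * r ^ (?d + 4) / (?d + 4)))
        has_real_derivative f r * (?v * r ^ ?d)) (at r)" by (simp only: times_divide_eq_right)
    show "0 \<le> f r * (?v * r ^ ?d)" using f0[of r] r by simp
  qed (use R in simp)
  also have "4 * \<alpha> * ?v * (w * R ^ (?d + 2) / (?d + 2) - \<alpha> * R ^ (?d + 4) / (?d + 4))
      - 4 * \<alpha> * ?v * (w * 0 ^ (?d + 2) / (?d + 2) - \<alpha> * 0 ^ (?d + 4) / (?d + 4))
      = 8 / ((real ?d + 2) * (real ?d + 4)) * ?v * w\<^sup>2 * R ^ ?d"
  proof -
    have R24: "\<alpha> * R ^ (?d + 2) = w * R ^ ?d" "\<alpha> * (\<alpha> * R ^ (?d + 4)) = w\<^sup>2 * R ^ ?d"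
    proof -
      show "\<alpha> * R ^ (?d + 2) = w * R ^ ?d" unfolding R(2)[symmetric] by (simp add: power_add power2_eq_square mult_ac)
      have "R ^ (?d + 4) = R ^ ?d * (R\<^sup>2)\<^sup>2" unfolding power_mult[symmetric] by (simp add: power_add)
      then show "\<alpha> * (\<alpha> * R ^ (?d + 4)) = w\<^sup>2 * R ^ ?d"
        unfolding R(2)[symmetric] by (simp add: power2_eq_square mult_ac)
    qed
    have "4 * \<alpha> * v * (w * A / a - \<alpha> * B / b) = 4 * v * (w * (\<alpha> * A) / a - (\<alpha> * (\<alpha> * B)) / b)" for A B a b v :: real
      by (simp add: algebra_simps)
    then have "4 * \<alpha> * ?v * (w * R ^ (?d + 2) / (?d + 2) - \<alpha> * R ^ (?d + 4) / (?d + 4))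
        = 4 * ?v * (w * (w * R ^ ?d) / (?d + 2) - w\<^sup>2 * R ^ ?d / (?d + 4))"
      unfolding R24[symmetric] .
    \<comment> \<open>The dimensional constant of the theorem arises here, as 4 (1/(d+2) - 1/(d+4))
      = 8/((d+2)(d+4)).\<close>
    also have "\<dots> = 8 / ((real ?d + 2) * (real ?d + 4)) * ?v * w\<^sup>2 * R ^ ?d"
      by (simp add: field_simps power2_eq_square)
    finally show ?thesis by simp
  qed
  finally have nn: "(\<integral>\<^sup>+(x::'a). ennreal (F x) \<partial>lborel) = ennreal (8 / ((real ?d + 2) * (real ?d + 4)) * ?v * w\<^sup>2 * R ^ ?d)" .
  have "(\<integral>\<^sup>+(x::'a). ennreal (F x) \<partial>lborel) = ennreal (\<integral>x. F x \<partial>lborel)"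
    using int by (intro nn_integral_eq_integral) (auto simp: F_def)
  then have "ennreal (\<integral>x. F x \<partial>lborel) = ennreal (8 / ((real ?d + 2) * (real ?d + 4)) * ?v * w\<^sup>2 * R ^ ?d)"
    using nn by simp
  then show "(\<integral>x. F x \<partial>lborel) = 8 / ((real DIM('a) + 2) * (real DIM('a) + 4)) * unit_ball_vol (real DIM('a)) * w\<^sup>2 * sqrt (w / \<alpha>) ^ DIM('a)"
    unfolding R_def[symmetric] using R(1)
    by (subst (asm) ennreal_inj) (auto intro!: integral_nonneg_AE mult_nonneg_nonneg divide_nonneg_nonneg simp: F_def)
qed

text \<open>Each lattice point stands for its cell. Rounding x to p moves it by at most \<delta>, so
  |p|^2 \<le> (1 + 1/\<eta>) \<delta>^2 + (1 + \<eta>) |x|^2 and a slightly steeper and lower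
  paraboloid stays below the step function. The subtracted ball accounts for the omitted frequencies
  |p| < \<rho>.\<close>

lemma lattice_sum_lower_bound:
  fixes h \<rho> \<eta> z c0 :: real
  assumes h: "0 < h" and \<eta>: "0 < \<eta>"
  defines "\<delta> \<equiv> real DIM('a::euclidean_space) * h"
  defines "w \<equiv> z - (1 + 1 / \<eta>) * \<delta>\<^sup>2"
  defines "P \<equiv> {p \<in> range (rnd h :: 'a \<Rightarrow> 'a). \<rho> \<le> norm p \<and> (norm p)\<^sup>2 \<le> z}"
  assumes w: "0 < w"
  shows "finite P"
    "8 / ((real DIM('a) + 2) * (real DIM('a) + 4)) * unit_ball_vol (real DIM('a)) * w\<^sup>2 * sqrt (w / (1 + \<eta>)) ^ DIM('a)
       - w\<^sup>2 * measure lborel (cball (0::'a) (\<rho> + \<delta>)) \<le> h ^ DIM('a) * (\<Sum>p\<in>P. (z - (norm p)\<^sup>2)\<^sup>2)"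
proof -
  have \<delta>: "0 \<le> \<delta>" unfolding \<delta>_def using h by simp
  have dist_le: "norm (x - rnd h x) \<le> \<delta>" for x :: 'a unfolding \<delta>_def by (rule norm_diff_rnd[OF h])
  have cellm: "emeasure lborel (cell h p) = ennreal (h ^ DIM('a))" "measure lborel (cell h p) = h ^ DIM('a)" if "p \<in> P" for p
    using that emeasure_cell[OF h] measure_cell[OF h] unfolding P_def by auto
  define B where "B = cball (0::'a) (sqrt z + \<delta>)"
  have Bf: "B \<in> sets borel" "emeasure lborel B < \<infinity>" 
    unfolding B_def using emeasure_lborel_cball_finite[of "0::'a" "sqrt z + \<delta>"] by simp_all
  have cellB: "cell h p \<subseteq> B" if "p \<in> P" for p
  proof
    fix x assume "x \<in> cell h p"
    then have "rnd h x = p" by (simp add: cell_def)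
    then have "norm x \<le> norm p + \<delta>" using dist_le[of x] norm_triangle_sub[of x p] by simp
    moreover have "norm p \<le> sqrt z" using that unfolding P_def by (auto intro: real_le_rsqrt)
    ultimately show "x \<in> B" unfolding B_def by simp
  qed
  \<comment> \<open>Finiteness by volume: the cells of points of \<open>P\<close> lie in one ball
    and each fills its full volume there.\<close>
  have "P \<subseteq> {q \<in> range (rnd h). h ^ DIM('a) \<le> measure lborel (B \<inter> cell h q)}"
  proof
    fix p assume p: "p \<in> P"
    have "B \<inter> cell h p = cell h p" using cellB[OF p] by blast
    then show "p \<in> {q \<in> range (rnd h). h ^ DIM('a) \<le> measure lborel (B \<inter> cell h q)}"
      using cellm(2)[OF p] p unfolding P_def by simp
  qed
  then show fin: "finite P" by (rule finite_subset) (rule finite_heavy_cells[OF Bf], use h in simp)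
  define F where "F = (\<lambda>x::'a. (max 0 (w - (1 + \<eta>) * (norm x)\<^sup>2))\<^sup>2)"
  have \<eta>1: "0 < 1 + \<eta>" using \<eta> by simp
  note tp = integral_truncated_paraboloid[OF w \<eta>1, where 'a = 'a, folded F_def]
  have pt: "F x \<le> w\<^sup>2 * indicator (cball 0 (\<rho> + \<delta>)) x + (\<Sum>p\<in>P. indicator (cell h p) x * (z - (norm p)\<^sup>2)\<^sup>2)" for x
  proof -
    have sum_nn: "0 \<le> (\<Sum>p\<in>P. indicator (cell h p) x * (z - (norm p)\<^sup>2)\<^sup>2)" by (intro sum_nonneg) auto
    show ?thesis
    proof (cases "x \<in> cball 0 (\<rho> + \<delta>)")
      case True
      have "F x \<le> w\<^sup>2" unfolding F_def using w \<eta>1 by (intro power_mono) auto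
      then show ?thesis using True sum_nn by simp
    next
      case False
      \<comment> \<open>Outside the enlarged ball the rounded point still satisfies |p| \<ge>
        \<rho>, so it belongs to \<open>P\<close> once it is inside the paraboloid.\<close>
      then have far: "\<rho> + \<delta> < norm x" by simp
      show ?thesis
      proof (cases "(1 + \<eta>) * (norm x)\<^sup>2 < w")
        case True
        let ?p = "rnd h x"
        have n1: "norm ?p \<le> norm x + \<delta>" "norm x \<le> norm ?p + \<delta>"
          using dist_le[of x] norm_triangle_sub[of x ?p] norm_triangle_sub[of ?p x] by (auto simp: norm_minus_commute)
        have "(norm ?p)\<^sup>2 \<le> (\<delta> + norm x)\<^sup>2" using n1(1) by (intro power_mono) auto
        also have "\<dots> \<le> (1 + 1 / \<eta>) * \<delta>\<^sup>2 + (1 + \<eta>) * (norm x)\<^sup>2" by (rule square_add_le_weighted[OF \<eta>])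
        finally have le: "w - (1 + \<eta>) * (norm x)\<^sup>2 \<le> z - (norm ?p)\<^sup>2" unfolding w_def by simp
        have p: "?p \<in> P" unfolding P_def using le True far n1(2) by auto
        have "F x = (w - (1 + \<eta>) * (norm x)\<^sup>2)\<^sup>2" unfolding F_def using True by simp
        also have "\<dots> \<le> (z - (norm ?p)\<^sup>2)\<^sup>2" using le True by (intro power_mono) auto
        also have "\<dots> = indicator (cell h ?p) x * (z - (norm ?p)\<^sup>2)\<^sup>2" by (simp add: cell_def)
        also have "\<dots> \<le> (\<Sum>p\<in>P. indicator (cell h p) x * (z - (norm p)\<^sup>2)\<^sup>2)"
          using fin p by (intro member_le_sum) auto
        finally show ?thesis using \<open>x \<notin> cball 0 (\<rho> + \<delta>)\<close> by simp
      next
        case False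
        then have "F x = 0" unfolding F_def by (simp add: max_def)
        then show ?thesis using sum_nn by simp
      qed
    qed
  qed
  have i1: "integrable lborel (\<lambda>x::'a. w\<^sup>2 * indicator (cball 0 (\<rho> + \<delta>)) x :: real)"
    using emeasure_lborel_cball_finite[of "0::'a" "\<rho> + \<delta>"] by (intro integrable_mult_right integrable_real_indicator) auto
  have i2: "integrable lborel (\<lambda>x. indicator (cell h p) x * (z - (norm p)\<^sup>2)\<^sup>2 :: real)" if "p \<in> P" for p
    using cellm(1)[OF that] by (intro integrable_mult_left integrable_real_indicator) auto
  have "(\<integral>x. F x \<partial>lborel) \<le> (\<integral>x. w\<^sup>2 * indicator (cball 0 (\<rho> + \<delta>)) x + (\<Sum>p\<in>P. indicator (cell h p) x * (z - (norm p)\<^sup>2)\<^sup>2) \<partial>lborel)"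
    using tp(1) i1 i2 pt by (intro integral_mono Bochner_Integration.integrable_add Bochner_Integration.integrable_sum) auto
  also have "\<dots> = w\<^sup>2 * measure lborel (cball (0::'a) (\<rho> + \<delta>)) + (\<Sum>p\<in>P. h ^ DIM('a) * (z - (norm p)\<^sup>2)\<^sup>2)"
    using i1 i2 cellm(2)
    by (subst Bochner_Integration.integral_add)
       (auto simp: Bochner_Integration.integral_sum intro!: Bochner_Integration.integrable_sum)
  finally show "8 / ((real DIM('a) + 2) * (real DIM('a) + 4)) * unit_ball_vol (real DIM('a)) * w\<^sup>2 * sqrt (w / (1 + \<eta>)) ^ DIM('a)
       - w\<^sup>2 * measure lborel (cball (0::'a) (\<rho> + \<delta>)) \<le> h ^ DIM('a) * (\<Sum>p\<in>P. (z - (norm p)\<^sup>2)\<^sup>2)"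
    unfolding tp(2) by (simp add: sum_distrib_left)
qed

text \<open>After normalisation everything depends on (z - c)/z, which tends to 1, except that the
  term with \<open>V\<close> keeps a factor z^(-d/2) and disappears.\<close>

lemma paraboloid_bound_asymptotics:
  fixes \<kappa> V c \<alpha> :: real and d :: nat
  assumes \<alpha>: "0 < \<alpha>" and d: "0 < d"
  shows "((\<lambda>z. (\<kappa> * (z - c)\<^sup>2 * sqrt ((z - c) / \<alpha>) ^ d - (z - c)\<^sup>2 * V) * z powr (- 2 - real d / 2))
     \<longlongrightarrow> \<kappa> / sqrt \<alpha> ^ d) at_top"
proof -
  have r: "((\<lambda>z. (z - c) / z) \<longlongrightarrow> 1) at_top"
  proof -
    have "((\<lambda>z::real. 1 - c / z) \<longlongrightarrow> 1 - 0) at_top"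
      by (intro tendsto_diff tendsto_const tendsto_divide_0[OF tendsto_const] filterlim_at_top_imp_at_infinity filterlim_ident)
    moreover have "\<forall>\<^sub>F z in at_top. 1 - c / z = (z - c) / z"
      using eventually_gt_at_top[of 0] by eventually_elim (simp add: field_simps)
    ultimately show ?thesis by (simp add: tendsto_cong)
  qed
  have p0: "((\<lambda>z::real. z powr (- (real d / 2))) \<longlongrightarrow> 0) at_top"
    using d by (intro tendsto_neg_powr filterlim_ident) simp
  have "((\<lambda>z. \<kappa> * ((z - c) / z)\<^sup>2 * (sqrt ((z - c) / z) / sqrt \<alpha>) ^ d - ((z - c) / z)\<^sup>2 * V * z powr (- (real d / 2)))
      \<longlongrightarrow> \<kappa> * 1\<^sup>2 * (sqrt 1 / sqrt \<alpha>) ^ d - 1\<^sup>2 * V * 0) at_top"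
    using \<alpha> by (intro tendsto_intros r p0) auto
  moreover have "\<forall>\<^sub>F z in at_top. \<kappa> * ((z - c) / z)\<^sup>2 * (sqrt ((z - c) / z) / sqrt \<alpha>) ^ d - ((z - c) / z)\<^sup>2 * V * z powr (- (real d / 2))
      = (\<kappa> * (z - c)\<^sup>2 * sqrt ((z - c) / \<alpha>) ^ d - (z - c)\<^sup>2 * V) * z powr (- 2 - real d / 2)"
    using eventually_gt_at_top[of 0]
  proof eventually_elim
    case (elim z)
    have z2: "z powr (- 2 - real d / 2) = z powr (- (real d / 2)) / z\<^sup>2"
    proof -
      have "- 2 - real d / 2 = - (real d / 2) - 2" by linarith
      then have "z powr (- 2 - real d / 2) = z powr (- (real d / 2) - 2)" by (rule arg_cong)
      also have "\<dots> = z powr (- (real d / 2)) / z powr 2" by (rule powr_diff)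
      also have "z powr 2 = z\<^sup>2" using elim by simp
      finally show ?thesis .
    qed
    have zd: "z powr (- (real d / 2)) = 1 / sqrt z ^ d"
    proof -
      have "sqrt z ^ d = sqrt z powr real d" by (rule powr_realpow[symmetric]) (use elim in simp)
      also have "\<dots> = z powr (1 / 2 * real d)" unfolding powr_half_sqrt[OF less_imp_le[OF elim], symmetric] by (rule powr_powr)
      finally have "sqrt z ^ d = z powr (real d / 2)" by simp
      then show ?thesis by (simp only: powr_minus inverse_eq_divide)
    qed
    have s: "sqrt ((z - c) / z) / sqrt \<alpha> = sqrt ((z - c) / \<alpha>) / sqrt z"
      by (simp add: real_sqrt_divide)
    have "(\<kappa> * Z * S - Z * V) * (1 / T / Q) = \<kappa> * (Z / Q) * (S / T) - Z / Q * V * (1 / T)" for Z S T Q :: real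
      by (simp add: divide_inverse algebra_simps)
    then show ?case unfolding z2 zd s power_divide by simp
  qed
  ultimately have "((\<lambda>z. (\<kappa> * (z - c)\<^sup>2 * sqrt ((z - c) / \<alpha>) ^ d - (z - c)\<^sup>2 * V) * z powr (- 2 - real d / 2))
     \<longlongrightarrow> \<kappa> * 1\<^sup>2 * (sqrt 1 / sqrt \<alpha>) ^ d - 1\<^sup>2 * V * 0) at_top"
    by (rule Lim_transform_eventually)
  then show ?thesis by (simp add: power_divide)
qed

context cutoff_domain
begin

text \<open>For a fixed cutoff and fixed \<eta> all constants are independent of z, so letting z
  grow removes the shift and the omitted low frequencies. What remains are the mass
  \<open>m0\<close> in place of the volume and factors tending to 1 with \<eta>.\<close>

lemma Liminf_R2_cutoff:
  assumes \<eta>: "0 < \<eta>"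
  shows "ereal (m0 * (8 / ((real DIM('a) + 2) * (real DIM('a) + 4)) * unit_ball_vol (real DIM('a)))
      / ((2 * pi) ^ DIM('a) * (1 + 2 * \<eta>) * sqrt (1 + \<eta>) ^ DIM('a)))
    \<le> Liminf at_top (\<lambda>z. ereal (R2 \<Omega> z * z powr (- 2 - real DIM('a) / 2)))"
proof -
  define \<kappa> where "\<kappa> = 8 / ((real DIM('a) + 2) * (real DIM('a) + 4)) * unit_ball_vol (real DIM('a))"
  have "bounded {x. \<phi> x \<noteq> 0}" using test unfolding test_fun_def compact_closure by blast
  then obtain r where r: "0 < r" "closure {x. \<phi> x \<noteq> 0} \<subseteq> cball 0 r"
    using bounded_closure[of "{x. \<phi> x \<noteq> 0}"] bounded_pos[of "closure {x. \<phi> x \<noteq> 0}"] by (auto simp: subset_iff)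
  \<comment> \<open>The cube then has half side r and contains the support of \<phi>, as Bessel's
    inequality on the cube requires.\<close>
  define h where "h = pi / r"
  have h: "0 < h" "pi / h = r" unfolding h_def using r(1) by auto
  have supp: "x \<notin> closure {x. \<phi> x \<noteq> 0}" if "x \<notin> cube h" for x
  proof
    assume "x \<in> closure {x. \<phi> x \<noteq> 0}"
    then have x: "norm x \<le> r" using r(2) by auto
    have "- r \<le> x \<bullet> b \<and> x \<bullet> b \<le> r" if "b \<in> Basis" for b
      using Basis_le_norm[OF that, of x] x by (simp add: abs_le_iff)
    then have "x \<in> cube h" unfolding cube_def h(2) by (simp add: mem_box)
    then show False using that by contradiction
  qed
  obtain S where S: "0 \<le> S" "\<And>x. norm (grad \<phi> x) \<le> S" using Cc_bounded[OF Cc_trial_data(2)] by blast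
  \<comment> \<open>The low-frequency cutoff is taken just large enough that the gradient error is
    at most \<eta>, with 1 added for the Rayleigh estimate, which requires |p| \<ge> 1.\<close>
  define \<rho> where "\<rho> = 1 + S * sqrt ((1 + 1 / \<eta>) / \<eta>)"
  have \<rho>: "1 \<le> \<rho>" unfolding \<rho>_def using S(1) \<eta> by simp
  have q: "(1 + 1 / \<eta>) * S\<^sup>2 / \<rho>\<^sup>2 \<le> \<eta>"
  proof -
    have "S\<^sup>2 * ((1 + 1 / \<eta>) / \<eta>) = (S * sqrt ((1 + 1 / \<eta>) / \<eta>))\<^sup>2" using \<eta> by (simp add: power_mult_distrib)
    also have "\<dots> \<le> \<rho>\<^sup>2" unfolding \<rho>_def using S(1) \<eta> by (intro power_mono) auto
    finally have "(1 + 1 / \<eta>) * S\<^sup>2 \<le> \<eta> * \<rho>\<^sup>2" using \<eta> by (simp add: field_simps)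
    moreover have "0 < \<rho>\<^sup>2" using \<rho> by simp
    ultimately show ?thesis by (simp add: pos_divide_le_eq)
  qed
  define \<delta> where "\<delta> = real DIM('a) * h"
  define c where "c = shift + (1 + 1 / \<eta>) * \<delta>\<^sup>2"
  have shift: "0 \<le> shift" unfolding shift_def using energies_nonneg by simp
  have c0: "0 \<le> c" unfolding c_def using shift \<eta> by simp
  define V where "V = measure lborel (cball (0::'a) (\<rho> + \<delta>))"
  define A where "A = m0 / ((2 * pi) ^ DIM('a) * (1 + 2 * \<eta>))"
  have A0: "0 \<le> A" unfolding A_def using energies_nonneg \<eta> by simp
  have bound: "A * (\<kappa> * (z - c)\<^sup>2 * sqrt ((z - c) / (1 + \<eta>)) ^ DIM('a) - (z - c)\<^sup>2 * V) \<le> R2 \<Omega> z" if z: "c < z" for z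
  proof -
    define P where "P = {p \<in> range (rnd h :: 'a \<Rightarrow> 'a). \<rho> \<le> norm p \<and> (norm p)\<^sup>2 \<le> z - shift}"
    have wz: "z - shift - (1 + 1 / \<eta>) * (real DIM('a) * h)\<^sup>2 = z - c" unfolding c_def \<delta>_def by simp
    have w0: "0 < z - shift - (1 + 1 / \<eta>) * (real DIM('a) * h)\<^sup>2" unfolding wz using z by simp
    note low = lattice_sum_lower_bound[OF h(1) \<eta> w0, where \<rho> = \<rho>, folded P_def \<delta>_def, unfolded wz[folded \<delta>_def], folded V_def \<kappa>_def]
    define \<Sigma> where "\<Sigma> = (\<Sum>p\<in>P. (z - shift - (norm p)\<^sup>2)\<^sup>2)"
    have R20: "0 \<le> R2 \<Omega> z" unfolding R2_def by (intro sum_nonneg) auto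
    have "m0 * \<Sigma> \<le> (2 * pi / h) ^ DIM('a) * ((1 + \<eta>) + (1 + 1 / \<eta>) * S\<^sup>2 / \<rho>\<^sup>2) * R2 \<Omega> z"
      unfolding \<Sigma>_def using z c0
      by (intro R2_lattice_lower_bound[OF h(1) low(1) _ supp \<rho> _ \<eta> S(2)]) (auto simp: P_def)
    also have "\<dots> \<le> (2 * pi / h) ^ DIM('a) * (1 + 2 * \<eta>) * R2 \<Omega> z"
      using q h(1) R20 by (intro mult_right_mono mult_left_mono) auto
    \<comment> \<open>Multiplication by the cell volume h^d turns (2 pi/h)^d into (2 pi)^d, so the
      auxiliary cube drops out of the leading constant.\<close>
    finally have "h ^ DIM('a) * (m0 * \<Sigma>) \<le> h ^ DIM('a) * ((2 * pi / h) ^ DIM('a) * (1 + 2 * \<eta>) * R2 \<Omega> z)"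
      using h(1) by (intro mult_left_mono) auto
    also have "\<dots> = (2 * pi) ^ DIM('a) * (1 + 2 * \<eta>) * R2 \<Omega> z" using h(1) by (simp add: power_divide)
    finally have up: "m0 * (h ^ DIM('a) * \<Sigma>) \<le> ((2 * pi) ^ DIM('a) * (1 + 2 * \<eta>)) * R2 \<Omega> z" by (simp add: mult_ac)
    have pos: "0 < (2 * pi) ^ DIM('a) * (1 + 2 * \<eta>)" using \<eta> by simp
    have "A * (\<kappa> * (z - c)\<^sup>2 * sqrt ((z - c) / (1 + \<eta>)) ^ DIM('a) - (z - c)\<^sup>2 * V) \<le> A * (h ^ DIM('a) * \<Sigma>)"
      unfolding \<Sigma>_def by (rule mult_left_mono[OF low(2) A0])
    also have "\<dots> = m0 * (h ^ DIM('a) * \<Sigma>) / ((2 * pi) ^ DIM('a) * (1 + 2 * \<eta>))" unfolding A_def by simp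
    also have "\<dots> \<le> R2 \<Omega> z" using up pos by (simp add: pos_divide_le_eq mult.commute)
    finally show ?thesis .
  qed
  define L where "L = (\<lambda>z. A * ((\<kappa> * (z - c)\<^sup>2 * sqrt ((z - c) / (1 + \<eta>)) ^ DIM('a) - (z - c)\<^sup>2 * V) * z powr (- 2 - real DIM('a) / 2)))"
  have "(L \<longlongrightarrow> A * (\<kappa> / sqrt (1 + \<eta>) ^ DIM('a))) at_top"
    unfolding L_def using \<eta> by (intro tendsto_mult_left paraboloid_bound_asymptotics) auto
  then have "((\<lambda>z. ereal (L z)) \<longlongrightarrow> ereal (A * (\<kappa> / sqrt (1 + \<eta>) ^ DIM('a)))) at_top" by simp
  then have "ereal (A * (\<kappa> / sqrt (1 + \<eta>) ^ DIM('a))) = Liminf at_top (\<lambda>z. ereal (L z))"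
    by (rule lim_imp_Liminf[OF trivial_limit_at_top_linorder, symmetric])
  also have "\<dots> \<le> Liminf at_top (\<lambda>z. ereal (R2 \<Omega> z * z powr (- 2 - real DIM('a) / 2)))"
  proof (rule Liminf_mono)
    show "\<forall>\<^sub>F z in at_top. ereal (L z) \<le> ereal (R2 \<Omega> z * z powr (- 2 - real DIM('a) / 2))"
      using eventually_gt_at_top[of c]
    proof eventually_elim
      case (elim z)
      show ?case using mult_right_mono[OF bound[OF elim], of "z powr (- 2 - real DIM('a) / 2)"]
        unfolding L_def by (simp add: mult.assoc)
    qed
  qed
  also have "A * (\<kappa> / sqrt (1 + \<eta>) ^ DIM('a)) = m0 * \<kappa> / ((2 * pi) ^ DIM('a) * (1 + 2 * \<eta>) * sqrt (1 + \<eta>) ^ DIM('a))"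
    unfolding A_def by simp
  finally show ?thesis unfolding \<kappa>_def .
qed

end

theorem theorem2p4:
  fixes \<Omega> :: "'a::euclidean_space set"
  assumes "open \<Omega>" and "connected \<Omega>" and "\<Omega> \<noteq> {}"
    and "condition_M \<Omega>"
  shows "Liminf at_top (\<lambda>z. ereal (R2 \<Omega> z * z powr (- 2 - real DIM('a) / 2)))
           \<ge> ereal (8 / ((real DIM('a) + 2) * (real DIM('a) + 4)) * (2 * pi) powr (- real DIM('a))
                    * measure lebesgue (ball (0::'a) 1) * measure lebesgue \<Omega>)"
proof -
  let ?d = "DIM('a)" and ?v = "unit_ball_vol (real DIM('a))"
  define \<kappa> where "\<kappa> = 8 / ((real ?d + 2) * (real ?d + 4)) * ?v"
  define m where "m = measure lborel \<Omega>"
  have fin: "emeasure lebesgue \<Omega> < \<infinity>" using assms(4) by (simp add: condition_M_def)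
  interpret finite_volume_domain \<Omega> by unfold_locales (fact assms(1), fact fin)
  \<comment> \<open>Positive volume guarantees, for small tolerances, a cutoff of positive mass, as
    \<open>cutoff_domain\<close> demands.\<close>
  have m0: "0 < m"
  proof -
    obtain x e where e: "0 < e" "ball x e \<subseteq> \<Omega>" using assms(1,3) openE by (metis ex_in_conv)
    have "0 < measure lborel (ball x e)" using e(1) by (simp add: content_ball_gt_0_iff)
    also have "\<dots> \<le> m"
      unfolding m_def using e(2) \<Omega>_borel emeasure_lborel_\<Omega> by (intro measure_mono_fmeasurable) (auto simp: fmeasurable_def)
    finally show ?thesis .
  qed
  \<comment> \<open>The bound obtained when the volume defect of the cutoff and the parameter \<eta>
    are both 1/(n+1); the two errors vanish together in the limit.\<close>
  define a where "a = (\<lambda>n. (m - 1 / real (Suc n)) * \<kappa> / ((2 * pi) ^ ?d * (1 + 2 * (1 / real (Suc n))) * sqrt (1 + 1 / real (Suc n)) ^ ?d))"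
  have \<kappa>0: "0 \<le> \<kappa>" unfolding \<kappa>_def by simp
  have inv: "(\<lambda>n. 1 / real (Suc n)) \<longlonglongrightarrow> 0" using LIMSEQ_inverse_real_of_nat by (simp add: inverse_eq_divide)
  have "a \<longlonglongrightarrow> (m - 0) * \<kappa> / ((2 * pi) ^ ?d * (1 + 2 * 0) * sqrt (1 + 0) ^ ?d)"
    unfolding a_def by (intro tendsto_intros inv) auto
  then have lim: "(\<lambda>n. ereal (a n)) \<longlonglongrightarrow> ereal (m * \<kappa> / (2 * pi) ^ ?d)" by simp
  have "\<forall>\<^sub>F n in sequentially. 1 / real (Suc n) < m" using order_tendstoD(2)[OF inv m0] .
  then have ev: "\<forall>\<^sub>F n in sequentially. ereal (a n) \<le> Liminf at_top (\<lambda>z. ereal (R2 \<Omega> z * z powr (- 2 - real ?d / 2)))"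
  proof eventually_elim
    case (elim n)
    let ?\<epsilon> = "1 / real (Suc n)"
    obtain \<phi> where \<phi>: "elem_smooth \<phi>" "test_fun \<Omega> \<phi>" "\<And>x. 0 \<le> \<phi> x" "\<And>x. \<phi> x \<le> 1"
      "m - ?\<epsilon> < (\<integral>x. (\<phi> x)\<^sup>2 \<partial>lborel)"
      unfolding m_def by (rule exists_cutoff[OF assms(1) emeasure_lborel_\<Omega>, of ?\<epsilon>]) auto
    interpret cutoff_domain \<Omega> \<phi>
      by unfold_locales (use \<phi> elim in auto)
    have "a n \<le> m0 * \<kappa> / ((2 * pi) ^ ?d * (1 + 2 * ?\<epsilon>) * sqrt (1 + ?\<epsilon>) ^ ?d)"
      unfolding a_def m0_def using \<phi>(5) \<kappa>0 by (intro divide_right_mono mult_right_mono) auto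
    then have "ereal (a n) \<le> ereal (m0 * \<kappa> / ((2 * pi) ^ ?d * (1 + 2 * ?\<epsilon>) * sqrt (1 + ?\<epsilon>) ^ ?d))" by simp
    also have "\<dots> \<le> Liminf at_top (\<lambda>z. ereal (R2 \<Omega> z * z powr (- 2 - real ?d / 2)))"
      unfolding \<kappa>_def by (rule Liminf_R2_cutoff) simp
    finally show ?case .
  qed
  have "ereal (m * \<kappa> / (2 * pi) ^ ?d) \<le> Liminf at_top (\<lambda>z. ereal (R2 \<Omega> z * z powr (- 2 - real ?d / 2)))"
    by (rule tendsto_upperbound[OF lim ev]) simp
  moreover have "measure lebesgue (ball (0::'a) 1) = ?v" "measure lebesgue \<Omega> = m"
    unfolding m_def using \<Omega>_borel by (simp_all add: content_ball)
  moreover have "(2 * pi) powr (- real ?d) = 1 / (2 * pi) ^ ?d"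
    by (simp add: powr_minus powr_realpow divide_inverse)
  ultimately show ?thesis unfolding \<kappa>_def by (simp add: mult_ac)
qed

end
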